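(* Let $A\#_R B$ be a strong smash product algebra, with $R: B\otimes A\to A\otimes B$ bijective, quasitriangular and normal. Then $A\natural B=(\{A\natural B(p,q)\}_{p,q\ge 0}, d_i, s_i, t, \bar d_j, \bar s_j,\bar t)$, where $A\natural B(p,q)=B^{\otimes (p+1)}\otimes A^{\otimes (q+1)}$ with the operators given in the context, is a cylindrical module.
   Context: Conventions: $k$ is a field containing $\mathbb{Q}$, $\otimes=\otimes_k$, all algebras are unital associative $k$-algebras, and tensors are written with commas or bars. Strong smash product algebras. Let $A,B$ be algebras with multiplications $m_A,m_B$. For a linear map $R:B\otimes A\to A\otimes B$, $R_{i,i+1}$ denotes $R$ applied to tensor factors $i,i+1$. $R$ is quasitriangular if $R\circ(m_B\otimes id)=(id\otimes m_B)R_{12}R_{23}$ on $B\otimes B\otimes A$ and $R\circ(id\otimes m_A)=(m_A\otimes id)R_{23}R_{12}$ on $B\otimes A\otimes A$; it is normal if $R(1\otimes a)=a\otimes 1$ and $R(b\otimes 1)=1\otimes b$ for all $a\in A,b\in B$. For quasitriangular and normal $R$, the smash product algebra $A\#_R B$ is $A\otimes B$ with product $(a\otimes b)(a'\otimes b')=aR(b\otimes a')b'$; it is strong if $R$ is bijective. Paracyclic and cylindrical modules. A paracyclic module is a simplicial module $(C_n,d_i,s_i)_{n\ge0}$ with invertible maps $t_n:C_n\to C_n$ such that $d_it_n=t_{n-1}d_{i-1}$ and $s_it_n=t_{n+1}s_{i-1}$ for $1\le i\le n$, $d_0t_n=d_n$, and $s_0t_n=t_{n+1}^2s_n$. It is a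 cyclic module if moreover $t_n^{n+1}=id$ for all $n$. A bi-paracyclic module is a family $\{C_{p,q}\}_{p,q\ge 0}$ with unbarred operators $d_i,s_i,t$ making $C_{\bullet,q}$ paracyclic for each $q$, and barred operators $\bar d_j,\bar s_j,\bar t$ making $C_{p,\bullet}$ paracyclic for each $p$, such that all unbarred operators commute with all barred ones. It is a cylindrical module if moreover $t_{p,q}^{p+1}\bar t_{p,q}^{\,q+1}=id$ for all $p,q\ge0$. Operators on $A\natural B(p,q)=B^{\otimes(p+1)}\otimes A^{\otimes(q+1)}$. Put $\Theta_q=R_{q+1,q+2}\cdots R_{23}R_{12}: B\otimes A^{\otimes(q+1)}\to A^{\otimes (q+1)}\otimes B$, $\Gamma_p=R^{-1}_{p+1,p+2}\cdots R^{-1}_{23}R^{-1}_{12}: A\otimes B^{\otimes(p+1)}\to B^{\otimes (p+1)}\otimes A$, and $f^{m,n}(c_1,\ldots,c_m,c_1',\ldots,c_n')=(c_1',\ldots,c_n',c_1,\ldots,c_m)$. Then $t_{p,q}(b_0,\ldots,b_p\,|\,a_0,\ldots,a_q)=f^{p+q+1,1}(b_0,\ldots,b_{p-1},\Theta_q(b_p,a_0,\ldots,a_q))$; $d_i^{p,q}(b_0,\ldots,b_p|a_0,\ldots,a_q)=(b_0,\ldots,b_ib_{i+1},\ldots,b_p|a_0,\ldots,a_q)$ for $0\le i<p$, and $d_p^{p,q}=d_0^{p,q}t_{p,q}$; $s_i^{p,q}(b_0,\ldots,b_p|a_0,\ldots,a_q)=(b_0,\ldots,b_i,1,b_{i+1},\ldots,b_p|a_0,\ldots,a_q)$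 for $0\le i\le p$; $\bar t_{p,q}(b_0,\ldots,b_p|a_0,\ldots,a_q)=(\Gamma_p(a_q,b_0,\ldots,b_p),a_0,\ldots,a_{q-1})$; $\bar d_j^{p,q}(b_0,\ldots,b_p|a_0,\ldots,a_q)=(b_0,\ldots,b_p|a_0,\ldots,a_ja_{j+1},\ldots,a_q)$ for $0\le j<q$, and $\bar d_q^{p,q}=\bar d_0^{p,q}\bar t_{p,q}$; $\bar s_j^{p,q}(b_0,\ldots,b_p|a_0,\ldots,a_q)=(b_0,\ldots,b_p|a_0,\ldots,a_j,1,a_{j+1},\ldots,a_q)$ for $0\le j\le q$. *)

theory Defs
  imports Complex_Main "HOL-Library.Function_Algebras"
begin

section \<open>Algebras and linear maps\<close>

text \<open>The sort \<open>{ring, monoid_mult}\<close> is used instead of \<open>ring_1\<close> because the latter excludes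
  the zero algebra.\<close>

locale assoc_algebra = vector_space scale
  for scale :: "'k::field \<Rightarrow> 'a::{ring,monoid_mult} \<Rightarrow> 'a" +
  assumes scale_mult_left: "scale c x * y = scale c (x * y)"
    and mult_scale_right: "x * scale c y = scale c (x * y)"

definition linear_on ::
  "('k \<Rightarrow> 'v \<Rightarrow> 'v) \<Rightarrow> ('k \<Rightarrow> 'w \<Rightarrow> 'w) \<Rightarrow> 'v set \<Rightarrow> 'w set \<Rightarrow> ('v::plus \<Rightarrow> 'w::plus) \<Rightarrow> bool"
where
  "linear_on s1 s2 V W f \<longleftrightarrow>
     (\<forall>x\<in>V. f x \<in> W) \<and>
     (\<forall>x\<in>V. \<forall>y\<in>V. f (x + y) = f x + f y) \<and>
     (\<forall>c. \<forall>x\<in>V. f (s1 c x) = s2 c (f x))"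


section \<open>Paracyclic and cylindrical modules\<close>

text \<open>The modules \<open>C n\<close> are submodules of one ambient module, and \<open>d n i\<close>, \<open>s n i\<close>, \<open>t n\<close> are the
  operators with source \<open>C n\<close>; their values outside \<open>C n\<close>, or for indices out of range, are
  irrelevant.\<close>

locale simplicial_module = module scale
  for scale :: "'r::comm_ring_1 \<Rightarrow> 'c::ab_group_add \<Rightarrow> 'c" +
  fixes C :: "nat \<Rightarrow> 'c set"
    and d s :: "nat \<Rightarrow> nat \<Rightarrow> 'c \<Rightarrow> 'c"
  assumes subspace_C: "subspace (C n)"
    and linear_d: "1 \<le> n \<Longrightarrow> i \<le> n \<Longrightarrow> linear_on scale scale (C n) (C (n - 1)) (d n i)"
    and linear_s: "i \<le> n \<Longrightarrow> linear_on scale scale (C n) (C (n + 1)) (s n i)"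
    and d_d: "2 \<le> n \<Longrightarrow> i < j \<Longrightarrow> j \<le> n \<Longrightarrow> x \<in> C n \<Longrightarrow>
      d (n - 1) i (d n j x) = d (n - 1) (j - 1) (d n i x)"
    and s_s: "i \<le> j \<Longrightarrow> j \<le> n \<Longrightarrow> x \<in> C n \<Longrightarrow>
      s (n + 1) i (s n j x) = s (n + 1) (j + 1) (s n i x)"
    and d_s_less: "i < j \<Longrightarrow> j \<le> n \<Longrightarrow> x \<in> C n \<Longrightarrow>
      d (n + 1) i (s n j x) = s (n - 1) (j - 1) (d n i x)"
    and d_s_same: "j \<le> n \<Longrightarrow> i = j \<or> i = j + 1 \<Longrightarrow> x \<in> C n \<Longrightarrow>
      d (n + 1) i (s n j x) = x"
    and d_s_greater: "j + 1 < i \<Longrightarrow> i \<le> n + 1 \<Longrightarrow> x \<in> C n \<Longrightarrow>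
      d (n + 1) i (s n j x) = s (n - 1) j (d n (i - 1) x)"

locale paracyclic_module = simplicial_module scale C d s
  for scale :: "'r::comm_ring_1 \<Rightarrow> 'c::ab_group_add \<Rightarrow> 'c"
    and C :: "nat \<Rightarrow> 'c set"
    and d s :: "nat \<Rightarrow> nat \<Rightarrow> 'c \<Rightarrow> 'c" +
  fixes t :: "nat \<Rightarrow> 'c \<Rightarrow> 'c"
  assumes linear_t: "linear_on scale scale (C n) (C n) (t n)"
    and bij_t: "bij_betw (t n) (C n) (C n)"
    and d_t: "1 \<le> i \<Longrightarrow> i \<le> n \<Longrightarrow> x \<in> C n \<Longrightarrow> d n i (t n x) = t (n - 1) (d n (i - 1) x)"
    and s_t: "1 \<le> i \<Longrightarrow> i \<le> n \<Longrightarrow> x \<in> C n \<Longrightarrow> s n i (t n x) = t (n + 1) (s n (i - 1) x)"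
    and d_0_t: "1 \<le> n \<Longrightarrow> x \<in> C n \<Longrightarrow> d n 0 (t n x) = d n n x"
    and s_0_t: "x \<in> C n \<Longrightarrow> s n 0 (t n x) = t (n + 1) (t (n + 1) (s n n x))"

locale bi_paracyclic_module =
  fixes scale :: "'r::comm_ring_1 \<Rightarrow> 'c::ab_group_add \<Rightarrow> 'c"
    and C :: "nat \<Rightarrow> nat \<Rightarrow> 'c set"
    and d s :: "nat \<Rightarrow> nat \<Rightarrow> nat \<Rightarrow> 'c \<Rightarrow> 'c"
    and t :: "nat \<Rightarrow> nat \<Rightarrow> 'c \<Rightarrow> 'c"
    and d' s' :: "nat \<Rightarrow> nat \<Rightarrow> nat \<Rightarrow> 'c \<Rightarrow> 'c"
    and t' :: "nat \<Rightarrow> nat \<Rightarrow> 'c \<Rightarrow> 'c"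
  assumes paracyclic_unbarred:
      "paracyclic_module scale (\<lambda>p. C p q) (\<lambda>p. d p q) (\<lambda>p. s p q) (\<lambda>p. t p q)"
    and paracyclic_barred:
      "paracyclic_module scale (C p) (d' p) (s' p) (t' p)"
    and d_d': "1 \<le> p \<Longrightarrow> 1 \<le> q \<Longrightarrow> i \<le> p \<Longrightarrow> j \<le> q \<Longrightarrow> x \<in> C p q \<Longrightarrow>
      d p (q - 1) i (d' p q j x) = d' (p - 1) q j (d p q i x)"
    and d_s': "1 \<le> p \<Longrightarrow> i \<le> p \<Longrightarrow> j \<le> q \<Longrightarrow> x \<in> C p q \<Longrightarrow>
      d p (q + 1) i (s' p q j x) = s' (p - 1) q j (d p q i x)"
    and d_t': "1 \<le> p \<Longrightarrow> i \<le> p \<Longrightarrow> x \<in> C p q \<Longrightarrow>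
      d p q i (t' p q x) = t' (p - 1) q (d p q i x)"
    and s_d': "1 \<le> q \<Longrightarrow> i \<le> p \<Longrightarrow> j \<le> q \<Longrightarrow> x \<in> C p q \<Longrightarrow>
      s p (q - 1) i (d' p q j x) = d' (p + 1) q j (s p q i x)"
    and s_s': "i \<le> p \<Longrightarrow> j \<le> q \<Longrightarrow> x \<in> C p q \<Longrightarrow>
      s p (q + 1) i (s' p q j x) = s' (p + 1) q j (s p q i x)"
    and s_t': "i \<le> p \<Longrightarrow> x \<in> C p q \<Longrightarrow>
      s p q i (t' p q x) = t' (p + 1) q (s p q i x)"
    and t_d': "1 \<le> q \<Longrightarrow> j \<le> q \<Longrightarrow> x \<in> C p q \<Longrightarrow>
      t p (q - 1) (d' p q j x) = d' p q j (t p q x)"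
    and t_s': "j \<le> q \<Longrightarrow> x \<in> C p q \<Longrightarrow>
      t p (q + 1) (s' p q j x) = s' p q j (t p q x)"
    and t_t': "x \<in> C p q \<Longrightarrow>
      t p q (t' p q x) = t' p q (t p q x)"

locale cylindrical_module = bi_paracyclic_module scale C d s t d' s' t'
  for scale :: "'r::comm_ring_1 \<Rightarrow> 'c::ab_group_add \<Rightarrow> 'c"
    and C :: "nat \<Rightarrow> nat \<Rightarrow> 'c set"
    and d s :: "nat \<Rightarrow> nat \<Rightarrow> nat \<Rightarrow> 'c \<Rightarrow> 'c"
    and t :: "nat \<Rightarrow> nat \<Rightarrow> 'c \<Rightarrow> 'c"
    and d' s' :: "nat \<Rightarrow> nat \<Rightarrow> nat \<Rightarrow> 'c \<Rightarrow> 'c"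
    and t' :: "nat \<Rightarrow> nat \<Rightarrow> 'c \<Rightarrow> 'c" +
  assumes cylindrical: "x \<in> C p q \<Longrightarrow> (t p q ^^ (p + 1)) ((t' p q ^^ (q + 1)) x) = x"


section \<open>Mixed tensor powers of two vector spaces\<close>

text \<open>
  A word over \<open>'a + 'b\<close> with letters \<open>Inl a\<close> (from \<open>A\<close>) and \<open>Inr b\<close> (from \<open>B\<close>) stands for a
  tuple of arguments. Its shape is a list of booleans, \<open>True\<close> for a factor \<open>A\<close> and \<open>False\<close> for a
  factor \<open>B\<close>. Only words of shape \<open>w\<close> matter in \<open>multilinear_on sA sB sW w f\<close>.
\<close>

definition multilinear_on ::
  "('k \<Rightarrow> 'a \<Rightarrow> 'a) \<Rightarrow> ('k \<Rightarrow> 'b \<Rightarrow> 'b) \<Rightarrow> ('k \<Rightarrow> 'w \<Rightarrow> 'w) \<Rightarrow> bool list \<Rightarrow>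
   (('a::plus + 'b::plus) list \<Rightarrow> 'w::plus) \<Rightarrow> bool"
where
  "multilinear_on sA sB sW w f \<longleftrightarrow>
     (\<forall>u v. map isl u @ True # map isl v = w \<longrightarrow>
        (\<forall>x y. f (u @ Inl (x + y) # v) = f (u @ Inl x # v) + f (u @ Inl y # v)) \<and>
        (\<forall>c x. f (u @ Inl (sA c x) # v) = sW c (f (u @ Inl x # v)))) \<and>
     (\<forall>u v. map isl u @ False # map isl v = w \<longrightarrow>
        (\<forall>x y. f (u @ Inr (x + y) # v) = f (u @ Inr x # v) + f (u @ Inr y # v)) \<and>
        (\<forall>c x. f (u @ Inr (sB c x) # v) = sW c (f (u @ Inr x # v))))"

text \<open>
  Over a field, a tensor product embeds into the dual of the space of multilinear forms on its
  factors. It is realised here as the span of the evaluations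
  \<open>x\<^sub>1 \<otimes> \<dots> \<otimes> x\<^sub>n = (\<lambda>\<phi>. \<phi> (x\<^sub>1, \<dots>, x\<^sub>n))\<close>; lemmas \<open>tensor_universal\<close> and \<open>tensor_universal_unique\<close>
  below give the universal property. An evaluation is set to \<open>0\<close> at functions that are not
  multilinear.
\<close>

type_synonym ('k, 'a, 'b) tensor = "(('a + 'b) list \<Rightarrow> 'k) \<Rightarrow> 'k"

definition tensor_scale :: "'k::field \<Rightarrow> ('k, 'a, 'b) tensor \<Rightarrow> ('k, 'a, 'b) tensor" where
  "tensor_scale c \<xi> = (\<lambda>\<phi>. c * \<xi> \<phi>)"

definition pure_tensor ::
  "('k::field \<Rightarrow> 'a \<Rightarrow> 'a) \<Rightarrow> ('k \<Rightarrow> 'b \<Rightarrow> 'b) \<Rightarrow> ('a::plus + 'b::plus) list \<Rightarrow> ('k, 'a, 'b) tensor"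
where
  "pure_tensor sA sB xs =
     (\<lambda>\<phi>. if multilinear_on sA sB (*) (map isl xs) \<phi> then \<phi> xs else 0)"

definition tensor_space ::
  "('k::field \<Rightarrow> 'a \<Rightarrow> 'a) \<Rightarrow> ('k \<Rightarrow> 'b \<Rightarrow> 'b) \<Rightarrow> bool list \<Rightarrow> ('k, 'a::plus, 'b::plus) tensor set"
where
  "tensor_space sA sB w = module.span tensor_scale (pure_tensor sA sB ` {xs. map isl xs = w})"

text \<open>
  For \<open>F\<close> multilinear on words of shape \<open>w\<close>, with values in a tensor space, \<open>tensor_lift F\<close> is the
  linear map induced on the tensor space of shape \<open>w\<close>; see \<open>tensor_lift_pure\<close>.
\<close>

definition tensor_lift ::
  "(('a + 'b) list \<Rightarrow> ('k, 'c, 'd) tensor) \<Rightarrow> ('k, 'a, 'b) tensor \<Rightarrow> ('k, 'c, 'd) tensor"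
where
  "tensor_lift F \<xi> = (\<lambda>\<phi>. \<xi> (\<lambda>xs. F xs \<phi>))"

lemma vector_space_tensor: "vector_space (tensor_scale :: 'k::field \<Rightarrow> ('k, 'a, 'b) tensor \<Rightarrow> _)"
  by unfold_locales (auto simp: tensor_scale_def fun_eq_iff algebra_simps)

interpretation tensor: vector_space "tensor_scale :: 'k::field \<Rightarrow> ('k, 'a, 'b) tensor \<Rightarrow> _"
  by (rule vector_space_tensor)

lemma tensor_space_induct [consumes 1, case_names zero step]:
  fixes sA :: "'k::field \<Rightarrow> 'a::plus \<Rightarrow> 'a" and sB :: "'k \<Rightarrow> 'b::plus \<Rightarrow> 'b"
  assumes \<xi>: "\<xi> \<in> tensor_space sA sB w"
    and zero: "P 0"
    and step: "\<And>c xs \<eta>. map isl xs = w \<Longrightarrow> \<eta> \<in> tensor_space sA sB w \<Longrightarrow> P \<eta> \<Longrightarrow>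
      P (tensor_scale c (pure_tensor sA sB xs) + \<eta>)"
  shows "P \<xi>"
proof -
  have "\<xi> \<in> tensor_space sA sB w \<and> P \<xi>"
    unfolding tensor_space_def
  proof (rule tensor.span_induct_alt[OF \<xi>[unfolded tensor_space_def]])
    show "0 \<in> tensor.span (pure_tensor sA sB ` {xs. map isl xs = w}) \<and> P 0"
      using zero by (metis tensor.span_zero)
  next
    fix c x y
    assume x: "x \<in> pure_tensor sA sB ` {xs. map isl xs = w}"
      and y: "y \<in> tensor.span (pure_tensor sA sB ` {xs. map isl xs = w}) \<and> P y"
    have "tensor_scale c x + y \<in> tensor.span (pure_tensor sA sB ` {xs. map isl xs = w})"
      using x y by (metis tensor.span_add tensor.span_scale tensor.span_base)
    moreover have "P (tensor_scale c x + y)"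
      using x y step unfolding tensor_space_def by blast
    ultimately show "tensor_scale c x + y \<in> tensor.span (pure_tensor sA sB ` {xs. map isl xs = w})
      \<and> P (tensor_scale c x + y)" by blast
  qed
  then show ?thesis by blast
qed

lemma tensor_space_closed:
  shows tensor_space_zero: "0 \<in> tensor_space sA sB w"
    and tensor_space_add: "\<xi> \<in> tensor_space sA sB w \<Longrightarrow> \<eta> \<in> tensor_space sA sB w \<Longrightarrow>
      \<xi> + \<eta> \<in> tensor_space sA sB w"
    and tensor_space_scale: "\<xi> \<in> tensor_space sA sB w \<Longrightarrow>
      tensor_scale c \<xi> \<in> tensor_space sA sB w"
    and tensor_space_pure: "map isl xs = w \<Longrightarrow> pure_tensor sA sB xs \<in> tensor_space sA sB w"
  unfolding tensor_space_def
  by (fact tensor.span_zero tensor.span_add tensor.span_scale)+ (blast intro: tensor.span_base)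

lemma pure_tensor_multilinear:
  fixes sA :: "'k::field \<Rightarrow> 'a::plus \<Rightarrow> 'a" and sB :: "'k \<Rightarrow> 'b::plus \<Rightarrow> 'b"
  shows "multilinear_on sA sB tensor_scale w (pure_tensor sA sB)"
  by (auto simp: multilinear_on_def pure_tensor_def tensor_scale_def fun_eq_iff)

lemma pure_tensor_letter:
  fixes sA :: "'k::field \<Rightarrow> 'a::plus \<Rightarrow> 'a" and sB :: "'k \<Rightarrow> 'b::plus \<Rightarrow> 'b"
  shows
    "pure_tensor sA sB (u @ Inl (x + y) # v) =
       pure_tensor sA sB (u @ Inl x # v) + pure_tensor sA sB (u @ Inl y # v)"
    "pure_tensor sA sB (u @ Inl (sA c x) # v) = tensor_scale c (pure_tensor sA sB (u @ Inl x # v))"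
    "pure_tensor sA sB (u @ Inr (x' + y') # v) =
       pure_tensor sA sB (u @ Inr x' # v) + pure_tensor sA sB (u @ Inr y' # v)"
    "pure_tensor sA sB (u @ Inr (sB c x') # v) = tensor_scale c (pure_tensor sA sB (u @ Inr x' # v))"
  using pure_tensor_multilinear[of sA sB "map isl u @ True # map isl v"]
    pure_tensor_multilinear[of sA sB "map isl u @ False # map isl v"]
  unfolding multilinear_on_def by blast+

lemma pure_tensor_letter_append:
  fixes sA :: "'k::field \<Rightarrow> 'a::plus \<Rightarrow> 'a" and sB :: "'k \<Rightarrow> 'b::plus \<Rightarrow> 'b"
  shows
    "pure_tensor sA sB (us @ u @ Inl (x + y) # v) =
       pure_tensor sA sB (us @ u @ Inl x # v) + pure_tensor sA sB (us @ u @ Inl y # v)"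
    "pure_tensor sA sB (us @ u @ Inl (sA c x) # v) =
       tensor_scale c (pure_tensor sA sB (us @ u @ Inl x # v))"
    "pure_tensor sA sB (us @ u @ Inr (x' + y') # v) =
       pure_tensor sA sB (us @ u @ Inr x' # v) + pure_tensor sA sB (us @ u @ Inr y' # v)"
    "pure_tensor sA sB (us @ u @ Inr (sB c x') # v) =
       tensor_scale c (pure_tensor sA sB (us @ u @ Inr x' # v))"
  using pure_tensor_letter[where u = "us @ u"] by simp_all

lemma pure_tensor_insert_multilinear:
  fixes sA :: "'k::field \<Rightarrow> 'a::plus \<Rightarrow> 'a" and sB :: "'k \<Rightarrow> 'b::plus \<Rightarrow> 'b"
  shows "multilinear_on sA sB tensor_scale w (\<lambda>xs. pure_tensor sA sB (us @ xs @ vs))"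
  by (simp add: multilinear_on_def pure_tensor_letter_append)

lemma multilinear_on_cong:
  assumes "\<And>xs. map isl xs = w \<Longrightarrow> f xs = g xs" and "multilinear_on sA sB sW w g"
  shows "multilinear_on sA sB sW w f"
proof -
  have "f (u @ Inl x # v) = g (u @ Inl x # v)" if "map isl u @ True # map isl v = w" for u v x
    using that by (intro assms(1)) simp
  moreover have "f (u @ Inr x # v) = g (u @ Inr x # v)" if "map isl u @ False # map isl v = w" for u v x
    using that by (intro assms(1)) simp
  ultimately show ?thesis using assms(2) unfolding multilinear_on_def by simp
qed

lemma tensor_lift_linear:
  fixes F :: "('a::plus + 'b::plus) list \<Rightarrow> ('k::field, 'c::plus, 'd::plus) tensor"
  assumes lift_pure: "\<And>xs. map isl xs = w \<Longrightarrow> tensor_lift F (pure_tensor sA sB xs) = F xs"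
    and F: "\<And>xs. map isl xs = w \<Longrightarrow> F xs \<in> tensor_space sC sD w'"
  shows "linear_on tensor_scale tensor_scale (tensor_space sA sB w) (tensor_space sC sD w')
           (tensor_lift F)"
proof -
  have add: "tensor_lift F (x + y) = tensor_lift F x + tensor_lift F y" for x y
    by (simp add: tensor_lift_def fun_eq_iff)
  have sc: "tensor_lift F (tensor_scale c x) = tensor_scale c (tensor_lift F x)" for c x
    by (simp add: tensor_lift_def tensor_scale_def)
  have "tensor_lift F x \<in> tensor_space sC sD w'" if "x \<in> tensor_space sA sB w" for x
    using that
  proof (induction rule: tensor_space_induct)
    case zero
    have "tensor_lift F 0 = 0" by (simp add: tensor_lift_def fun_eq_iff)
    then show ?case by (metis tensor_space_zero)
  next
    case (step c xs y)
    then show ?case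
      unfolding add sc using F lift_pure by (metis tensor_space_add tensor_space_scale)
  qed
  then show ?thesis using add sc by (simp add: linear_on_def)
qed

lemma tensor_space_vanish:
  assumes "\<xi> \<in> tensor_space sA sB w" and "\<not> multilinear_on sA sB (*) w \<phi>"
  shows "\<xi> \<phi> = 0"
  using assms(1)
  by (induction rule: tensor_space_induct)
    (use assms(2) in \<open>auto simp: tensor_scale_def pure_tensor_def\<close>)

lemma tensor_lift_pure:
  fixes F :: "('a::plus + 'b::plus) list \<Rightarrow> ('k::field, 'c::plus, 'd::plus) tensor"
  assumes F: "multilinear_on sA sB tensor_scale w F" and xs: "map isl xs = w"
  shows "tensor_lift F (pure_tensor sA sB xs) = F xs"
proof
  fix \<phi> :: "('c + 'd) list \<Rightarrow> 'k"
  have "multilinear_on sA sB (*) w (\<lambda>xs. F xs \<phi>)"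
    using F by (simp add: multilinear_on_def tensor_scale_def)
  then show "tensor_lift F (pure_tensor sA sB xs) \<phi> = F xs \<phi>"
    using xs by (simp add: tensor_lift_def pure_tensor_def)
qed

lemma tensor_universal:
  fixes sA :: "'k::field \<Rightarrow> 'a::plus \<Rightarrow> 'a" and sB :: "'k \<Rightarrow> 'b::plus \<Rightarrow> 'b"
    and sW :: "'k \<Rightarrow> 'w::ab_group_add \<Rightarrow> 'w"
  assumes W: "vector_space sW" and f: "multilinear_on sA sB sW w f"
  shows "\<exists>g. linear_on tensor_scale sW (tensor_space sA sB w) UNIV g \<and>
             (\<forall>xs. map isl xs = w \<longrightarrow> g (pure_tensor sA sB xs) = f xs)"
proof -
  interpret W: vector_space sW by (rule W)
  have K: "vector_space ((*) :: 'k \<Rightarrow> 'k \<Rightarrow> 'k)"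
    by unfold_locales (auto simp: algebra_simps)
  interpret WK: vector_space_pair sW "(*) :: 'k \<Rightarrow> 'k \<Rightarrow> 'k"
    using W K by (simp add: vector_space_pair_def)
  define L where "L = {h. Vector_Spaces.linear sW ((*) :: 'k \<Rightarrow> 'k \<Rightarrow> 'k) h}"
  have L_add: "h (x + y) = h x + h y" if "h \<in> L" for h x y
    using that by (simp add: L_def Vector_Spaces.linear_def module_hom_def module_hom_axioms_def)
  have L_scale: "h (sW c x) = c * h x" if "h \<in> L" for h c x
    using that by (simp add: L_def Vector_Spaces.linear_def module_hom_def module_hom_axioms_def)
  have sep: "z = 0" if z: "\<And>h. h \<in> L \<Longrightarrow> h z = 0" for z
  proof (rule ccontr)
    assume "z \<noteq> 0"
    then have "W.independent {z}" by simp
    from WK.linear_independent_extend[OF this, of "\<lambda>_. 1"]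
    obtain h where "h \<in> L" "h z = 1" by (auto simp: L_def)
    then show False using z by force
  qed
  have L_diff: "h (x - y) = h x - h y" if "h \<in> L" for h x y
    using L_add[OF that, of "x - y" y] by simp
  have L_zero: "h 0 = 0" if "h \<in> L" for h
    using L_diff[OF that, of 0 0] by simp
  have eqI: "x = y" if "\<And>h. h \<in> L \<Longrightarrow> h x = h y" for x y
    using sep[of "x - y"] that by (simp add: L_diff)
  define P where "P \<xi> z \<longleftrightarrow> (\<forall>h\<in>L. \<xi> (h \<circ> f) = h z)" for \<xi> :: "('k, 'a, 'b) tensor" and z
  define g where "g \<xi> = (THE z. P \<xi> z)" for \<xi>
  have g_eq: "g \<xi> = z" if "P \<xi> z" for \<xi> z
    unfolding g_def
  proof (rule the_equality[where a = z])
    show "y = z" if y: "P \<xi> y" for y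
    proof (rule eqI)
      fix h assume "h \<in> L"
      then have "\<xi> (h \<circ> f) = h y" "\<xi> (h \<circ> f) = h z"
        using y \<open>P \<xi> z\<close> unfolding P_def by blast+
      then show "h y = h z" by simp
    qed
  qed (rule that)
  have P_pure: "P (pure_tensor sA sB xs) (f xs)" if "map isl xs = w" for xs
  proof -
    have "multilinear_on sA sB (*) w (h \<circ> f)" if "h \<in> L" for h
      using f by (auto simp: multilinear_on_def L_add[OF that] L_scale[OF that])
    then show ?thesis using that by (simp add: P_def pure_tensor_def)
  qed
  have P_add: "P (x + y) (a + b)" if "P x a" "P y b" for x y a b
    using that by (auto simp: P_def L_add)
  have P_scale: "P (tensor_scale c x) (sW c a)" if "P x a" for c x a
    using that by (auto simp: P_def L_scale tensor_scale_def)
  have P_ex: "\<exists>z. P \<xi> z" if "\<xi> \<in> tensor_space sA sB w" for \<xi>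
    using that
  proof (induction rule: tensor_space_induct)
    case zero
    show ?case by (rule exI[of _ 0]) (simp add: P_def L_zero)
  next
    case (step c xs y)
    then show ?case using P_pure P_add P_scale by blast
  qed
  have P_g: "P \<xi> (g \<xi>)" if "\<xi> \<in> tensor_space sA sB w" for \<xi>
    using P_ex[OF that] g_eq by blast
  have "linear_on tensor_scale sW (tensor_space sA sB w) UNIV g"
    unfolding linear_on_def
    by (auto intro!: g_eq P_add P_scale P_g)
  moreover have "g (pure_tensor sA sB xs) = f xs" if "map isl xs = w" for xs
    by (rule g_eq, rule P_pure[OF that])
  ultimately show ?thesis by blast
qed

lemma tensor_universal_unique:
  fixes sA :: "'k::field \<Rightarrow> 'a::plus \<Rightarrow> 'a" and sB :: "'k \<Rightarrow> 'b::plus \<Rightarrow> 'b"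
    and sW :: "'k \<Rightarrow> 'w::ab_group_add \<Rightarrow> 'w"
  assumes W: "vector_space sW"
    and g: "linear_on tensor_scale sW (tensor_space sA sB w) UNIV g"
    and h: "linear_on tensor_scale sW (tensor_space sA sB w) UNIV h"
    and eq: "\<And>xs. map isl xs = w \<Longrightarrow> g (pure_tensor sA sB xs) = h (pure_tensor sA sB xs)"
    and \<xi>: "\<xi> \<in> tensor_space sA sB w"
  shows "g \<xi> = h \<xi>"
proof -
  interpret W: vector_space sW by (rule W)
  have map_zero: "k 0 = 0" if "linear_on tensor_scale sW (tensor_space sA sB w) UNIV k" for k
  proof -
    have "k (0 + 0) = k 0 + k 0"
      using that tensor_space_zero[of sA sB w] unfolding linear_on_def by blast
    then show ?thesis by simp
  qed
  from \<xi> show ?thesis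
  proof (induction rule: tensor_space_induct)
    case zero
    show ?case by (simp add: map_zero[OF g, unfolded zero_fun_def] map_zero[OF h, unfolded zero_fun_def])
  next
    case (step c xs y)
    have x: "pure_tensor sA sB xs \<in> tensor_space sA sB w"
      using step by (intro tensor_space_pure)
    have cx: "tensor_scale c (pure_tensor sA sB xs) \<in> tensor_space sA sB w"
      by (rule tensor_space_scale[OF x])
    show ?case using g h x cx step eq unfolding linear_on_def by metis
  qed
qed


section \<open>Operators on tensor factors\<close>

text \<open>
  \<open>on_factors sA sB i n G\<close> is \<open>id \<otimes> G \<otimes> id\<close> with \<open>G\<close> acting on the \<open>n\<close> consecutive factors that
  follow the first \<open>i\<close> ones.
\<close>

definition insert_tensor ::
  "('k::field \<Rightarrow> 'a \<Rightarrow> 'a) \<Rightarrow> ('k \<Rightarrow> 'b \<Rightarrow> 'b) \<Rightarrow> ('a::plus + 'b::plus) list \<Rightarrow>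
   ('k, 'a, 'b) tensor \<Rightarrow> ('a + 'b) list \<Rightarrow> ('k, 'a, 'b) tensor"
where
  "insert_tensor sA sB us \<xi> vs = tensor_lift (\<lambda>xs. pure_tensor sA sB (us @ xs @ vs)) \<xi>"

definition on_factors ::
  "('k::field \<Rightarrow> 'a \<Rightarrow> 'a) \<Rightarrow> ('k \<Rightarrow> 'b \<Rightarrow> 'b) \<Rightarrow> nat \<Rightarrow> nat \<Rightarrow>
   (('k, 'a::plus, 'b::plus) tensor \<Rightarrow> ('k, 'a, 'b) tensor) \<Rightarrow>
   ('k, 'a, 'b) tensor \<Rightarrow> ('k, 'a, 'b) tensor"
where
  "on_factors sA sB i n G =
     tensor_lift (\<lambda>xs. insert_tensor sA sB (take i xs)
       (G (pure_tensor sA sB (take n (drop i xs)))) (drop (i + n) xs))"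

definition insert_letter ::
  "('k::field \<Rightarrow> 'a \<Rightarrow> 'a) \<Rightarrow> ('k \<Rightarrow> 'b \<Rightarrow> 'b) \<Rightarrow> nat \<Rightarrow> ('a::plus + 'b::plus) \<Rightarrow>
   ('k, 'a, 'b) tensor \<Rightarrow> ('k, 'a, 'b) tensor"
where
  "insert_letter sA sB i l = tensor_lift (\<lambda>xs. pure_tensor sA sB (take i xs @ l # drop i xs))"

text \<open>
  These lemmas confirm that \<open>on_factors\<close> is \<open>id \<otimes> G \<otimes> id\<close>: \<open>insert_tensor us \<xi> vs\<close> is the tensor
  \<open>us \<otimes> \<xi> \<otimes> vs\<close>, and \<open>on_factors\<close> sends the pure tensor \<open>us \<otimes> xs \<otimes> vs\<close> to \<open>us \<otimes> G xs \<otimes> vs\<close>.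
\<close>

lemma insert_tensor_pure:
  "insert_tensor sA sB us (pure_tensor sA sB xs) vs = pure_tensor sA sB (us @ xs @ vs)"
  unfolding insert_tensor_def by (rule tensor_lift_pure[OF pure_tensor_insert_multilinear refl])

lemma tensor_space_apply_add:
  assumes "\<xi> \<in> tensor_space sA sB w"
    and "multilinear_on sA sB (*) w f" and "multilinear_on sA sB (*) w g"
  shows "\<xi> (\<lambda>xs. f xs + g xs) = \<xi> f + \<xi> g"
proof -
  have "multilinear_on sA sB (*) w (\<lambda>xs. f xs + g xs)"
    using assms(2,3) by (simp add: multilinear_on_def algebra_simps)
  with assms(2-) show ?thesis
    by (intro tensor_space_induct[OF assms(1), where P = "\<lambda>\<xi>. \<xi> (\<lambda>xs. f xs + g xs) = \<xi> f + \<xi> g"])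
      (auto simp: tensor_scale_def pure_tensor_def algebra_simps)
qed

lemma tensor_space_apply_scale:
  assumes "\<xi> \<in> tensor_space sA sB w" and "multilinear_on sA sB (*) w f"
  shows "\<xi> (\<lambda>xs. c * f xs) = c * \<xi> f"
proof -
  have "multilinear_on sA sB (*) w (\<lambda>xs. c * f xs)"
    using assms(2) by (simp add: multilinear_on_def algebra_simps)
  with assms(2-) show ?thesis
    by (intro tensor_space_induct[OF assms(1), where P = "\<lambda>\<xi>. \<xi> (\<lambda>xs. c * f xs) = c * \<xi> f"])
      (auto simp: tensor_scale_def pure_tensor_def algebra_simps)
qed

lemma insert_tensor_add_scale:
  fixes sA :: "'k::field \<Rightarrow> 'a::plus \<Rightarrow> 'a" and sB :: "'k \<Rightarrow> 'b::plus \<Rightarrow> 'b"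
  shows "insert_tensor sA sB us (\<xi> + \<eta>) vs = insert_tensor sA sB us \<xi> vs + insert_tensor sA sB us \<eta> vs"
    and "insert_tensor sA sB us (tensor_scale c \<xi>) vs = tensor_scale c (insert_tensor sA sB us \<xi> vs)"
  by (simp_all add: insert_tensor_def tensor_lift_def tensor_scale_def fun_eq_iff)

lemma insert_tensor_multilinear:
  fixes sA :: "'k::field \<Rightarrow> 'a::plus \<Rightarrow> 'a" and sB :: "'k \<Rightarrow> 'b::plus \<Rightarrow> 'b"
  assumes \<xi>: "\<xi> \<in> tensor_space sA sB w"
  shows "multilinear_on sA sB tensor_scale w' (\<lambda>us. insert_tensor sA sB us \<xi> vs)"
    and "multilinear_on sA sB tensor_scale w' (\<lambda>vs. insert_tensor sA sB us \<xi> vs)"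
proof -
  have ml: "multilinear_on sA sB (*) w (\<lambda>xs. pure_tensor sA sB (us @ xs @ vs) \<phi>)" for us vs \<phi>
    using pure_tensor_insert_multilinear[of sA sB w us vs]
    by (simp add: multilinear_on_def tensor_scale_def fun_eq_iff)
  have *: "insert_tensor sA sB us \<xi> vs = insert_tensor sA sB us' \<xi> vs' + insert_tensor sA sB us'' \<xi> vs''"
    if "\<And>xs. pure_tensor sA sB (us @ xs @ vs) =
      pure_tensor sA sB (us' @ xs @ vs') + pure_tensor sA sB (us'' @ xs @ vs'')"
    for us us' us'' vs vs' vs''
    unfolding insert_tensor_def tensor_lift_def that
    using tensor_space_apply_add[OF \<xi> ml ml] by (simp add: fun_eq_iff)
  have **: "insert_tensor sA sB us \<xi> vs = tensor_scale c (insert_tensor sA sB us' \<xi> vs')"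
    if "\<And>xs. pure_tensor sA sB (us @ xs @ vs) = tensor_scale c (pure_tensor sA sB (us' @ xs @ vs'))"
    for us us' vs vs' c
    unfolding insert_tensor_def tensor_lift_def that
    using tensor_space_apply_scale[OF \<xi> ml] by (simp add: fun_eq_iff tensor_scale_def)
  note eq = pure_tensor_letter_append[where us = "us @ xs" for xs, unfolded append_assoc]
  show "multilinear_on sA sB tensor_scale w' (\<lambda>us. insert_tensor sA sB us \<xi> vs)"
    unfolding multilinear_on_def
    by (intro conjI allI impI; (rule * | rule **); simp add: pure_tensor_letter)
  show "multilinear_on sA sB tensor_scale w' (\<lambda>vs. insert_tensor sA sB us \<xi> vs)"
    unfolding multilinear_on_def
    by (intro conjI allI impI; (rule * | rule **); rule eq)
qed

lemma multilinear_on_append: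
  assumes f1: "\<And>ys. map isl ys = w2 \<Longrightarrow> multilinear_on sA sB sW w1 (\<lambda>xs. f (xs @ ys))"
    and f2: "\<And>xs. map isl xs = w1 \<Longrightarrow> multilinear_on sA sB sW w2 (\<lambda>ys. f (xs @ ys))"
  shows "multilinear_on sA sB sW (w1 @ w2) f"
proof -
  have split: "(\<exists>v1 v2. v = v1 @ v2 \<and> map isl u @ b # map isl v1 = w1 \<and> map isl v2 = w2) \<or>
      (\<exists>u1 u2. u = u1 @ u2 \<and> map isl u1 = w1 \<and> map isl u2 @ b # map isl v = w2)"
    if "map isl u @ b # map isl v = w1 @ w2" for u v :: "('a + 'b) list" and b
  proof -
    from that consider us where "map isl u = w1 @ us" "us @ b # map isl v = w2"
      | us where "map isl u @ us = w1" "b # map isl v = us @ w2" "us \<noteq> []"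
      by (fastforce simp: append_eq_append_conv2)
    then show ?thesis
    proof cases
      case 1
      from 1(1) obtain u1 u2 where "u = u1 @ u2" "map isl u1 = w1" "map isl u2 = us"
        unfolding map_eq_append_conv by blast
      with 1(2) show ?thesis by blast
    next
      case 2
      then obtain us' where us: "us = b # us'" and v: "map isl v = us' @ w2"
        by (cases us) auto
      from v obtain v1 v2 where "v = v1 @ v2" "map isl v1 = us'" "map isl v2 = w2"
        unfolding map_eq_append_conv by blast
      with 2(1) us show ?thesis by blast
    qed
  qed
  have A: "(\<forall>x y. f (u @ Inl (x + y) # v) = f (u @ Inl x # v) + f (u @ Inl y # v)) \<and>
        (\<forall>c x. f (u @ Inl (sA c x) # v) = sW c (f (u @ Inl x # v)))"
    if "map isl u @ True # map isl v = w1 @ w2" for u v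
    using split[OF that]
  proof (elim disjE exE conjE)
    fix v1 v2 assume "v = v1 @ v2" "map isl u @ True # map isl v1 = w1" "map isl v2 = w2"
    then show ?thesis using f1[of v2] by (simp add: multilinear_on_def)
  next
    fix u1 u2 assume "u = u1 @ u2" "map isl u1 = w1" "map isl u2 @ True # map isl v = w2"
    then show ?thesis using f2[of u1] by (simp add: multilinear_on_def)
  qed
  have B: "(\<forall>x y. f (u @ Inr (x + y) # v) = f (u @ Inr x # v) + f (u @ Inr y # v)) \<and>
        (\<forall>c x. f (u @ Inr (sB c x) # v) = sW c (f (u @ Inr x # v)))"
    if "map isl u @ False # map isl v = w1 @ w2" for u v
    using split[OF that]
  proof (elim disjE exE conjE)
    fix v1 v2 assume "v = v1 @ v2" "map isl u @ False # map isl v1 = w1" "map isl v2 = w2"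
    then show ?thesis using f1[of v2] by (simp add: multilinear_on_def)
  next
    fix u1 u2 assume "u = u1 @ u2" "map isl u1 = w1" "map isl u2 @ False # map isl v = w2"
    then show ?thesis using f2[of u1] by (simp add: multilinear_on_def)
  qed
  show ?thesis unfolding multilinear_on_def using A B by blast
qed

lemma on_factors_pure:
  fixes sA :: "'k::field \<Rightarrow> 'a::plus \<Rightarrow> 'a" and sB :: "'k \<Rightarrow> 'b::plus \<Rightarrow> 'b"
  assumes G: "linear_on tensor_scale tensor_scale
      (tensor_space sA sB (map isl xs)) (tensor_space sA sB w') G"
  shows "on_factors sA sB (length us) (length xs) G (pure_tensor sA sB (us @ xs @ vs)) =
    insert_tensor sA sB us (G (pure_tensor sA sB xs)) vs"
proof -
  define F where "F = (\<lambda>ys. insert_tensor sA sB (take (length us) ys)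
    (G (pure_tensor sA sB (take (length xs) (drop (length us) ys)))) (drop (length us + length xs) ys))"
  let ?w = "map isl xs"
  have Gin: "G (pure_tensor sA sB ys) \<in> tensor_space sA sB w'" if "map isl ys = ?w" for ys
    using G tensor_space_pure[OF that] unfolding linear_on_def by blast
  have GF: "multilinear_on sA sB tensor_scale ?w
      (\<lambda>ys. insert_tensor sA sB u (G (pure_tensor sA sB ys)) v)" for u v
  proof -
    have Gadd: "G (\<xi> + \<eta>) = G \<xi> + G \<eta>"
      if "\<xi> \<in> tensor_space sA sB ?w" "\<eta> \<in> tensor_space sA sB ?w" for \<xi> \<eta>
      using G that by (simp add: linear_on_def)
    have Gsc: "G (tensor_scale c \<xi>) = tensor_scale c (G \<xi>)"
      if "\<xi> \<in> tensor_space sA sB ?w" for \<xi> c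
      using G that by (simp add: linear_on_def)
    have mem: "pure_tensor sA sB (u @ l # v) \<in> tensor_space sA sB ?w"
      if "map isl u @ isl l # map isl v = ?w" for u v l
      using that by (intro tensor_space_pure) simp
    show ?thesis
      using pure_tensor_multilinear[of sA sB ?w]
      unfolding multilinear_on_def
      by (simp add: Gadd Gsc mem insert_tensor_add_scale)
  qed
  have ml: "multilinear_on sA sB tensor_scale (map isl us @ ?w @ map isl vs) F"
  proof (rule multilinear_on_append)
    fix ys :: "('a + 'b) list" assume ys: "map isl ys = ?w @ map isl vs"
    then obtain y1 y2 where y: "ys = y1 @ y2" "map isl y1 = ?w" "map isl y2 = map isl vs"
      by (auto simp: map_eq_append_conv)
    have len: "length y1 = length xs" using y(2) by (metis length_map)
    have ml1: "multilinear_on sA sB tensor_scale (map isl us)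
        (\<lambda>u. insert_tensor sA sB u (G (pure_tensor sA sB y1)) y2)"
      by (rule insert_tensor_multilinear(1)[OF Gin[OF y(2)]])
    have "F (u @ ys) = insert_tensor sA sB u (G (pure_tensor sA sB y1)) y2"
      if "map isl u = map isl us" for u
      using map_eq_imp_length_eq[OF that] len by (simp add: F_def y(1))
    then show "multilinear_on sA sB tensor_scale (map isl us) (\<lambda>u. F (u @ ys))"
      using ml1 by (rule multilinear_on_cong)
  next
    fix u :: "('a + 'b) list" assume u: "map isl u = map isl us"
    show "multilinear_on sA sB tensor_scale (?w @ map isl vs) (\<lambda>ys. F (u @ ys))"
    proof (rule multilinear_on_append)
      fix v :: "('a + 'b) list" assume "map isl v = map isl vs"
      have "F (u @ y @ v) = insert_tensor sA sB u (G (pure_tensor sA sB y)) v"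
        if "map isl y = ?w" for y
        using map_eq_imp_length_eq[OF that] map_eq_imp_length_eq[OF u] by (simp add: F_def)
      then show "multilinear_on sA sB tensor_scale ?w (\<lambda>y. F (u @ y @ v))"
        using GF[of u v] by (rule multilinear_on_cong)
    next
      fix y :: "('a + 'b) list" assume y: "map isl y = ?w"
      have "F (u @ y @ v) = insert_tensor sA sB u (G (pure_tensor sA sB y)) v" for v
        using map_eq_imp_length_eq[OF y] map_eq_imp_length_eq[OF u] by (simp add: F_def)
      then show "multilinear_on sA sB tensor_scale (map isl vs) (\<lambda>v. F (u @ y @ v))"
        using insert_tensor_multilinear(2)[OF Gin[OF y]] by simp
    qed
  qed
  have "tensor_lift F (pure_tensor sA sB (us @ xs @ vs)) = F (us @ xs @ vs)"
    by (rule tensor_lift_pure[OF ml]) simp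
  then show ?thesis by (simp add: on_factors_def F_def)
qed

text \<open>The block flip \<open>f\<^sup>m\<^sup>,\<^sup>n\<close>; the number \<open>n\<close> of remaining factors is determined by the word.\<close>

definition block_flip ::
  "('k::field \<Rightarrow> 'a \<Rightarrow> 'a) \<Rightarrow> ('k \<Rightarrow> 'b \<Rightarrow> 'b) \<Rightarrow> nat \<Rightarrow>
   ('k, 'a::plus, 'b::plus) tensor \<Rightarrow> ('k, 'a, 'b) tensor"
where
  "block_flip sA sB m = tensor_lift (\<lambda>xs. pure_tensor sA sB (drop m xs @ take m xs))"

text \<open>\<open>m\<^sub>A\<close> on \<open>A \<otimes> A\<close> and \<open>m\<^sub>B\<close> on \<open>B \<otimes> B\<close>; the value at words of any other shape is
  irrelevant.\<close>

fun mult_word :: "('a::times + 'b::times) list \<Rightarrow> ('a + 'b) list" where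
  "mult_word [Inl x, Inl y] = [Inl (x * y)]"
| "mult_word [Inr x, Inr y] = [Inr (x * y)]"
| "mult_word xs = xs"

definition tensor_mult ::
  "('k::field \<Rightarrow> 'a \<Rightarrow> 'a) \<Rightarrow> ('k \<Rightarrow> 'b \<Rightarrow> 'b) \<Rightarrow>
   ('k, 'a::{plus,times}, 'b::{plus,times}) tensor \<Rightarrow> ('k, 'a, 'b) tensor"
where
  "tensor_mult sA sB = tensor_lift (\<lambda>xs. pure_tensor sA sB (mult_word xs))"


section \<open>Smash product data\<close>

text \<open>\<open>R\<close> is a function on all tensors; only its restriction to \<open>B \<otimes> A\<close> matters. In
  \<open>on_factors sA sB i 2 R\<close> positions count from \<open>0\<close>, so this is \<open>R\<^bsub>i+1,i+2\<^esub>\<close>.\<close>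

abbreviation space_AB where "space_AB sA sB \<equiv> tensor_space sA sB [True, False]"
abbreviation space_BA where "space_BA sA sB \<equiv> tensor_space sA sB [False, True]"

definition quasitriangular ::
  "('k::field \<Rightarrow> 'a \<Rightarrow> 'a) \<Rightarrow> ('k \<Rightarrow> 'b \<Rightarrow> 'b) \<Rightarrow>
   (('k, 'a::{plus,times}, 'b::{plus,times}) tensor \<Rightarrow> ('k, 'a, 'b) tensor) \<Rightarrow> bool"
where
  "quasitriangular sA sB R \<longleftrightarrow>
     (\<forall>\<xi> \<in> tensor_space sA sB [False, False, True].
        R (on_factors sA sB 0 2 (tensor_mult sA sB) \<xi>) =
        on_factors sA sB 1 2 (tensor_mult sA sB)
          (on_factors sA sB 0 2 R (on_factors sA sB 1 2 R \<xi>))) \<and>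
     (\<forall>\<xi> \<in> tensor_space sA sB [False, True, True].
        R (on_factors sA sB 1 2 (tensor_mult sA sB) \<xi>) =
        on_factors sA sB 0 2 (tensor_mult sA sB)
          (on_factors sA sB 1 2 R (on_factors sA sB 0 2 R \<xi>)))"

definition normal ::
  "('k::field \<Rightarrow> 'a \<Rightarrow> 'a) \<Rightarrow> ('k \<Rightarrow> 'b \<Rightarrow> 'b) \<Rightarrow>
   (('k, 'a::{plus,one}, 'b::{plus,one}) tensor \<Rightarrow> ('k, 'a, 'b) tensor) \<Rightarrow> bool"
where
  "normal sA sB R \<longleftrightarrow>
     (\<forall>a. R (pure_tensor sA sB [Inr 1, Inl a]) = pure_tensor sA sB [Inl a, Inr 1]) \<and>
     (\<forall>b. R (pure_tensor sA sB [Inr b, Inl 1]) = pure_tensor sA sB [Inl 1, Inr b])"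

locale strong_smash_product =
  A: assoc_algebra sA + B: assoc_algebra sB
  for sA :: "'k::field_char_0 \<Rightarrow> 'a::{ring,monoid_mult} \<Rightarrow> 'a"
    and sB :: "'k \<Rightarrow> 'b::{ring,monoid_mult} \<Rightarrow> 'b" +
  fixes R :: "('k, 'a, 'b) tensor \<Rightarrow> ('k, 'a, 'b) tensor"
  assumes linear_R:
      "linear_on tensor_scale tensor_scale (space_BA sA sB) (space_AB sA sB) R"
    and quasitriangular_R: "quasitriangular sA sB R"
    and normal_R: "normal sA sB R"
    and bij_R: "bij_betw R (space_BA sA sB) (space_AB sA sB)"


section \<open>The operators on \<open>A \<natural> B\<close>\<close>

definition cyl_space ::
  "('k::field \<Rightarrow> 'a \<Rightarrow> 'a) \<Rightarrow> ('k \<Rightarrow> 'b \<Rightarrow> 'b) \<Rightarrow> nat \<Rightarrow> nat \<Rightarrow>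
   ('k, 'a::plus, 'b::plus) tensor set"
where
  "cyl_space sA sB p q = tensor_space sA sB (replicate (p + 1) False @ replicate (q + 1) True)"

text \<open>\<open>G\<^bsub>n+1,n+2\<^esub> \<circ> \<dots> \<circ> G\<^bsub>23\<^esub> \<circ> G\<^bsub>12\<^esub>\<close>\<close>

primrec sweep ::
  "('k::field \<Rightarrow> 'a \<Rightarrow> 'a) \<Rightarrow> ('k \<Rightarrow> 'b \<Rightarrow> 'b) \<Rightarrow>
   (('k, 'a::plus, 'b::plus) tensor \<Rightarrow> ('k, 'a, 'b) tensor) \<Rightarrow> nat \<Rightarrow>
   ('k, 'a, 'b) tensor \<Rightarrow> ('k, 'a, 'b) tensor"
where
  "sweep sA sB G 0 = on_factors sA sB 0 2 G"
| "sweep sA sB G (Suc n) = on_factors sA sB (Suc n) 2 G \<circ> sweep sA sB G n"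

definition Theta ::
  "('k::field \<Rightarrow> 'a \<Rightarrow> 'a) \<Rightarrow> ('k \<Rightarrow> 'b \<Rightarrow> 'b) \<Rightarrow>
   (('k, 'a::plus, 'b::plus) tensor \<Rightarrow> ('k, 'a, 'b) tensor) \<Rightarrow> nat \<Rightarrow>
   ('k, 'a, 'b) tensor \<Rightarrow> ('k, 'a, 'b) tensor"
where
  "Theta sA sB R q = sweep sA sB R q"

definition Gamma ::
  "('k::field \<Rightarrow> 'a \<Rightarrow> 'a) \<Rightarrow> ('k \<Rightarrow> 'b \<Rightarrow> 'b) \<Rightarrow>
   (('k, 'a::plus, 'b::plus) tensor \<Rightarrow> ('k, 'a, 'b) tensor) \<Rightarrow> nat \<Rightarrow>
   ('k, 'a, 'b) tensor \<Rightarrow> ('k, 'a, 'b) tensor"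
where
  "Gamma sA sB R p = sweep sA sB (inv_into (space_BA sA sB) R) p"

definition cyl_t ::
  "('k::field \<Rightarrow> 'a \<Rightarrow> 'a) \<Rightarrow> ('k \<Rightarrow> 'b \<Rightarrow> 'b) \<Rightarrow>
   (('k, 'a::plus, 'b::plus) tensor \<Rightarrow> ('k, 'a, 'b) tensor) \<Rightarrow> nat \<Rightarrow> nat \<Rightarrow>
   ('k, 'a, 'b) tensor \<Rightarrow> ('k, 'a, 'b) tensor"
where
  "cyl_t sA sB R p q =
     block_flip sA sB (p + q + 1) \<circ> on_factors sA sB p (q + 2) (Theta sA sB R q)"

text \<open>The flip brings \<open>a\<^sub>q\<close> to the front, in the order of the arguments of \<open>\<Gamma>\<^sub>p\<close>.\<close>

definition cyl_t_bar ::
  "('k::field \<Rightarrow> 'a \<Rightarrow> 'a) \<Rightarrow> ('k \<Rightarrow> 'b \<Rightarrow> 'b) \<Rightarrow>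
   (('k, 'a::plus, 'b::plus) tensor \<Rightarrow> ('k, 'a, 'b) tensor) \<Rightarrow> nat \<Rightarrow> nat \<Rightarrow>
   ('k, 'a, 'b) tensor \<Rightarrow> ('k, 'a, 'b) tensor"
where
  "cyl_t_bar sA sB R p q =
     on_factors sA sB 0 (p + 2) (Gamma sA sB R p) \<circ> block_flip sA sB (p + q + 1)"

definition cyl_d ::
  "('k::field \<Rightarrow> 'a \<Rightarrow> 'a) \<Rightarrow> ('k \<Rightarrow> 'b \<Rightarrow> 'b) \<Rightarrow>
   (('k, 'a::{plus,times}, 'b::{plus,times}) tensor \<Rightarrow> ('k, 'a, 'b) tensor) \<Rightarrow>
   nat \<Rightarrow> nat \<Rightarrow> nat \<Rightarrow> ('k, 'a, 'b) tensor \<Rightarrow> ('k, 'a, 'b) tensor"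
where
  "cyl_d sA sB R p q i =
     (if i < p then on_factors sA sB i 2 (tensor_mult sA sB)
      else on_factors sA sB 0 2 (tensor_mult sA sB) \<circ> cyl_t sA sB R p q)"

definition cyl_d_bar ::
  "('k::field \<Rightarrow> 'a \<Rightarrow> 'a) \<Rightarrow> ('k \<Rightarrow> 'b \<Rightarrow> 'b) \<Rightarrow>
   (('k, 'a::{plus,times}, 'b::{plus,times}) tensor \<Rightarrow> ('k, 'a, 'b) tensor) \<Rightarrow>
   nat \<Rightarrow> nat \<Rightarrow> nat \<Rightarrow> ('k, 'a, 'b) tensor \<Rightarrow> ('k, 'a, 'b) tensor"
where
  "cyl_d_bar sA sB R p q j =
     (if j < q then on_factors sA sB (p + 1 + j) 2 (tensor_mult sA sB)
      else on_factors sA sB (p + 1) 2 (tensor_mult sA sB) \<circ> cyl_t_bar sA sB R p q)"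

definition cyl_s ::
  "('k::field \<Rightarrow> 'a \<Rightarrow> 'a) \<Rightarrow> ('k \<Rightarrow> 'b \<Rightarrow> 'b) \<Rightarrow>
   nat \<Rightarrow> nat \<Rightarrow> nat \<Rightarrow> ('k, 'a::plus, 'b::{plus,one}) tensor \<Rightarrow> ('k, 'a, 'b) tensor"
where
  "cyl_s sA sB p q i = insert_letter sA sB (i + 1) (Inr 1)"

definition cyl_s_bar ::
  "('k::field \<Rightarrow> 'a \<Rightarrow> 'a) \<Rightarrow> ('k \<Rightarrow> 'b \<Rightarrow> 'b) \<Rightarrow>
   nat \<Rightarrow> nat \<Rightarrow> nat \<Rightarrow> ('k, 'a::{plus,one}, 'b::plus) tensor \<Rightarrow> ('k, 'a, 'b) tensor"
where
  "cyl_s_bar sA sB p q j = insert_letter sA sB (p + 1 + j + 1) (Inl 1)"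

end

theory Submission
  imports Defs
begin

text \<open>
The cyclic operator \<open>t\<close> carries the last factor of \<open>B\<close> through the whole block of factors of \<open>A\<close>,
one application of \<open>R\<close> per factor, and then moves it to the front; \<open>t\<close> barred moves the last factor
of \<open>A\<close> to the front and carries it through the block of factors of \<open>B\<close> by \<open>R\<inverse>\<close>. These are two
instances of one construction: for letters \<open>c\<close> and \<open>e\<close> and an invertible \<open>K : c \<otimes> e \<rightarrow> e \<otimes> c\<close>
compatible with products and units (locale \<open>crossing\<close>), a factor \<open>c\<close> is swept through a block of
factors \<open>e\<close>. The conditions on \<open>K\<close> are self-dual: if \<open>(c, e, K)\<close> satisfies them, so does
\<open>(e, c, K\<inverse>)\<close> (lemma \<open>dual\<close>). Hence each fact about \<open>R\<close> and \<open>B\<close> also gives its barred counterpart.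

Quasitriangularity and normality extend from \<open>K\<close> to sweeps by induction on the length of the block: a sweep is
natural for products and units inside the block (\<open>sweep_at_mul_e\<close>, \<open>sweep_at_unit_e\<close>), and sweeping a
product of two factors is sweeping them one after the other (\<open>sweep_at_mul_c\<close>, \<open>sweep_at_unit_c\<close>).
These are the relations between \<open>t\<close> and the faces and degeneracies that multiply neighbours or
insert units. The last face is \<open>d\<^sub>0 t\<close>, and the relations in which it occurs then follow formally (\<open>paracyclic_moduleI\<close>, \<open>bi_paracyclic_moduleI\<close>). The barred operators with \<open>p\<close> fixed
are those of the unbarred module of the dual crossing, conjugated by a block flip (\<open>paracyclic_right\<close>).

The two cyclic operators commute because in \<open>t\<close> after \<open>t\<close> barred the crossing of the last \<open>a\<close> past
the last \<open>b\<close> is undone at once, in the other order likewise, and what remains is a pair of sweeps on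
disjoint sets of factors (\<open>t_commute\<close>). For the cylindrical identity, the full power of \<open>t\<close> is the
crossing of the whole block of factors of \<open>B\<close> with that of \<open>A\<close>, followed by the block flip
(\<open>t_power\<close>); the full power of \<open>t\<close> barred is the block flip followed by the opposite
crossing (\<open>t_power_right\<close>). Both crossings pass through the same grid of elementary crossings, in two
orders that differ by interchanges of distant ones, so that they are mutually inverse
(\<open>cross_inverse\<close>).

All operators are composites of flips and of operators of the form \<open>id \<otimes> G \<otimes> id\<close>. Besides the
conditions on \<open>K\<close>, the argument rests on two facts about them: operators on disjoint slots commute
(\<open>onf_interchange\<close>), and flips are natural (\<open>flip_onf_left\<close>, \<open>flip_onf_right\<close>).
\<close>

section \<open>Calculus of operators on tensor factors\<close>

text \<open>
Operators are typed by shapes: \<open>arr w w' G\<close> means that \<open>G\<close> is linear from the tensors of shape \<open>w\<close> to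
those of shape \<open>w'\<close>. Positions and lengths enter the lemmas as separate variables with equations such
as \<open>i = length u\<close>, so that a lemma applies to any arithmetic expression for a position.
\<close>

locale tensor_calculus =
  fixes sA :: "'k::field \<Rightarrow> 'a::plus \<Rightarrow> 'a" and sB :: "'k \<Rightarrow> 'b::plus \<Rightarrow> 'b"
begin

abbreviation "T \<equiv> tensor_space sA sB"
abbreviation "pt \<equiv> pure_tensor sA sB"
abbreviation "ins \<equiv> insert_tensor sA sB"
abbreviation "onf \<equiv> on_factors sA sB"
abbreviation "flip \<equiv> block_flip sA sB"
abbreviation "arr w w' f \<equiv> linear_on tensor_scale tensor_scale (T w) (T w') f"

lemma arr_mem: "arr w w' f \<Longrightarrow> x \<in> T w \<Longrightarrow> f x \<in> T w'"
  by (simp add: linear_on_def)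

lemma arr_id: "arr w w (\<lambda>x. x)"
  by (simp add: linear_on_def)

lemma arr_comp: "arr w w' f \<Longrightarrow> arr w' w'' g \<Longrightarrow> arr w w'' (\<lambda>x. g (f x))"
  by (simp add: linear_on_def)

lemma arr_cong:
  assumes g: "arr w w' g" and eq: "\<And>x. x \<in> T w \<Longrightarrow> f x = g x"
  shows "arr w w' f"
  using g unfolding linear_on_def by (simp add: eq tensor_space_add tensor_space_scale)

text \<open>
Most identities below are proved by this principle: they are checked on pure tensors, where both
sides can be computed. In the applications the membership premise is chained as the last of four
facts, so that \<open>x\<close> is fixed before the goal is matched with \<open>f x = g x\<close>.
\<close>

lemma arr_ext:
  assumes f: "arr w w' f" and g: "arr w w' g"
    and eq: "\<And>xs. map isl xs = w \<Longrightarrow> f (pt xs) = g (pt xs)" and x: "x \<in> T w"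
  shows "f x = g x"
proof -
  have "linear_on tensor_scale tensor_scale (T w) UNIV h" if "arr w w' h" for h
    using that by (simp add: linear_on_def)
  from tensor_universal_unique[OF vector_space_tensor this[OF f] this[OF g] eq x]
  show ?thesis .
qed

lemma map_isl_appendE:
  assumes "map isl xs = u @ v"
  obtains us vs where "xs = us @ vs" "map isl us = u" "map isl vs = v"
  using assms by (auto simp: map_eq_append_conv)

lemma arr_ins:
  assumes "map isl us = u" "map isl vs = v"
  shows "arr w (u @ w @ v) (\<lambda>\<xi>. ins us \<xi> vs)"
proof -
  have "arr w (u @ w @ v) (tensor_lift (\<lambda>xs. pt (us @ xs @ vs)))"
    using assms
    by (intro tensor_lift_linear tensor_lift_pure[OF pure_tensor_insert_multilinear] refl
        tensor_space_pure) auto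
  then show ?thesis by (simp add: insert_tensor_def[abs_def])
qed

lemma ins_mem:
  "\<xi> \<in> T w \<Longrightarrow> W = map isl us @ w @ map isl vs \<Longrightarrow> ins us \<xi> vs \<in> T W"
  using arr_mem[OF arr_ins[OF refl refl]] by blast

lemma onf_pure:
  assumes "arr w w' G" "map isl xs = w" "i = length us" "n = length w"
  shows "onf i n G (pt (us @ xs @ vs)) = ins us (G (pt xs)) vs"
  using assms on_factors_pure[of sA sB xs w' G us vs] by (auto simp del: length_map simp flip: length_map[of isl])

lemma arr_onf:
  assumes G: "arr w w' G" and i: "i = length u" and n: "n = length w"
    and W: "W = u @ w @ v" and W': "W' = u @ w' @ v"
  shows "arr W W' (onf i n G)"
  unfolding on_factors_def
proof (rule tensor_lift_linear)
  fix xs :: "('a + 'b) list" assume "map isl xs = W"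
  then obtain us ws vs where xs: "xs = us @ ws @ vs"
    and shape: "map isl us = u" "map isl ws = w" "map isl vs = v"
    unfolding W by (metis map_isl_appendE)
  have len: "i = length us" "n = length ws" using shape i n by (metis length_map)+
  show "tensor_lift (\<lambda>xs. ins (take i xs) (G (pt (take n (drop i xs)))) (drop (i + n) xs)) (pt xs)
      = ins (take i xs) (G (pt (take n (drop i xs)))) (drop (i + n) xs)"
    using onf_pure[OF G shape(2) len(1) n, of vs]
    by (simp add: xs len on_factors_def)
  have "G (pt ws) \<in> T w'" using G shape(2) by (simp add: arr_mem tensor_space_pure)
  from arr_mem[OF arr_ins[OF shape(1,3)] this]
  show "ins (take i xs) (G (pt (take n (drop i xs)))) (drop (i + n) xs) \<in> T W'"
    by (simp add: xs len W')
qed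

lemma ins_ins:
  assumes "\<xi> \<in> T w"
  shows "ins us (ins as \<xi> bs) vs = ins (us @ as) \<xi> (bs @ vs)"
  using _ _ _ assms
proof (rule arr_ext)
  show "arr w (map isl us @ (map isl as @ w @ map isl bs) @ map isl vs) (\<lambda>\<xi>. ins us (ins as \<xi> bs) vs)"
    by (rule arr_comp[OF arr_ins arr_ins]) simp_all
  show "arr w (map isl us @ (map isl as @ w @ map isl bs) @ map isl vs)
      (\<lambda>\<xi>. ins (us @ as) \<xi> (bs @ vs))"
    using arr_ins[of "us @ as" _ "bs @ vs" _ w, OF refl refl] by simp
qed (simp add: insert_tensor_pure)

lemma onf_ins:
  assumes G: "arr w w' G" and "\<xi> \<in> T w" and i: "i = length us" and n: "n = length w"
  shows "onf i n G (ins us \<xi> vs) = ins us (G \<xi>) vs"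
  using _ _ _ assms(2)
proof (rule arr_ext)
  show "arr w (map isl us @ w' @ map isl vs) (\<lambda>\<xi>. onf i n G (ins us \<xi> vs))"
    by (rule arr_comp[OF arr_ins arr_onf[OF G, where u = "map isl us"]]) (simp_all add: i n)
  show "arr w (map isl us @ w' @ map isl vs) (\<lambda>\<xi>. ins us (G \<xi>) vs)"
    by (rule arr_comp[OF G arr_ins]) simp_all
qed (simp add: insert_tensor_pure onf_pure[OF G _ i n])

text \<open>
The next four lemmas say that \<open>G \<mapsto> id \<otimes> G \<otimes> id\<close> is compatible with nesting and composition,
depends only on \<open>G\<close> on the relevant space, and preserves identities.
\<close>

lemma onf_nest:
  assumes G: "arr w w' G" and x: "x \<in> T W" and W: "W = u @ (a @ w @ b) @ v"
    and i: "i = length u" and n: "n = length (a @ w @ b)" and j: "j = length a" and m: "m = length w"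
    and ij: "l = i + j"
  shows "onf i n (onf j m G) x = onf l m G x"
  using _ _ _ x
proof (rule arr_ext)
  have G': "arr (a @ w @ b) (a @ w' @ b) (onf j m G)"
    by (rule arr_onf[OF G j m refl refl])
  show "arr W (u @ (a @ w' @ b) @ v) (onf i n (onf j m G))"
    by (rule arr_onf[OF G' i n W refl])
  show "arr W (u @ (a @ w' @ b) @ v) (onf l m G)"
    by (rule arr_onf[OF G, where u = "u @ a" and v = "b @ v"]) (simp_all add: i j m W ij)
  fix xs :: "('a + 'b) list" assume "map isl xs = W"
  then obtain us as ws bs vs where xs: "xs = us @ (as @ ws @ bs) @ vs"
    and shape: "map isl us = u" "map isl as = a" "map isl ws = w" "map isl bs = b" "map isl vs = v"
    unfolding W by (metis map_isl_appendE)
  have len: "i = length us" "j = length as" using shape i j by (metis length_map)+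
  have "onf i n (onf j m G) (pt xs) = ins us (ins as (G (pt ws)) bs) vs"
    unfolding xs using shape
    by (subst onf_pure[OF G' _ len(1) n]) (simp_all add: onf_pure[OF G _ len(2) m])
  also have "\<dots> = ins (us @ as) (G (pt ws)) (bs @ vs)"
    using G shape(3) by (intro ins_ins[where w = w']) (simp add: arr_mem tensor_space_pure)
  also have "\<dots> = onf l m G (pt xs)"
    using onf_pure[OF G shape(3) _ m, of l "us @ as" "bs @ vs"] by (simp add: xs len ij)
  finally show "onf i n (onf j m G) (pt xs) = onf l m G (pt xs)" .
qed

lemma onf_comp:
  assumes G: "arr w w' G" and H: "arr w' w'' H" and x: "x \<in> T W" and W: "W = u @ w @ v"
    and i: "i = length u" and n: "n = length w" and n': "n' = length w'"
  shows "onf i n' H (onf i n G x) = onf i n (\<lambda>x. H (G x)) x"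
  using _ _ _ x
proof (rule arr_ext)
  note HG = arr_comp[OF G H]
  show "arr W (u @ w'' @ v) (\<lambda>x. onf i n' H (onf i n G x))"
    by (rule arr_comp[OF arr_onf[OF G i n W refl] arr_onf[OF H i n' refl refl]])
  show "arr W (u @ w'' @ v) (onf i n (\<lambda>x. H (G x)))"
    by (rule arr_onf[OF HG i n W refl])
  fix xs :: "('a + 'b) list" assume "map isl xs = W"
  then obtain us ws vs where xs: "xs = us @ ws @ vs"
    and shape: "map isl us = u" "map isl ws = w" "map isl vs = v"
    unfolding W by (metis map_isl_appendE)
  have len: "i = length us" using shape i by (metis length_map)
  have "G (pt ws) \<in> T w'" using G shape(2) by (simp add: arr_mem tensor_space_pure)
  then show "onf i n' H (onf i n G (pt xs)) = onf i n (\<lambda>x. H (G x)) (pt xs)"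
    unfolding xs onf_pure[OF G shape(2) len n] onf_pure[OF HG shape(2) len n]
    by (rule onf_ins[OF H _ len n'])
qed

lemma onf_cong:
  assumes G: "arr w w' G" and H: "arr w w' H" and eq: "\<And>x. x \<in> T w \<Longrightarrow> G x = H x"
    and x: "x \<in> T W" and W: "W = u @ w @ v" and i: "i = length u" and n: "n = length w"
  shows "onf i n G x = onf i n H x"
  using _ _ _ x
proof (rule arr_ext)
  show "arr W (u @ w' @ v) (onf i n G)" "arr W (u @ w' @ v) (onf i n H)"
    by (rule arr_onf[OF G i n W refl] arr_onf[OF H i n W refl])+
  fix xs :: "('a + 'b) list" assume "map isl xs = W"
  then obtain us ws vs where xs: "xs = us @ ws @ vs"
    and shape: "map isl us = u" "map isl ws = w" "map isl vs = v"
    unfolding W by (metis map_isl_appendE)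
  have len: "i = length us" using shape i by (metis length_map)
  show "onf i n G (pt xs) = onf i n H (pt xs)"
    unfolding xs onf_pure[OF G shape(2) len n] onf_pure[OF H shape(2) len n]
    using eq shape(2) by (simp add: tensor_space_pure)
qed

lemma onf_id:
  assumes x: "x \<in> T W" and W: "W = u @ w @ v" and i: "i = length u" and n: "n = length w"
  shows "onf i n (\<lambda>x. x) x = x"
  using _ _ _ x
proof (rule arr_ext)
  show "arr W W (onf i n (\<lambda>x. x))" by (rule arr_onf[OF arr_id i n W W])
  show "arr W W (\<lambda>x. x)" by (rule arr_id)
  fix xs :: "('a + 'b) list" assume "map isl xs = W"
  then obtain us ws vs where xs: "xs = us @ ws @ vs"
    and shape: "map isl us = u" "map isl ws = w" "map isl vs = v"
    unfolding W by (metis map_isl_appendE)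
  have len: "i = length us" using shape i by (metis length_map)
  show "onf i n (\<lambda>x. x) (pt xs) = pt xs"
    unfolding xs onf_pure[OF arr_id shape(2) len n] by (rule insert_tensor_pure)
qed

lemma multilinear_on_middle:
  assumes "multilinear_on sA sB sW (map isl us @ w @ map isl vs) f"
  shows "multilinear_on sA sB sW w (\<lambda>xs. f (us @ xs @ vs))"
  unfolding multilinear_on_def
proof (rule conjI; intro allI impI)
  fix u v :: "('a + 'b) list"
  note f = assms[unfolded multilinear_on_def]
  show "(\<forall>x y. f (us @ (u @ Inl (x + y) # v) @ vs) =
      f (us @ (u @ Inl x # v) @ vs) + f (us @ (u @ Inl y # v) @ vs)) \<and>
      (\<forall>c x. f (us @ (u @ Inl (sA c x) # v) @ vs) = sW c (f (us @ (u @ Inl x # v) @ vs)))"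
    if "map isl u @ True # map isl v = w"
    using f[THEN conjunct1, THEN spec, THEN spec, of "us @ u" "v @ vs"] that by auto
  show "(\<forall>x y. f (us @ (u @ Inr (x + y) # v) @ vs) =
      f (us @ (u @ Inr x # v) @ vs) + f (us @ (u @ Inr y # v) @ vs)) \<and>
      (\<forall>c x. f (us @ (u @ Inr (sB c x) # v) @ vs) = sW c (f (us @ (u @ Inr x # v) @ vs)))"
    if "map isl u @ False # map isl v = w"
    using f[THEN conjunct2, THEN spec, THEN spec, of "us @ u" "v @ vs"] that by auto
qed

text \<open>
A tensor is a functional, so inserting \<open>\<xi>\<close> and \<open>\<eta>\<close> into two disjoint slots can be done by evaluating
either one first. The two results agree since both are bilinear and agree on pure tensors. This is
what makes \<open>onf_interchange\<close> true when neither operator maps pure tensors to pure tensors.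
\<close>

lemma ins_fubini:
  assumes \<xi>: "\<xi> \<in> T w" and \<eta>: "\<eta> \<in> T v"
  shows "tensor_lift (\<lambda>xs. ins (us @ xs @ ms) \<eta> zs) \<xi> = tensor_lift (\<lambda>ys. ins us \<xi> (ms @ ys @ zs)) \<eta>"
  using \<xi>
proof (induction rule: tensor_space_induct)
  case zero
  have "\<eta> (\<lambda>ys. 0) = 0"
    using tensor_space_apply_scale[OF \<eta>, of "\<lambda>_. 0" 0] by (simp add: multilinear_on_def)
  then show ?case by (simp add: tensor_lift_def insert_tensor_def fun_eq_iff)
next
  case (step c xs \<xi>)
  have ml: "multilinear_on sA sB (*) v (\<lambda>ys. ins us \<zeta> (ms @ ys @ zs) \<phi>)" if "\<zeta> \<in> T w" for \<zeta> \<phi>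
    using multilinear_on_middle[OF insert_tensor_multilinear(2)[OF that, where us = us], where us = ms and w = v and vs = zs]
    by (simp add: multilinear_on_def tensor_scale_def fun_eq_iff)
  have p: "pt xs \<in> T w" using step(1) by (rule tensor_space_pure)
  have ml': "multilinear_on sA sB (*) v (\<lambda>ys. c * ins us (pt xs) (ms @ ys @ zs) \<phi>)" for \<phi>
    using ml[OF p] by (simp add: multilinear_on_def algebra_simps)
  have scale: "tensor_scale c \<zeta> \<phi> = c * \<zeta> \<phi>" for \<zeta> :: "('k, 'a, 'b) tensor" and \<phi>
    by (simp add: tensor_scale_def)
  have split: "ins us (tensor_scale c (pt xs) + \<xi>) vs \<phi> = c * ins us (pt xs) vs \<phi> + ins us \<xi> vs \<phi>"
    for vs \<phi>
    unfolding insert_tensor_add_scale by (simp add: tensor_scale_def)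
  have "tensor_lift (\<lambda>ys. ins us (tensor_scale c (pt xs) + \<xi>) (ms @ ys @ zs)) \<eta> =
    tensor_scale c (tensor_lift (\<lambda>ys. ins us (pt xs) (ms @ ys @ zs)) \<eta>) +
    tensor_lift (\<lambda>ys. ins us \<xi> (ms @ ys @ zs)) \<eta>"
    by (rule ext) (simp only: tensor_lift_def split plus_fun_apply scale
        tensor_space_apply_add[OF \<eta> ml' ml[OF step(2)]] tensor_space_apply_scale[OF \<eta> ml[OF p]])
  also have "tensor_lift (\<lambda>ys. ins us (pt xs) (ms @ ys @ zs)) \<eta> = ins (us @ xs @ ms) \<eta> zs"
    by (simp add: insert_tensor_pure) (simp add: insert_tensor_def)
  also have "ins (us @ xs @ ms) \<eta> zs = tensor_lift (\<lambda>xs. ins (us @ xs @ ms) \<eta> zs) (pt xs)"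
    by (rule tensor_lift_pure[symmetric, OF multilinear_on_middle[OF insert_tensor_multilinear(1)[OF \<eta>]] refl])
  finally have "tensor_lift (\<lambda>ys. ins us (tensor_scale c (pt xs) + \<xi>) (ms @ ys @ zs)) \<eta> =
    tensor_scale c (tensor_lift (\<lambda>xs. ins (us @ xs @ ms) \<eta> zs) (pt xs)) +
    tensor_lift (\<lambda>ys. ins us \<xi> (ms @ ys @ zs)) \<eta>" .
  also have "tensor_lift (\<lambda>ys. ins us \<xi> (ms @ ys @ zs)) \<eta> =
    tensor_lift (\<lambda>xs. ins (us @ xs @ ms) \<eta> zs) \<xi>"
    by (rule step(3)[symmetric])
  finally show ?case
    by (simp only:) (simp add: tensor_lift_def fun_eq_iff scale)
qed

text \<open>
The interchange law for operators on disjoint slots. If \<open>G\<close> changes the number of its factors, the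
position of \<open>H\<close> to the right of it shifts, whence \<open>j\<close> and \<open>j'\<close>.
\<close>

lemma onf_interchange:
  assumes G: "arr w w' G" and H: "arr v v' H" and x: "x \<in> T W" and W: "W = u @ w @ m @ v @ z"
    and i: "i = length u" and n: "n = length w" and k: "k = length v"
    and j: "j = length (u @ w @ m)" and j': "j' = length (u @ w' @ m)"
  shows "onf j' k H (onf i n G x) = onf i n G (onf j k H x)"
  using _ _ _ x
proof (rule arr_ext)
  show "arr W (u @ w' @ m @ v' @ z) (\<lambda>x. onf j' k H (onf i n G x))"
    by (rule arr_comp[OF arr_onf[OF G i n W refl] arr_onf[OF H j' k]]) simp_all
  show "arr W (u @ w' @ m @ v' @ z) (\<lambda>x. onf i n G (onf j k H x))"
    by (rule arr_comp[OF arr_onf[OF H j k _ refl] arr_onf[OF G i n]]) (simp_all add: W)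
  fix xs :: "('a + 'b) list" assume "map isl xs = W"
  then obtain us ws ms vs zs where xs: "xs = us @ ws @ ms @ vs @ zs"
    and shape: "map isl us = u" "map isl ws = w" "map isl ms = m" "map isl vs = v" "map isl zs = z"
    unfolding W by (metis map_isl_appendE)
  have len: "i = length us" "j = length (us @ ws @ ms)" "j' = length us + length w' + length ms"
    using shape i j j' by auto
  have Gw: "G (pt ws) \<in> T w'" and Hv: "H (pt vs) \<in> T v'"
    using G H shape by (simp_all add: arr_mem tensor_space_pure)
  let ?F = "\<lambda>ys. ins (us @ ys @ ms) (H (pt vs)) zs"
  let ?F' = "\<lambda>ys. ins us (G (pt ws)) (ms @ ys @ zs)"
  have F: "tensor_lift ?F (pt ys) = ?F ys" if "map isl ys = w'" for ys
    using that
    by (rule tensor_lift_pure[OF multilinear_on_middle[OF insert_tensor_multilinear(1)[OF Hv]]])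
  have F': "tensor_lift ?F' (pt ys) = ?F' ys" if "map isl ys = v'" for ys
    using that
    by (rule tensor_lift_pure[OF multilinear_on_middle[OF insert_tensor_multilinear(2)[OF Gw]]])
  have "onf j' k H (onf i n G (pt xs)) = onf j' k H (ins us (G (pt ws)) (ms @ vs @ zs))"
    unfolding xs by (subst onf_pure[OF G shape(2) len(1) n]) simp
  also have "\<dots> = tensor_lift ?F (G (pt ws))"
    using _ _ _ Gw
  proof (rule arr_ext)
    show "arr w' (u @ w' @ m @ v' @ z) (\<lambda>\<xi>. onf j' k H (ins us \<xi> (ms @ vs @ zs)))"
      by (rule arr_comp[OF arr_ins[OF shape(1) refl] arr_onf[OF H j' k, of _ z]]) (simp_all add: shape)
    show "arr w' (u @ w' @ m @ v' @ z) (tensor_lift ?F)"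
    proof (rule tensor_lift_linear[OF F])
      fix ys :: "('a + 'b) list" assume "map isl ys = w'"
      with shape show "?F ys \<in> T (u @ w' @ m @ v' @ z)" by (intro ins_mem[OF Hv]) simp
    qed
    fix ys :: "('a + 'b) list" assume ys: "map isl ys = w'"
    then have "length ys = length w'" by (metis length_map)
    with F[OF ys] onf_pure[OF H shape(4) _ k, of j' "us @ ys @ ms" zs] show
      "onf j' k H (ins us (pt ys) (ms @ vs @ zs)) = tensor_lift ?F (pt ys)"
      by (simp add: insert_tensor_pure len)
  qed
  also have "\<dots> = tensor_lift ?F' (H (pt vs))"
    by (rule ins_fubini[OF Gw Hv])
  also have "\<dots> = onf i n G (ins (us @ ws @ ms) (H (pt vs)) zs)"
    using _ _ _ Hv
  proof (rule arr_ext)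
    show "arr v' (u @ w' @ m @ v' @ z) (\<lambda>\<xi>. onf i n G (ins (us @ ws @ ms) \<xi> zs))"
      by (rule arr_comp[OF arr_ins[OF refl refl] arr_onf[OF G i n]]) (simp_all add: shape)
    show "arr v' (u @ w' @ m @ v' @ z) (tensor_lift ?F')"
    proof (rule tensor_lift_linear[OF F'])
      fix ys :: "('a + 'b) list" assume "map isl ys = v'"
      with shape show "?F' ys \<in> T (u @ w' @ m @ v' @ z)" by (intro ins_mem[OF Gw]) simp
    qed
    fix ys :: "('a + 'b) list" assume ys: "map isl ys = v'"
    with F'[OF ys] onf_pure[OF G shape(2) len(1) n, of "ms @ ys @ zs"] show
      "tensor_lift ?F' (pt ys) = onf i n G (ins (us @ ws @ ms) (pt ys) zs)"
      by (simp add: insert_tensor_pure)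
  qed
  also have "ins (us @ ws @ ms) (H (pt vs)) zs = onf j k H (pt xs)"
    using onf_pure[OF H shape(4) len(2) k, of zs] by (simp add: xs)
  finally show "onf j' k H (onf i n G (pt xs)) = onf i n G (onf j k H (pt xs))" .
qed

lemma flip_pure: "i = length us \<Longrightarrow> flip i (pt (us @ vs)) = pt (vs @ us)"
proof -
  assume i: "i = length us"
  let ?F = "\<lambda>xs. pt (drop i xs @ take i xs)"
  have "multilinear_on sA sB tensor_scale (map isl us @ map isl vs) ?F"
  proof (rule multilinear_on_append)
    fix ys :: "('a + 'b) list"
    have "?F (xs @ ys) = pt (ys @ xs @ [])" if "map isl xs = map isl us" for xs
      using map_eq_imp_length_eq[OF that] by (simp add: i)
    then show "multilinear_on sA sB tensor_scale (map isl us) (\<lambda>xs. ?F (xs @ ys))"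
      using pure_tensor_insert_multilinear by (rule multilinear_on_cong)
  next
    fix xs :: "('a + 'b) list" assume "map isl xs = map isl us"
    then have "length xs = length us" by (rule map_eq_imp_length_eq)
    then have "?F (xs @ ys) = pt ([] @ ys @ xs)" for ys
      by (simp add: i)
    then show "multilinear_on sA sB tensor_scale (map isl vs) (\<lambda>ys. ?F (xs @ ys))"
      using pure_tensor_insert_multilinear by (rule multilinear_on_cong)
  qed
  from tensor_lift_pure[OF this, of "us @ vs"] show ?thesis
    by (simp add: block_flip_def i)
qed

lemma arr_flip:
  assumes i: "i = length u" and W: "W = u @ v" and W': "W' = v @ u"
  shows "arr W W' (flip i)"
proof -
  have *: "\<exists>us vs. xs = us @ vs \<and> map isl us = u \<and> map isl vs = v \<and> length us = length u"
    if "map isl xs = W" for xs :: "('a + 'b) list"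
    using that unfolding W by (metis map_isl_appendE length_map)
  show ?thesis
    unfolding block_flip_def
  proof (rule tensor_lift_linear)
    fix xs :: "('a + 'b) list" assume "map isl xs = W"
    from *[OF this] obtain us vs where
      xs: "xs = us @ vs" "map isl us = u" "map isl vs = v" "length us = length u" by blast
    show "tensor_lift (\<lambda>xs. pt (drop i xs @ take i xs)) (pt xs) = pt (drop i xs @ take i xs)"
      using flip_pure[of i us vs] xs i by (simp add: block_flip_def)
    show "pt (drop i xs @ take i xs) \<in> T W'"
      using xs i W' by (intro tensor_space_pure) simp
  qed
qed

lemma flip_flip:
  assumes x: "x \<in> T W" and W: "W = u @ v @ z"
    and i: "i = length u" and j: "j = length v" and k: "k = length (u @ v)"
  shows "flip j (flip i x) = flip k x"
  using _ _ _ x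
proof (rule arr_ext)
  show "arr W (z @ u @ v) (\<lambda>x. flip j (flip i x))"
    by (rule arr_comp[OF arr_flip[OF i W refl] arr_flip[OF j, of _ "z @ u"]]) simp_all
  show "arr W (z @ u @ v) (flip k)"
    by (rule arr_flip[OF k, of _ z]) (simp_all add: W)
  fix xs :: "('a + 'b) list" assume "map isl xs = W"
  then obtain us vs zs where xs: "xs = us @ vs @ zs" and shape: "map isl us = u" "map isl vs = v"
    unfolding W by (metis map_isl_appendE)
  then have "i = length us" "j = length vs" "k = length (us @ vs)" using i j k by auto
  then show "flip j (flip i (pt xs)) = flip k (pt xs)"
    using flip_pure[of i us "vs @ zs"] flip_pure[of j vs "zs @ us"] flip_pure[of k "us @ vs" zs]
    by (simp add: xs)
qed

lemma flip_full:
  assumes x: "x \<in> T W" and k: "k = length W"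
  shows "flip k x = x"
  using _ _ _ x
proof (rule arr_ext)
  show "arr W W (flip k)" by (rule arr_flip[OF k, of _ "[]"]) simp_all
  show "arr W W (\<lambda>x. x)" by (rule arr_id)
  show "flip k (pt xs) = pt xs" if "map isl xs = W" for xs
    using flip_pure[of k xs "[]"] that k by auto
qed

lemma flip_inverse:
  assumes x: "x \<in> T W" and W: "W = u @ v" and i: "i = length u" and j: "j = length v"
  shows "flip j (flip i x) = x"
proof -
  have "flip j (flip i x) = flip (length W) x"
    by (rule flip_flip[OF x _ i j, of "[]"]) (simp_all add: W)
  then show ?thesis by (simp only: flip_full[OF x refl])
qed

lemma bij_flip:
  assumes i: "i = length u" and W: "W = u @ v" and W': "W' = v @ u"
  shows "bij_betw (flip i) (T W) (T W')"
proof (rule bij_betw_byWitness[where f' = "flip (length v)"])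
  show "flip i ` T W \<subseteq> T W'" using arr_mem[OF arr_flip[OF i W W']] by blast
  show "flip (length v) ` T W' \<subseteq> T W" using arr_mem[OF arr_flip[OF refl W' W]] by blast
  show "\<forall>x\<in>T W. flip (length v) (flip i x) = x" using flip_inverse[OF _ W i refl] by blast
  show "\<forall>x\<in>T W'. flip i (flip (length v) x) = x" using flip_inverse[OF _ W' refl i] by blast
qed

text \<open>
Block flips are natural: an operator inside the block that is moved commutes with the flip, up to
its position. As \<open>G\<close> may change the length of that block, the flip lengths \<open>k\<close> and \<open>k'\<close> may differ.
\<close>

lemma flip_onf_left:
  assumes G: "arr w w' G" and x: "x \<in> T W" and W: "W = a @ w @ b @ v"
    and i: "i = length a" and n: "n = length w" and k: "k = length (a @ w @ b)"
    and k': "k' = length (a @ w' @ b)" and j: "j = length (v @ a)"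
  shows "flip k' (onf i n G x) = onf j n G (flip k x)"
  using _ _ _ x
proof (rule arr_ext)
  show "arr W (v @ a @ w' @ b) (\<lambda>x. flip k' (onf i n G x))"
    by (rule arr_comp[OF arr_onf[OF G i n W refl] arr_flip[OF k', of _ v]]) simp_all
  show "arr W (v @ a @ w' @ b) (\<lambda>x. onf j n G (flip k x))"
    by (rule arr_comp[OF arr_flip[OF k _ refl, of _ v] arr_onf[OF G j n]]) (simp_all add: W)
  fix xs :: "('a + 'b) list" assume "map isl xs = W"
  then obtain as ws bs vs where xs: "xs = as @ ws @ bs @ vs"
    and shape: "map isl as = a" "map isl ws = w" "map isl bs = b" "map isl vs = v"
    unfolding W by (metis map_isl_appendE)
  have len: "i = length as" "j = length (vs @ as)" "k = length (as @ ws @ bs)"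
    "k' = length as + length w' + length bs"
    using shape i j k k' by auto
  have Gw: "G (pt ws) \<in> T w'" using G shape by (simp add: arr_mem tensor_space_pure)
  have "flip k' (onf i n G (pt xs)) = flip k' (ins as (G (pt ws)) (bs @ vs))"
    unfolding xs by (subst onf_pure[OF G shape(2) len(1) n]) simp
  also have "\<dots> = ins (vs @ as) (G (pt ws)) bs"
    using _ _ _ Gw
  proof (rule arr_ext)
    show "arr w' (v @ a @ w' @ b) (\<lambda>\<xi>. flip k' (ins as \<xi> (bs @ vs)))"
      by (rule arr_comp[OF arr_ins[OF shape(1) refl] arr_flip[OF k', of _ v]]) (simp_all add: shape)
    show "arr w' (v @ a @ w' @ b) (\<lambda>\<xi>. ins (vs @ as) \<xi> bs)"
      using arr_ins[of "vs @ as" "v @ a" bs b w'] shape by simp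
    fix ys :: "('a + 'b) list" assume "map isl ys = w'"
    then have "k' = length (as @ ys @ bs)" using len(4) by auto
    from flip_pure[OF this, of vs]
    show "flip k' (ins as (pt ys) (bs @ vs)) = ins (vs @ as) (pt ys) bs"
      by (simp add: insert_tensor_pure)
  qed
  also have "\<dots> = onf j n G (pt (vs @ as @ ws @ bs))"
    using onf_pure[OF G shape(2) len(2) n, of bs] by simp
  also have "pt (vs @ as @ ws @ bs) = flip k (pt xs)"
    using flip_pure[OF len(3), of vs] by (simp add: xs)
  finally show "flip k' (onf i n G (pt xs)) = onf j n G (flip k (pt xs))" .
qed

lemma flip_onf_right:
  assumes G: "arr w w' G" and x: "x \<in> T W" and W: "W = u @ a @ w @ b"
    and k: "k = length u" and i: "i = length (u @ a)" and n: "n = length w" and j: "j = length a"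
  shows "flip k (onf i n G x) = onf j n G (flip k x)"
proof -
  let ?l = "length (a @ w @ b)" and ?l' = "length (a @ w' @ b)"
  have fx: "flip k x \<in> T (a @ w @ b @ u)"
    by (rule arr_mem[OF arr_flip[OF k W] x]) simp
  have "onf j n G (flip k x) \<in> T (a @ w' @ b @ u)"
    by (rule arr_mem[OF arr_onf[OF G j n refl refl] fx])
  then have "onf j n G (flip k x) = flip k (flip ?l' (onf j n G (flip k x)))"
    by (intro flip_inverse[symmetric, where u = "a @ w' @ b"]) (simp_all add: k)
  also have "flip ?l' (onf j n G (flip k x)) = onf i n G (flip ?l (flip k x))"
    by (rule flip_onf_left[OF G fx refl j n refl refl i])
  also have "flip ?l (flip k x) = x"
    by (rule flip_inverse[OF x W k]) simp
  finally show ?thesis by simp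
qed

lemma onf_mem:
  "x \<in> T W \<Longrightarrow> arr w w' G \<Longrightarrow> W = u @ w @ v \<Longrightarrow> i = length u \<Longrightarrow> n = length w \<Longrightarrow>
    W' = u @ w' @ v \<Longrightarrow> onf i n G x \<in> T W'"
  using arr_mem[OF arr_onf] by blast

text \<open>
This splits off the innermost step of a composite that acts inside a slot; repeated use turns an
identity between operators on few factors into one between operators at positions.
\<close>

lemma onf_comp_nest:
  assumes G: "arr w w' G" and H: "arr (a @ w' @ b) w'' H" and x: "x \<in> T W"
    and W: "W = u @ (a @ w @ b) @ v"
    and i: "i = length u" and n: "n = length (a @ w @ b)" and n': "n' = length (a @ w' @ b)"
    and j: "j = length a" and m: "m = length w" and l: "l = i + j"
  shows "onf i n (\<lambda>x. H (onf j m G x)) x = onf i n' H (onf l m G x)"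
proof -
  have G': "arr (a @ w @ b) (a @ w' @ b) (onf j m G)" by (rule arr_onf[OF G j m refl refl])
  have "onf i n (\<lambda>x. H (onf j m G x)) x = onf i n' H (onf i n (onf j m G) x)"
    by (rule onf_comp[OF G' H x W i n n', symmetric])
  also have "onf i n (onf j m G) x = onf l m G x"
    by (rule onf_nest[OF G x W i n j m l])
  finally show ?thesis .
qed

end

section \<open>Reductions for paracyclic and bi-paracyclic modules\<close>

text \<open>
Since \<open>d\<^sub>n = d\<^sub>0 t\<close>, it suffices to know the relations among \<open>t\<close>, the degeneracies and the faces
\<open>d\<^sub>i\<close> with \<open>i < n\<close>, and two relations in which \<open>d\<^sub>n\<close> is written out: \<open>d\<^sub>n t = t d\<^bsub>n-1\<^esub>\<close>, which becomes
\<open>d\<^sub>0 t t = t d\<^bsub>n-1\<^esub>\<close>, and \<open>d\<^bsub>n+1\<^esub> s\<^sub>n = id\<close>, which becomes \<open>d\<^sub>0 t s\<^sub>n = id\<close>. The simplicial identities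
that involve \<open>d\<^sub>n\<close> follow by moving \<open>t\<close> past the other operator.
\<close>

lemma paracyclic_moduleI:
  fixes scale :: "'r::comm_ring_1 \<Rightarrow> 'c::ab_group_add \<Rightarrow> 'c"
  assumes module: "module scale"
    and subspace: "\<And>n. module.subspace scale (C n)"
    and linear_d: "\<And>n i. i < n \<Longrightarrow> linear_on scale scale (C n) (C (n - 1)) (d n i)"
    and linear_s: "\<And>n i. i \<le> n \<Longrightarrow> linear_on scale scale (C n) (C (n + 1)) (s n i)"
    and linear_t: "\<And>n. linear_on scale scale (C n) (C n) (t n)"
    and bij_t: "\<And>n. bij_betw (t n) (C n) (C n)"
    and d_last: "\<And>n x. 1 \<le> n \<Longrightarrow> x \<in> C n \<Longrightarrow> d n n x = d n 0 (t n x)"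
    and d_d: "\<And>n i j x. i < j \<Longrightarrow> j < n \<Longrightarrow> x \<in> C n \<Longrightarrow>
      d (n - 1) i (d n j x) = d (n - 1) (j - 1) (d n i x)"
    and s_s: "\<And>n i j x. i \<le> j \<Longrightarrow> j \<le> n \<Longrightarrow> x \<in> C n \<Longrightarrow>
      s (n + 1) i (s n j x) = s (n + 1) (j + 1) (s n i x)"
    and d_s_less: "\<And>n i j x. i < j \<Longrightarrow> j \<le> n \<Longrightarrow> x \<in> C n \<Longrightarrow>
      d (n + 1) i (s n j x) = s (n - 1) (j - 1) (d n i x)"
    and d_s_same: "\<And>n i j x. i \<le> n \<Longrightarrow> j \<le> n \<Longrightarrow> i = j \<or> i = j + 1 \<Longrightarrow> x \<in> C n \<Longrightarrow>
      d (n + 1) i (s n j x) = x"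
    and d_s_greater: "\<And>n i j x. j + 1 < i \<Longrightarrow> i \<le> n \<Longrightarrow> x \<in> C n \<Longrightarrow>
      d (n + 1) i (s n j x) = s (n - 1) j (d n (i - 1) x)"
    and d_t: "\<And>n i x. 1 \<le> i \<Longrightarrow> i < n \<Longrightarrow> x \<in> C n \<Longrightarrow>
      d n i (t n x) = t (n - 1) (d n (i - 1) x)"
    and d_t_t: "\<And>n x. 1 \<le> n \<Longrightarrow> x \<in> C n \<Longrightarrow> d n 0 (t n (t n x)) = t (n - 1) (d n (n - 1) x)"
    and s_t: "\<And>n i x. 1 \<le> i \<Longrightarrow> i \<le> n \<Longrightarrow> x \<in> C n \<Longrightarrow>
      s n i (t n x) = t (n + 1) (s n (i - 1) x)"
    and s_0_t: "\<And>n x. x \<in> C n \<Longrightarrow> s n 0 (t n x) = t (n + 1) (t (n + 1) (s n n x))"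
    and d_t_s: "\<And>n x. x \<in> C n \<Longrightarrow> d (n + 1) 0 (t (n + 1) (s n n x)) = x"
  shows "paracyclic_module scale C d s t"
proof -
  have t_mem: "t n x \<in> C n" if "x \<in> C n" for n x
    using linear_t that by (simp add: linear_on_def)
  have s_mem: "s n i x \<in> C (Suc n)" if "i \<le> n" "x \<in> C n" for n i x
    using linear_s[OF that(1)] that(2) by (simp add: linear_on_def)
  have d_mem: "d n i x \<in> C (n - 1)" if "i < n" "x \<in> C n" for n i x
    using linear_d[OF that(1)] that(2) by (simp add: linear_on_def)
  have d_t': "d n i (t n x) = t (n - 1) (d n (i - 1) x)" if "1 \<le> i" "i \<le> n" "x \<in> C n" for n i x
  proof (cases "i = n")
    case True
    with that show ?thesis using d_last[of n "t n x"] d_t_t[of n x] t_mem by simp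
  qed (use that d_t in simp)
  have linear_d': "linear_on scale scale (C n) (C (n - 1)) (d n i)" if "1 \<le> n" "i \<le> n" for n i
  proof (cases "i = n")
    case True
    have "linear_on scale scale (C n) (C (n - 1)) (\<lambda>x. d n 0 (t n x))"
      using linear_d[of 0 n] linear_t[of n] that by (simp add: linear_on_def)
    moreover interpret module scale by (rule module)
    have "x + y \<in> C n" "scale c x \<in> C n" if "x \<in> C n" "y \<in> C n" for x y c
      using that subspace by (auto intro: subspace_add subspace_scale)
    ultimately show ?thesis
      using d_last[OF that(1)] unfolding True linear_on_def by simp
  qed (use that linear_d in simp)
  have d_d': "d (n - 1) i (d n j x) = d (n - 1) (j - 1) (d n i x)"
    if n: "2 \<le> n" and ij: "i < j" "j \<le> n" and x: "x \<in> C n" for n i j x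
  proof (cases "j = n")
    case True
    show ?thesis
    proof (cases "i = n - 1")
      case i: True
      \<comment> \<open>With two last faces in play, both sides reduce to \<open>d\<^sub>0 d\<^sub>0 t t\<close>.\<close>
      let ?y = "t n x"
      have y: "?y \<in> C n" "t n ?y \<in> C n" using x t_mem by blast+
      have "d (n - 1) i (d n j x) = d (n - 1) 0 (t (n - 1) (d n 0 ?y))"
        using d_last[of n x] d_last[of "n - 1" "d n 0 ?y"] d_mem[of 0 n ?y] n x y by (simp add: True i)
      also have "t (n - 1) (d n 0 ?y) = d n 1 (t n ?y)"
        using d_t'[of 1 n ?y] n y by simp
      also have "d (n - 1) 0 \<dots> = d (n - 1) 0 (d n 0 (t n ?y))"
        using d_d[of 0 1 n "t n ?y"] n y by simp
      also have "\<dots> = d (n - 1) 0 (t (n - 1) (d n (n - 1) x))"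
        using d_t_t[of n x] n x by simp
      also have "\<dots> = d (n - 1) (n - 1) (d n (n - 1) x)"
        using d_last[of "n - 1"] n x d_mem by simp
      finally show ?thesis by (simp add: True i)
    next
      case False
      with ij True have i: "i + 1 < n" by simp
      have "d (n - 1) i (d n j x) = d (n - 1) i (d n 0 (t n x))"
        using n x by (simp add: True d_last)
      also have "\<dots> = d (n - 1) 0 (d n (i + 1) (t n x))"
        using d_d[of 0 "i + 1" n "t n x"] i x t_mem by simp
      also have "\<dots> = d (n - 1) 0 (t (n - 1) (d n i x))"
        using d_t[of "i + 1" n x] i x by simp
      also have "\<dots> = d (n - 1) (n - 1) (d n i x)"
        using d_last[of "n - 1"] n x i d_mem by simp
      finally show ?thesis by (simp add: True)
    qed
  qed (use that d_d in simp)
  have d_s_same': "d (n + 1) i (s n j x) = x" if "j \<le> n" "i = j \<or> i = j + 1" "x \<in> C n" for n i j x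
  proof (cases "i = n + 1")
    case True
    with that have "j = n" by simp
    with that True show ?thesis
      using d_last[of "n + 1" "s n n x"] d_t_s[of x n] s_mem by simp
  next
    case False
    with that have "i \<le> n" by auto
    then show ?thesis using that by (intro d_s_same)
  qed
  have d_s_greater': "d (n + 1) i (s n j x) = s (n - 1) j (d n (i - 1) x)"
    if "j + 1 < i" "i \<le> n + 1" "x \<in> C n" for n i j x
  proof (cases "i = n + 1")
    case True
    with that have j: "j + 1 \<le> n" by simp
    have "d (n + 1) i (s n j x) = d (n + 1) 0 (t (n + 1) (s n j x))"
      using d_last[of "n + 1"] True j that s_mem by simp
    also have "t (n + 1) (s n j x) = s n (j + 1) (t n x)"
      using s_t[of "j + 1" n x] j that by simp
    also have "d (n + 1) 0 \<dots> = s (n - 1) j (d n 0 (t n x))"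
      using d_s_less[of 0 "j + 1" n "t n x"] j that t_mem by simp
    finally show ?thesis
      using d_last[of n x] True j that by simp
  qed (use that d_s_greater in simp)
  interpret module scale by (rule module)
  show ?thesis
    by unfold_locales
      (fact subspace linear_d' linear_s d_d' s_s d_s_less d_s_same' d_s_greater'
        linear_t bij_t d_t' s_t d_last[symmetric] s_0_t)+
qed

text \<open>
The structure pulls back along levelwise bijections that intertwine the operators: each relation
may be tested after applying the injective map \<open>\<Phi>\<close>.
\<close>

lemma paracyclic_module_transport:
  fixes scale :: "'r::comm_ring_1 \<Rightarrow> 'c::ab_group_add \<Rightarrow> 'c"
  assumes para: "paracyclic_module scale C d s t"
    and subspace: "\<And>n. module.subspace scale (C' n)"
    and linear_d: "\<And>n i. 1 \<le> n \<Longrightarrow> i \<le> n \<Longrightarrow> linear_on scale scale (C' n) (C' (n - 1)) (d' n i)"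
    and linear_s: "\<And>n i. i \<le> n \<Longrightarrow> linear_on scale scale (C' n) (C' (n + 1)) (s' n i)"
    and linear_t: "\<And>n. linear_on scale scale (C' n) (C' n) (t' n)"
    and bij: "\<And>n. bij_betw (\<Phi> n) (C' n) (C n)"
    and d: "\<And>n i x. 1 \<le> n \<Longrightarrow> i \<le> n \<Longrightarrow> x \<in> C' n \<Longrightarrow> \<Phi> (n - 1) (d' n i x) = d n i (\<Phi> n x)"
    and s: "\<And>n i x. i \<le> n \<Longrightarrow> x \<in> C' n \<Longrightarrow> \<Phi> (n + 1) (s' n i x) = s n i (\<Phi> n x)"
    and t: "\<And>n x. x \<in> C' n \<Longrightarrow> \<Phi> n (t' n x) = t n (\<Phi> n x)"
  shows "paracyclic_module scale C' d' s' t'"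
proof -
  interpret P: paracyclic_module scale C d s t by (rule para)
  have \<Phi>: "\<Phi> n x \<in> C n" if "x \<in> C' n" for n x
    using bij that by (rule bij_betw_apply)
  have t_mem: "t' n x \<in> C' n" if "x \<in> C' n" for n x
    using linear_t that by (simp add: linear_on_def)
  have s_mem: "s' n i x \<in> C' (n + 1)" if "i \<le> n" "x \<in> C' n" for n i x
    using linear_s[OF that(1)] that(2) by (simp add: linear_on_def)
  have d_mem: "d' n i x \<in> C' (n - 1)" if "1 \<le> n" "i \<le> n" "x \<in> C' n" for n i x
    using linear_d[OF that(1,2)] that(3) by (simp add: linear_on_def)
  have d_mem1: "d' (n + 1) i x \<in> C' n" if "i \<le> n + 1" "x \<in> C' (n + 1)" for n i x
    using d_mem[of "n + 1" i x] that by simp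
  have d1: "\<Phi> n (d' (n + 1) i x) = d (n + 1) i (\<Phi> (n + 1) x)" if "i \<le> n + 1" "x \<in> C' (n + 1)" for n i x
    using d[of "n + 1" i x] that by simp
  have s1: "\<Phi> n (s' (n - 1) i x) = s (n - 1) i (\<Phi> (n - 1) x)" if "1 \<le> n" "i \<le> n - 1" "x \<in> C' (n - 1)" for n i x
    using s[of i "n - 1" x] that by simp
  have s_mem1: "s' (n - 1) i x \<in> C' n" if "1 \<le> n" "i \<le> n - 1" "x \<in> C' (n - 1)" for n i x
    using s_mem[of i "n - 1" x] that by simp
  have eqI: "x = y" if "\<Phi> n x = \<Phi> n y" "x \<in> C' n" "y \<in> C' n" for n x y
    using bij[of n] that by (auto simp: bij_betw_def inj_on_def)
  have bij_t': "bij_betw (t' n) (C' n) (C' n)" for n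
  proof -
    have "bij_betw (t n \<circ> \<Phi> n) (C' n) (C n)" using bij P.bij_t by (rule bij_betw_trans)
    then have *: "bij_betw (\<Phi> n \<circ> t' n) (C' n) (C n)"
      by (subst bij_betw_cong[where g = "t n \<circ> \<Phi> n"]) (simp_all add: t)
    have "t' n ` C' n \<subseteq> C' n" using t_mem by blast
    from bij_betw_comp_iff2[OF bij[of n] this] * show ?thesis by (rule iffD2)
  qed
  have d_d: "d' (n - 1) i (d' n j x) = d' (n - 1) (j - 1) (d' n i x)"
    if "2 \<le> n" "i < j" "j \<le> n" "x \<in> C' n" for n i j x
  proof (rule eqI)
    have dd: "\<Phi> (n - 1 - 1) (d' (n - 1) k (d' n l x)) = d (n - 1) k (d n l (\<Phi> n x))"
      "d' (n - 1) k (d' n l x) \<in> C' (n - 1 - 1)" if "k \<le> n - 1" "l \<le> n" for k l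
      using that \<open>2 \<le> n\<close> \<open>x \<in> C' n\<close> d[of "n - 1" k "d' n l x"] d[of n l x] d_mem[of n l x]
        d_mem[of "n - 1" k "d' n l x"] by simp_all
    show "\<Phi> (n - 1 - 1) (d' (n - 1) i (d' n j x)) = \<Phi> (n - 1 - 1) (d' (n - 1) (j - 1) (d' n i x))"
      using that dd(1)[of i j] dd(1)[of "j - 1" i] P.d_d[of n i j "\<Phi> n x"] \<Phi>[of x n] by simp
    show "d' (n - 1) i (d' n j x) \<in> C' (n - 1 - 1)" "d' (n - 1) (j - 1) (d' n i x) \<in> C' (n - 1 - 1)"
      using that dd(2)[of i j] dd(2)[of "j - 1" i] by simp_all
  qed
  have ss: "\<Phi> (n + 1 + 1) (s' (n + 1) k (s' n l x)) = s (n + 1) k (s n l (\<Phi> n x))"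
    if "k \<le> n + 1" "l \<le> n" "x \<in> C' n" for n k l x
    using that s[of k "n + 1" "s' n l x"] s[of l n x] s_mem[of l n x] by simp
  have s_s: "s' (n + 1) i (s' n j x) = s' (n + 1) (j + 1) (s' n i x)"
    if "i \<le> j" "j \<le> n" "x \<in> C' n" for n i j x
  proof (rule eqI)
    show "\<Phi> (n + 1 + 1) (s' (n + 1) i (s' n j x)) = \<Phi> (n + 1 + 1) (s' (n + 1) (j + 1) (s' n i x))"
      using that ss[of i n j x] ss[of "j + 1" n i x] P.s_s[of i j n "\<Phi> n x"] \<Phi> by simp
    show "s' (n + 1) i (s' n j x) \<in> C' (n + 1 + 1)" "s' (n + 1) (j + 1) (s' n i x) \<in> C' (n + 1 + 1)"
      using that s_mem[of j n x] s_mem[of i n x] s_mem[of i "n + 1" "s' n j x"]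
        s_mem[of "j + 1" "n + 1" "s' n i x"] by simp_all
  qed
  have ds: "\<Phi> n (d' (n + 1) k (s' n l x)) = d (n + 1) k (s n l (\<Phi> n x))"
    if "k \<le> n + 1" "l \<le> n" "x \<in> C' n" for n k l x
    using that d1[of k n "s' n l x"] s[of l n x] s_mem[of l n x] by simp
  have sd: "\<Phi> n (s' (n - 1) l (d' n k x)) = s (n - 1) l (d n k (\<Phi> n x))"
    if "1 \<le> n" "k \<le> n" "l \<le> n - 1" "x \<in> C' n" for n k l x
    using that s1[of n l "d' n k x"] d[of n k x] d_mem[of n k x] by simp
  have ds_mem: "d' (n + 1) k (s' n l x) \<in> C' n" if "k \<le> n + 1" "l \<le> n" "x \<in> C' n" for n k l x
    using that d_mem1 s_mem by blast
  have sd_mem: "s' (n - 1) l (d' n k x) \<in> C' n" if "1 \<le> n" "k \<le> n" "l \<le> n - 1" "x \<in> C' n" for n k l x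
    using that s_mem1 d_mem by blast
  have d_s_less: "d' (n + 1) i (s' n j x) = s' (n - 1) (j - 1) (d' n i x)"
    if "i < j" "j \<le> n" "x \<in> C' n" for n i j x
    using that P.d_s_less[of i j n "\<Phi> n x"] \<Phi>[of x n] ds[of i n j x] sd[of n i "j - 1" x]
    by (intro eqI[OF _ ds_mem sd_mem]) simp_all
  have d_s_same: "d' (n + 1) i (s' n j x) = x" if "j \<le> n" "i = j \<or> i = j + 1" "x \<in> C' n" for n i j x
  proof (rule eqI)
    have "i \<le> n + 1" using that by auto
    with that show "\<Phi> n (d' (n + 1) i (s' n j x)) = \<Phi> n x" "d' (n + 1) i (s' n j x) \<in> C' n"
      using P.d_s_same[of j n i "\<Phi> n x"] \<Phi>[of x n] ds[of i n j x] ds_mem by simp_all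
  qed (rule that)
  have d_s_greater: "d' (n + 1) i (s' n j x) = s' (n - 1) j (d' n (i - 1) x)"
    if "j + 1 < i" "i \<le> n + 1" "x \<in> C' n" for n i j x
    using that P.d_s_greater[of j i n "\<Phi> n x"] \<Phi>[of x n] ds[of i n j x] sd[of n "i - 1" j x]
    by (intro eqI[OF _ ds_mem sd_mem]) simp_all
  have d_t: "d' n i (t' n x) = t' (n - 1) (d' n (i - 1) x)" if i: "1 \<le> i" "i \<le> n" and x: "x \<in> C' n" for n i x
  proof (rule eqI)
    have n: "1 \<le> n" "i - 1 \<le> n" using i by simp_all
    note y = d_mem[OF n x]
    have "\<Phi> (n - 1) (d' n i (t' n x)) = d n i (t n (\<Phi> n x))"
      by (simp only: d[OF n(1) i(2) t_mem[OF x]] t[OF x])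
    also have "\<dots> = t (n - 1) (d n (i - 1) (\<Phi> n x))" by (rule P.d_t[OF i \<Phi>[OF x]])
    also have "\<dots> = \<Phi> (n - 1) (t' (n - 1) (d' n (i - 1) x))" by (simp only: t[OF y] d[OF n x])
    finally show "\<Phi> (n - 1) (d' n i (t' n x)) = \<Phi> (n - 1) (t' (n - 1) (d' n (i - 1) x))" .
    show "d' n i (t' n x) \<in> C' (n - 1)" "t' (n - 1) (d' n (i - 1) x) \<in> C' (n - 1)"
      by (fact d_mem[OF n(1) i(2) t_mem[OF x]] t_mem[OF y])+
  qed
  have s_t: "s' n i (t' n x) = t' (n + 1) (s' n (i - 1) x)" if i: "1 \<le> i" "i \<le> n" and x: "x \<in> C' n" for n i x
  proof (rule eqI)
    have i': "i - 1 \<le> n" using i by simp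
    note y = s_mem[OF i' x]
    have "\<Phi> (n + 1) (s' n i (t' n x)) = s n i (t n (\<Phi> n x))"
      by (simp only: s[OF i(2) t_mem[OF x]] t[OF x])
    also have "\<dots> = t (n + 1) (s n (i - 1) (\<Phi> n x))" by (rule P.s_t[OF i \<Phi>[OF x]])
    also have "\<dots> = \<Phi> (n + 1) (t' (n + 1) (s' n (i - 1) x))" by (simp only: t[OF y] s[OF i' x])
    finally show "\<Phi> (n + 1) (s' n i (t' n x)) = \<Phi> (n + 1) (t' (n + 1) (s' n (i - 1) x))" .
    show "s' n i (t' n x) \<in> C' (n + 1)" "t' (n + 1) (s' n (i - 1) x) \<in> C' (n + 1)"
      by (fact s_mem[OF i(2) t_mem[OF x]] t_mem[OF y])+
  qed
  have d_0_t: "d' n 0 (t' n x) = d' n n x" if n: "1 \<le> n" and x: "x \<in> C' n" for n x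
  proof (rule eqI)
    show "\<Phi> (n - 1) (d' n 0 (t' n x)) = \<Phi> (n - 1) (d' n n x)"
      by (simp only: d[OF n le0 t_mem[OF x]] d[OF n order_refl x] t[OF x] P.d_0_t[OF n \<Phi>[OF x]])
    show "d' n 0 (t' n x) \<in> C' (n - 1)" "d' n n x \<in> C' (n - 1)"
      by (fact d_mem[OF n le0 t_mem[OF x]] d_mem[OF n order_refl x])+
  qed
  have s_0_t: "s' n 0 (t' n x) = t' (n + 1) (t' (n + 1) (s' n n x))" if x: "x \<in> C' n" for n x
  proof (rule eqI)
    note y = s_mem[OF order_refl x]
    show "\<Phi> (n + 1) (s' n 0 (t' n x)) = \<Phi> (n + 1) (t' (n + 1) (t' (n + 1) (s' n n x)))"
      by (simp only: s[OF le0 t_mem[OF x]] s[OF order_refl x] t[OF x] t[OF y] t[OF t_mem[OF y]]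
          P.s_0_t[OF \<Phi>[OF x]])
    show "s' n 0 (t' n x) \<in> C' (n + 1)" "t' (n + 1) (t' (n + 1) (s' n n x)) \<in> C' (n + 1)"
      by (fact s_mem[OF le0 t_mem[OF x]] t_mem[OF t_mem[OF y]])+
  qed
  show ?thesis
    by unfold_locales
      (fact subspace linear_d linear_s d_d s_s d_s_less d_s_same d_s_greater
        linear_t bij_t' d_t s_t d_0_t s_0_t)+
qed

text \<open>
The last faces are \<open>d\<^sub>0 t\<close> and its barred analogue, so they commute with whatever the first faces and
the cyclic operators commute with.
\<close>

lemma bi_paracyclic_moduleI:
  fixes scale :: "'r::comm_ring_1 \<Rightarrow> 'c::ab_group_add \<Rightarrow> 'c"
  assumes unbarred: "\<And>q. paracyclic_module scale (\<lambda>p. C p q) (\<lambda>p. d p q) (\<lambda>p. s p q) (\<lambda>p. t p q)"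
    and barred: "\<And>p. paracyclic_module scale (C p) (d' p) (s' p) (t' p)"
    and d_d': "\<And>p q i j x. i < p \<Longrightarrow> j < q \<Longrightarrow> x \<in> C p q \<Longrightarrow>
      d p (q - 1) i (d' p q j x) = d' (p - 1) q j (d p q i x)"
    and d_s': "\<And>p q i j x. i < p \<Longrightarrow> j \<le> q \<Longrightarrow> x \<in> C p q \<Longrightarrow>
      d p (q + 1) i (s' p q j x) = s' (p - 1) q j (d p q i x)"
    and d_t': "\<And>p q i x. i < p \<Longrightarrow> x \<in> C p q \<Longrightarrow>
      d p q i (t' p q x) = t' (p - 1) q (d p q i x)"
    and s_d': "\<And>p q i j x. i \<le> p \<Longrightarrow> j < q \<Longrightarrow> x \<in> C p q \<Longrightarrow>
      s p (q - 1) i (d' p q j x) = d' (p + 1) q j (s p q i x)"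
    and s_s': "\<And>p q i j x. i \<le> p \<Longrightarrow> j \<le> q \<Longrightarrow> x \<in> C p q \<Longrightarrow>
      s p (q + 1) i (s' p q j x) = s' (p + 1) q j (s p q i x)"
    and s_t': "\<And>p q i x. i \<le> p \<Longrightarrow> x \<in> C p q \<Longrightarrow>
      s p q i (t' p q x) = t' (p + 1) q (s p q i x)"
    and t_d': "\<And>p q j x. j < q \<Longrightarrow> x \<in> C p q \<Longrightarrow>
      t p (q - 1) (d' p q j x) = d' p q j (t p q x)"
    and t_s': "\<And>p q j x. j \<le> q \<Longrightarrow> x \<in> C p q \<Longrightarrow>
      t p (q + 1) (s' p q j x) = s' p q j (t p q x)"
    and t_t': "\<And>p q x. x \<in> C p q \<Longrightarrow> t p q (t' p q x) = t' p q (t p q x)"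
  shows "bi_paracyclic_module scale C d s t d' s' t'"
proof -
  interpret U: paracyclic_module scale "\<lambda>p. C p q" "\<lambda>p. d p q" "\<lambda>p. s p q" "\<lambda>p. t p q" for q
    by (rule unbarred)
  interpret B: paracyclic_module scale "C p" "d' p" "s' p" "t' p" for p
    by (rule barred)
  have t_mem: "t p q x \<in> C p q" and t'_mem: "t' p q x \<in> C p q" if "x \<in> C p q" for p q x
    using U.linear_t B.linear_t that by (simp_all add: linear_on_def)
  have s_mem: "s p q i x \<in> C (p + 1) q" if "i \<le> p" "x \<in> C p q" for p q i x
    using U.linear_s[OF that(1)] that(2) by (simp add: linear_on_def)
  have s'_mem: "s' p q j x \<in> C p (q + 1)" if "j \<le> q" "x \<in> C p q" for p q j x
    using B.linear_s[OF that(1)] that(2) by (simp add: linear_on_def)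
  have d_mem: "d p q i x \<in> C (p - 1) q" if "1 \<le> p" "i \<le> p" "x \<in> C p q" for p q i x
    using U.linear_d[OF that(1,2)] that(3) by (simp add: linear_on_def)
  have d'_mem: "d' p q j x \<in> C p (q - 1)" if "1 \<le> q" "j \<le> q" "x \<in> C p q" for p q j x
    using B.linear_d[OF that(1,2)] that(3) by (simp add: linear_on_def)
  note mem = t_mem t'_mem s_mem s'_mem d_mem d'_mem
  have t_d'_le: "t p (q - 1) (d' p q j x) = d' p q j (t p q x)" if "1 \<le> q" "j \<le> q" "x \<in> C p q" for p q j x
  proof (cases "j = q")
    case True
    then show ?thesis
      using that B.d_0_t[of q "t p q x" p] B.d_0_t[of q x p] t_d'[of 0 q "t' p q x" p] t_d'[of j q x p]
      by (simp add: mem t_t')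
  next
    case False
    then show ?thesis using that by (intro t_d') simp_all
  qed
  have s_d'_le: "s p (q - 1) i (d' p q j x) = d' (p + 1) q j (s p q i x)"
    if "1 \<le> q" "i \<le> p" "j \<le> q" "x \<in> C p q" for p q i j x
  proof (cases "j = q")
    case True
    then show ?thesis
      using that B.d_0_t[of q "s p q i x" "p + 1"] B.d_0_t[of q x p] s_d'[of i p 0 q "t' p q x"]
      s_t'[of i p x q] s_mem[of i p x q]
      by (simp add: mem)
  next
    case False
    then show ?thesis using that by (intro s_d') simp_all
  qed
  have d_t'_le: "d p q i (t' p q x) = t' (p - 1) q (d p q i x)" if "1 \<le> p" "i \<le> p" "x \<in> C p q" for p q i x
  proof (cases "i = p")
    case True
    then show ?thesis
      using that U.d_0_t[of p "t' p q x" q] U.d_0_t[of p x q] d_t'[of 0 p "t p q x" q] t_t'[of x p q]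
      by (simp add: mem)
  next
    case False
    then show ?thesis using that by (intro d_t') simp_all
  qed
  have d_s'_le: "d p (q + 1) i (s' p q j x) = s' (p - 1) q j (d p q i x)"
    if "1 \<le> p" "i \<le> p" "j \<le> q" "x \<in> C p q" for p q i j x
  proof (cases "i = p")
    case True
    then show ?thesis
      using that U.d_0_t[of p "s' p q j x" "q + 1"] U.d_0_t[of p x q] d_s'[of 0 p j q "t p q x"]
      t_s'[of j q x p] s'_mem[of j q x p]
      by (simp add: mem)
  next
    case False
    then show ?thesis using that by (intro d_s') simp_all
  qed
  have d_d'_less: "d p (q - 1) i (d' p q j x) = d' (p - 1) q j (d p q i x)"
    if "1 \<le> p" "i \<le> p" "j < q" "x \<in> C p q" for p q i j x
  proof (cases "i = p")
    case True
    then show ?thesis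
      using that U.d_0_t[of p "d' p q j x" "q - 1"] U.d_0_t[of p x q] d_d'[of 0 p j q "t p q x"]
      t_d'[of j q x p] d'_mem[of q j x p]
      by (simp add: mem)
  next
    case False
    then show ?thesis using that by (intro d_d') simp_all
  qed
  have d_d'_le: "d p (q - 1) i (d' p q j x) = d' (p - 1) q j (d p q i x)"
    if "1 \<le> p" "1 \<le> q" "i \<le> p" "j \<le> q" "x \<in> C p q" for p q i j x
  proof (cases "j = q")
    case True
    then show ?thesis
      using that B.d_0_t[of q "d p q i x" "p - 1"] B.d_0_t[of q x p] d_d'_less[of p i 0 q "t' p q x"] d_d'_less[of p i j q x]
      d_t'_le[of p i x q] d_mem[of p i x q]
      by (simp add: mem)
  next
    case False
    then show ?thesis using that by (intro d_d'_less) simp_all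
  qed
  show ?thesis
    by unfold_locales
      (fact unbarred barred d_d'_le d_s'_le d_t'_le s_d'_le s_s' s_t' t_d'_le t_s' t_t')+
qed

section \<open>Sweeping factors through a block\<close>

context tensor_calculus
begin

text \<open>
The factor at position \<open>i\<close> is carried to the right past \<open>n\<close> factors. Unlike the function \<open>sweep\<close>, this
allows \<open>n = 0\<close> and acts at any position, both of which the inductions need.
\<close>

primrec sweep_at :: "(('k, 'a, 'b) tensor \<Rightarrow> ('k, 'a, 'b) tensor) \<Rightarrow> nat \<Rightarrow> nat \<Rightarrow>
    ('k, 'a, 'b) tensor \<Rightarrow> ('k, 'a, 'b) tensor" where
  "sweep_at K i 0 x = x"
| "sweep_at K i (Suc n) x = onf (i + n) 2 K (sweep_at K i n x)"

text \<open>
The \<open>m\<close> factors from position \<open>i\<close> on are carried past the following \<open>n\<close> factors, the last one first.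
\<close>

primrec cross :: "(('k, 'a, 'b) tensor \<Rightarrow> ('k, 'a, 'b) tensor) \<Rightarrow> nat \<Rightarrow> nat \<Rightarrow> nat \<Rightarrow>
    ('k, 'a, 'b) tensor \<Rightarrow> ('k, 'a, 'b) tensor" where
  "cross K i 0 n x = x"
| "cross K i (Suc m) n x = sweep_at K i n (cross K (Suc i) m n x)"

lemma sweep_at_add: "sweep_at K i (m + n) x = sweep_at K (i + m) n (sweep_at K i m x)"
  by (induction n) (simp_all add: add.assoc)

lemma sweep_at_Suc: "sweep_at K i (Suc n) x = sweep_at K (Suc i) n (onf i 2 K x)"
  using sweep_at_add[of K i 1 n x] by simp

lemma arr_sweep_at:
  assumes K: "arr [c, e] [e, c] K" and i: "i = length u"
  shows "W = u @ c # replicate n e @ v \<Longrightarrow> W' = u @ replicate n e @ c # v \<Longrightarrow> arr W W' (sweep_at K i n)"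
proof (induction n arbitrary: v W W')
  case 0
  then show ?case by (simp add: linear_on_def)
next
  case (Suc n)
  have 1: "arr W (u @ replicate n e @ c # e # v) (sweep_at K i n)"
    by (rule Suc.IH[of _ "e # v"]) (simp_all add: Suc.prems replicate_app_Cons_same)
  have 2: "arr (u @ replicate n e @ c # e # v) W' (onf (i + n) 2 K)"
    by (rule arr_onf[OF K, of _ "u @ replicate n e" _ _ v])
      (simp_all add: Suc.prems i replicate_app_Cons_same)
  show ?case using arr_comp[OF 1 2] by simp
qed

lemma sweep_at_mem:
  "x \<in> T W \<Longrightarrow> arr [c, e] [e, c] K \<Longrightarrow> W = u @ c # replicate n e @ v \<Longrightarrow> i = length u \<Longrightarrow>
    W' = u @ replicate n e @ c # v \<Longrightarrow> sweep_at K i n x \<in> T W'"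
  using arr_mem[OF arr_sweep_at] by blast

text \<open>
A sweep acts on a slot of \<open>n + 1\<close> factors. Through this the interchange and flip laws for a single
operator apply to a whole sweep at once.
\<close>

lemma sweep_at_onf:
  assumes K: "arr [c, e] [e, c] K" and i: "i = length u" and x: "x \<in> T W"
  shows "W = u @ c # replicate n e @ v \<Longrightarrow> sweep_at K i n x = onf i (Suc n) (sweep_at K 0 n) x"
  using i x
proof (induction n arbitrary: u v i x W)
  case 0
  then show ?case
    using onf_id[of x W u "[c]" v i "Suc 0"] by (simp add: sweep_at.simps(1)[abs_def])
next
  case (Suc n)
  let ?w = "c # replicate n e @ [e]" and ?w' = "replicate n e @ c # [e]"
  have W: "W = u @ (?w) @ v" using Suc.prems by (simp add: replicate_app_Cons_same)
  have G: "arr ?w ?w' (sweep_at K 0 n)"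
    by (rule arr_sweep_at[OF K, of _ "[]" _ _ "[e]"]) simp_all
  have G0: "arr (c # replicate n e) (replicate n e @ [c]) (sweep_at K 0 n)"
    by (rule arr_sweep_at[OF K, of _ "[]" _ _ "[]"]) simp_all
  have H: "arr ?w' (replicate n e @ [e, c]) (onf n 2 K)"
    by (rule arr_onf[OF K, of _ "replicate n e" _ _ "[]"]) simp_all
  have "onf i (Suc (Suc n)) (\<lambda>x. onf n 2 K (sweep_at K 0 n x)) x =
    onf i (Suc (Suc n)) (onf n 2 K) (onf i (Suc (Suc n)) (sweep_at K 0 n) x)"
    by (rule onf_comp[OF G H _ W, symmetric]) (use Suc.prems in simp_all)
  also have "onf i (Suc (Suc n)) (sweep_at K 0 n) x = onf i (Suc (Suc n)) (onf 0 (Suc n) (sweep_at K 0 n)) x"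
  proof (rule onf_cong[OF G _ _ _ W])
    show "arr ?w ?w' (onf 0 (Suc n) (sweep_at K 0 n))"
      by (rule arr_onf[OF G0, of _ "[]" _ _ "[e]"]) simp_all
    show "sweep_at K 0 n y = onf 0 (Suc n) (sweep_at K 0 n) y" if "y \<in> T ?w" for y
      using Suc.IH[of ?w "[]" "[e]" 0 y] that by simp
  qed (use Suc.prems in simp_all)
  also have "onf i (Suc (Suc n)) (onf 0 (Suc n) (sweep_at K 0 n)) x = onf i (Suc n) (sweep_at K 0 n) x"
    by (rule onf_nest[OF G0, of _ W u "[]" "[e]" v]) (use Suc.prems W in simp_all)
  also have "\<dots> = sweep_at K i n x"
    using Suc.IH[of W u "e # v" i x] Suc.prems by (simp add: replicate_app_Cons_same)
  also have "onf i (Suc (Suc n)) (onf n 2 K) (sweep_at K i n x) = onf (i + n) 2 K (sweep_at K i n x)"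
  proof (rule onf_nest[OF K, of _ "u @ ?w' @ v" u "replicate n e" "[]" v])
    show "sweep_at K i n x \<in> T (u @ ?w' @ v)"
      by (rule sweep_at_mem[OF _ K, of _ _ u _ "e # v"])
        (use Suc.prems in \<open>simp_all add: replicate_app_Cons_same\<close>)
  qed (use Suc.prems in simp_all)
  finally show ?case by (simp add: sweep_at.simps(2)[abs_def])
qed

lemma onf_sweep_at_right:
  assumes K: "arr [c, e] [e, c] K" and H: "arr w w' H" and x: "x \<in> T W"
    and W: "W = u @ c # replicate n e @ m @ w @ z" and i: "i = length u"
    and j: "j = length (u @ c # replicate n e @ m)" and k: "k = length w"
  shows "onf j k H (sweep_at K i n x) = sweep_at K i n (onf j k H x)"
proof -
  have S: "arr (c # replicate n e) (replicate n e @ [c]) (sweep_at K 0 n)"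
    by (rule arr_sweep_at[OF K, of _ "[]" _ _ "[]"]) simp_all
  have Hx: "onf j k H x \<in> T (u @ c # replicate n e @ m @ w' @ z)"
    by (rule onf_mem[OF x H _ j k]) (simp_all add: W)
  have "onf j k H (sweep_at K i n x) = onf j k H (onf i (Suc n) (sweep_at K 0 n) x)"
    using sweep_at_onf[OF K i x W] by simp
  also have "\<dots> = onf i (Suc n) (sweep_at K 0 n) (onf j k H x)"
    by (rule onf_interchange[OF S H x, of u m z]) (simp_all add: W i j k)
  also have "\<dots> = sweep_at K i n (onf j k H x)"
    by (rule sweep_at_onf[OF K i Hx refl, symmetric])
  finally show ?thesis .
qed

lemma sweep_at_onf_left:
  assumes K: "arr [c, e] [e, c] K" and G: "arr w w' G" and x: "x \<in> T W"
    and W: "W = u @ w @ m @ c # replicate n e @ z" and i: "i = length u" and k: "k = length w"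
    and j: "j = length (u @ w @ m)" and j': "j' = length (u @ w' @ m)"
  shows "sweep_at K j' n (onf i k G x) = onf i k G (sweep_at K j n x)"
proof -
  have S: "arr (c # replicate n e) (replicate n e @ [c]) (sweep_at K 0 n)"
    by (rule arr_sweep_at[OF K, of _ "[]" _ _ "[]"]) simp_all
  have Gx: "onf i k G x \<in> T ((u @ w' @ m) @ c # replicate n e @ z)"
    by (rule onf_mem[OF x G W i k]) simp
  have "sweep_at K j' n (onf i k G x) = onf j' (Suc n) (sweep_at K 0 n) (onf i k G x)"
    by (rule sweep_at_onf[OF K j' Gx refl])
  also have "\<dots> = onf i k G (onf j (Suc n) (sweep_at K 0 n) x)"
    by (rule onf_interchange[OF G S x, of u m z]) (simp_all add: W i j j' k)
  also have "onf j (Suc n) (sweep_at K 0 n) x = sweep_at K j n x"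
    by (rule sweep_at_onf[OF K j x, of _ z, symmetric]) (simp add: W)
  finally show ?thesis .
qed

lemma flip_sweep_at:
  assumes K: "arr [c, e] [e, c] K" and x: "x \<in> T W" and W: "W = a @ c # replicate n e @ b @ v"
    and i: "i = length a" and k: "k = length (a @ c # replicate n e @ b)" and j: "j = length (v @ a)"
  shows "flip k (sweep_at K i n x) = sweep_at K j n (flip k x)"
proof -
  have S: "arr (c # replicate n e) (replicate n e @ [c]) (sweep_at K 0 n)"
    by (rule arr_sweep_at[OF K, of _ "[]" _ _ "[]"]) simp_all
  have fx: "flip k x \<in> T ((v @ a) @ c # replicate n e @ b)"
    by (rule arr_mem[OF arr_flip[OF k, of _ v] x]) (simp_all add: W)
  have "flip k (sweep_at K i n x) = flip k (onf i (Suc n) (sweep_at K 0 n) x)"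
    by (simp only: sweep_at_onf[OF K i x W])
  also have "\<dots> = onf j (Suc n) (sweep_at K 0 n) (flip k x)"
    by (rule flip_onf_left[OF S x, of a b v]) (simp_all add: W i j k)
  also have "\<dots> = sweep_at K j n (flip k x)"
    by (rule sweep_at_onf[OF K j fx refl, symmetric])
  finally show ?thesis .
qed

text \<open>
Flips compose by addition of lengths modulo the length of the word; \<open>flip_flip\<close> is the case without
wraparound, and here the sum exceeds the length by \<open>length u\<close>.
\<close>

lemma flip_flip_wrap:
  assumes x: "x \<in> T W" and W: "W = u @ v @ z"
    and i: "i = length (u @ v)" and j: "j = length (z @ u)" and k: "k = length u"
  shows "flip j (flip i x) = flip k x"
proof -
  have y: "flip k x \<in> T (v @ z @ u)" by (rule arr_mem[OF arr_flip[OF k W] x]) simp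
  have "flip i x = flip (length v) (flip k x)" by (rule flip_flip[OF x W k refl i, symmetric])
  then show ?thesis using flip_inverse[OF y refl refl j] by simp
qed

lemma sweep_at_sweep_at:
  assumes K: "arr [c, e] [e, c] K" and L: "arr [c', e'] [e', c'] L" and x: "x \<in> T W"
    and W: "W = u @ c # replicate n e @ m @ c' # replicate l e' @ z" and i: "i = length u"
    and j: "j = length (u @ c # replicate n e @ m)"
  shows "sweep_at L j l (sweep_at K i n x) = sweep_at K i n (sweep_at L j l x)"
proof -
  have S: "arr (c' # replicate l e') (replicate l e' @ [c']) (sweep_at L 0 l)"
    by (rule arr_sweep_at[OF L, of _ "[]" _ _ "[]"]) simp_all
  have y: "sweep_at K i n x \<in> T ((u @ replicate n e @ c # m) @ c' # replicate l e' @ z)"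
    by (rule sweep_at_mem[OF x K, of u n "m @ c' # replicate l e' @ z"]) (simp_all add: W i)
  have "sweep_at L j l (sweep_at K i n x) = onf j (Suc l) (sweep_at L 0 l) (sweep_at K i n x)"
    by (rule sweep_at_onf[OF L _ y refl]) (simp add: j)
  also have "\<dots> = sweep_at K i n (onf j (Suc l) (sweep_at L 0 l) x)"
    by (rule onf_sweep_at_right[OF K S x, of u n m z]) (simp_all add: W i j)
  also have "onf j (Suc l) (sweep_at L 0 l) x = sweep_at L j l x"
    by (rule sweep_at_onf[OF L j x, of _ z, symmetric]) (simp add: W)
  finally show ?thesis .
qed

lemma arr_cross:
  assumes K: "arr [c, e] [e, c] K"
  shows "W = u @ replicate m c @ replicate n e @ v \<Longrightarrow> i = length u \<Longrightarrow>
    W' = u @ replicate n e @ replicate m c @ v \<Longrightarrow> arr W W' (cross K i m n)"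
proof (induction m arbitrary: u i W W')
  case 0
  then show ?case by (simp add: linear_on_def)
next
  case (Suc m)
  have "arr W (u @ c # replicate n e @ replicate m c @ v) (cross K (Suc i) m n)"
    by (rule Suc.IH[of _ "u @ [c]"]) (simp_all add: Suc.prems)
  moreover have "arr (u @ c # replicate n e @ replicate m c @ v) W' (sweep_at K i n)"
    by (rule arr_sweep_at[OF K Suc.prems(2) refl]) (simp add: Suc.prems)
  ultimately show ?case using arr_comp by fastforce
qed

lemma cross_mem:
  "x \<in> T W \<Longrightarrow> arr [c, e] [e, c] K \<Longrightarrow> W = u @ replicate m c @ replicate n e @ v \<Longrightarrow> i = length u \<Longrightarrow>
    W' = u @ replicate n e @ replicate m c @ v \<Longrightarrow> cross K i m n x \<in> T W'"
  using arr_mem[OF arr_cross] by blast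

lemma cross_onf_left:
  assumes K: "arr [c, e] [e, c] K" and G: "arr w w' G"
  shows "x \<in> T W \<Longrightarrow> W = u @ w @ m @ replicate k c @ replicate n e @ z \<Longrightarrow> i = length u \<Longrightarrow>
    l = length w \<Longrightarrow> j = length (u @ w @ m) \<Longrightarrow> j' = length (u @ w' @ m) \<Longrightarrow>
    cross K j' k n (onf i l G x) = onf i l G (cross K j k n x)"
proof (induction k arbitrary: m j j' x W z)
  case (Suc k)
  have "cross K (Suc j') k n (onf i l G x) = onf i l G (cross K (Suc j) k n x)"
    by (rule Suc.IH[OF Suc.prems(1), of "m @ [c]" z]) (simp_all add: Suc.prems)
  moreover have "sweep_at K j' n (onf i l G (cross K (Suc j) k n x)) = onf i l G (sweep_at K j n (cross K (Suc j) k n x))"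
  proof (rule sweep_at_onf_left[OF K G _ refl])
    show "cross K (Suc j) k n x \<in> T (u @ w @ m @ c # replicate n e @ replicate k c @ z)"
      by (rule cross_mem[OF Suc.prems(1) K, of "u @ w @ m @ [c]" k n z]) (simp_all add: Suc.prems)
  qed (simp_all add: Suc.prems)
  ultimately show ?case by simp
qed simp

text \<open>
\<open>cross\<close> is defined row by row; this is the first step of its decomposition column by column. The two
orders differ by interchanges of distant elementary crossings.
\<close>

lemma cross_split:
  assumes K: "arr [c, e] [e, c] K"
  shows "x \<in> T W \<Longrightarrow> W = u @ replicate n c @ replicate (Suc m) e @ v \<Longrightarrow> i = length u \<Longrightarrow>
    cross K i n (Suc m) x = cross K (Suc i) n m (cross K i n 1 x)"
proof (induction n arbitrary: u i W)
  case (Suc n)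
  let ?z = "cross K (Suc i) n 1 x"
  have z: "?z \<in> T (u @ [c, e] @ replicate n c @ replicate m e @ v)"
    by (rule cross_mem[OF Suc.prems(1) K, of "u @ [c]" n 1 "replicate m e @ v"]) (simp_all add: Suc.prems)
  have "cross K i (Suc n) (Suc m) x = sweep_at K i (Suc m) (cross K (Suc i) n (Suc m) x)" by simp
  also have "cross K (Suc i) n (Suc m) x = cross K (Suc (Suc i)) n m ?z"
    by (rule Suc.IH[OF Suc.prems(1), of "u @ [c]"]) (simp_all add: Suc.prems)
  also have "sweep_at K i (Suc m) (cross K (Suc (Suc i)) n m ?z) =
      sweep_at K (Suc i) m (onf i 2 K (cross K (Suc (Suc i)) n m ?z))"
    by (rule sweep_at_Suc)
  also have "onf i 2 K (cross K (Suc (Suc i)) n m ?z) = cross K (Suc (Suc i)) n m (onf i 2 K ?z)"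
    by (rule cross_onf_left[OF K K z, of u "[]" n m v, symmetric]) (simp_all add: Suc.prems)
  finally show ?case by simp
qed simp

end

section \<open>Multiplications and units\<close>

locale tensor_algebra = tensor_calculus sA sB + A: assoc_algebra sA + B: assoc_algebra sB
  for sA :: "'k::field \<Rightarrow> 'a::{ring,monoid_mult} \<Rightarrow> 'a"
    and sB :: "'k \<Rightarrow> 'b::{ring,monoid_mult} \<Rightarrow> 'b"
begin

abbreviation "mul \<equiv> tensor_mult sA sB"

text \<open>
The shapes \<open>[True]\<close> and \<open>[False]\<close> stand for \<open>A\<close> and \<open>B\<close>; products and units of both algebras are
handled uniformly in the shape \<open>b\<close>.
\<close>

definition unit_letter :: "bool \<Rightarrow> 'a + 'b" where
  "unit_letter b = (if b then Inl 1 else Inr 1)"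

abbreviation "unit b \<equiv> insert_letter sA sB 0 (unit_letter b)"

lemma isl_unit_letter [simp]: "isl (unit_letter b) = b"
  by (simp add: unit_letter_def)

lemma mult_word_multilinear: "multilinear_on sA sB tensor_scale [b, b] (\<lambda>xs. pt (mult_word xs))"
proof -
  have 1: "map isl u @ l # map isl v = [b, b] \<longleftrightarrow>
    (u = [] \<and> l = b \<and> (\<exists>y. v = [y] \<and> isl y = b)) \<or> (v = [] \<and> l = b \<and> (\<exists>x. u = [x] \<and> isl x = b))"
    for u v :: "('a + 'b) list" and l
    by (cases u; cases v; auto)
  have 2: "isl y = b \<longleftrightarrow> (b \<and> (\<exists>a. y = Inl a)) \<or> (\<not> b \<and> (\<exists>a. y = Inr a))" for y :: "'a + 'b"
    by (cases y) auto
  note letter = pure_tensor_letter[of sA sB "[]" _ _ "[]", simplified]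
  show ?thesis
    unfolding multilinear_on_def 1 2
    by (auto simp: letter algebra_simps A.scale_mult_left A.mult_scale_right
        B.scale_mult_left B.mult_scale_right)
qed

lemma mul_pure: "map isl xs = [b, b] \<Longrightarrow> mul (pt xs) = pt (mult_word xs)"
  unfolding tensor_mult_def by (rule tensor_lift_pure[OF mult_word_multilinear])

lemma mult_word_shape: "map isl xs = [b, b] \<Longrightarrow> map isl (mult_word xs) = [b]"
  by (cases xs rule: mult_word.cases) auto

lemma arr_mul: "arr [b, b] [b] mul"
  unfolding tensor_mult_def
  by (rule tensor_lift_linear[OF tensor_lift_pure[OF mult_word_multilinear]])
    (auto intro!: tensor_space_pure mult_word_shape)

lemma insert_letter_pure:
  assumes "i = length us"
  shows "insert_letter sA sB i l (pt (us @ vs)) = pt (us @ l # vs)"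
proof -
  let ?F = "\<lambda>xs. pt (take i xs @ l # drop i xs)"
  have "multilinear_on sA sB tensor_scale (map isl us @ map isl vs) ?F"
  proof (rule multilinear_on_append)
    fix ys :: "('a + 'b) list"
    have "?F (xs @ ys) = pt ([] @ xs @ l # ys)" if "map isl xs = map isl us" for xs
      using map_eq_imp_length_eq[OF that] assms by simp
    then show "multilinear_on sA sB tensor_scale (map isl us) (\<lambda>xs. ?F (xs @ ys))"
      using pure_tensor_insert_multilinear by (rule multilinear_on_cong)
  next
    fix xs :: "('a + 'b) list" assume "map isl xs = map isl us"
    then have "length xs = length us" by (rule map_eq_imp_length_eq)
    then have "?F (xs @ ys) = pt ((xs @ [l]) @ ys @ [])" for ys
      using assms by simp
    then show "multilinear_on sA sB tensor_scale (map isl vs) (\<lambda>ys. ?F (xs @ ys))"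
      using pure_tensor_insert_multilinear by (rule multilinear_on_cong)
  qed
  from tensor_lift_pure[OF this, of "us @ vs"] show ?thesis
    by (simp add: insert_letter_def assms)
qed

lemma arr_insert_letter:
  assumes i: "i = length u" and W: "W = u @ v" and W': "W' = u @ isl l # v"
  shows "arr W W' (insert_letter sA sB i l)"
  unfolding insert_letter_def
proof (rule tensor_lift_linear)
  fix xs :: "('a + 'b) list" assume "map isl xs = W"
  then obtain us vs where xs: "xs = us @ vs" "map isl us = u" "map isl vs = v"
    unfolding W by (rule map_isl_appendE)
  then have len: "i = length us" using i by auto
  from insert_letter_pure[OF len, of l vs] xs len
  show "tensor_lift (\<lambda>xs. pt (take i xs @ l # drop i xs)) (pt xs) = pt (take i xs @ l # drop i xs)"
    by (simp add: insert_letter_def)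
  show "pt (take i xs @ l # drop i xs) \<in> T W'"
    using xs len W' by (intro tensor_space_pure) simp
qed

lemma arr_unit: "arr [] [b] (unit b)"
  by (rule arr_insert_letter[of _ "[]" _ "[]"]) simp_all

lemma unit_pure: "unit b (pt []) = pt [unit_letter b]"
  using insert_letter_pure[of 0 "[]" "unit_letter b" "[]"] by simp

text \<open>
Inserting a unit is an operator on an empty slot, so the interchange law covers degeneracies too.
\<close>

lemma insert_letter_onf:
  assumes x: "x \<in> T W" and W: "W = u @ v" and i: "i = length u"
  shows "insert_letter sA sB i (unit_letter b) x = onf i 0 (unit b) x"
  using _ _ _ x
proof (rule arr_ext)
  show "arr W (u @ b # v) (insert_letter sA sB i (unit_letter b))"
    by (rule arr_insert_letter[OF i W]) simp
  show "arr W (u @ b # v) (onf i 0 (unit b))"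
    by (rule arr_onf[OF arr_unit i, of _ _ v]) (simp_all add: W)
  fix xs :: "('a + 'b) list" assume "map isl xs = W"
  then obtain us vs where xs: "xs = us @ vs" "map isl us = u" "map isl vs = v"
    unfolding W by (rule map_isl_appendE)
  then have len: "i = length us" using i by auto
  show "insert_letter sA sB i (unit_letter b) (pt xs) = onf i 0 (unit b) (pt xs)"
    using insert_letter_pure[OF len, of "unit_letter b" vs] onf_pure[OF arr_unit, of "[]" i us 0 b vs] len
    by (simp add: xs unit_pure insert_tensor_pure)
qed

lemma mul_mul:
  assumes x: "x \<in> T W" and W: "W = u @ [b, b, b] @ v" and i: "i = length u" and j: "j = Suc i"
  shows "onf i 2 mul (onf i 2 mul x) = onf i 2 mul (onf j 2 mul x)"
proof -
  have 1: "arr [b, b, b] [b, b] (onf 0 2 mul)"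
    by (rule arr_onf[OF arr_mul, of _ "[]" _ _ _ "[b]"]) simp_all
  have 2: "arr [b, b, b] [b, b] (onf 1 2 mul)"
    by (rule arr_onf[OF arr_mul, of _ "[b]" _ _ _ "[]"]) simp_all
  note l = arr_comp[OF 1 arr_mul] and r = arr_comp[OF 2 arr_mul]
  have eq: "mul (onf 0 2 mul y) = mul (onf 1 2 mul y)" if "y \<in> T [b, b, b]" for y
    using l r _ that
  proof (rule arr_ext)
    fix xs :: "('a + 'b) list" assume "map isl xs = [b, b, b]"
    then obtain p q r where xs: "xs = [p, q, r]" "isl p = b" "isl q = b" "isl r = b" by auto
    have "onf 0 2 mul (pt xs) = pt (mult_word [p, q] @ [r])"
      using onf_pure[OF arr_mul, of "[p, q]" b 0 "[]" 2 "[r]"] mul_pure[of "[p, q]"] xs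
      by (simp add: insert_tensor_pure)
    moreover have "onf 1 2 mul (pt xs) = pt (p # mult_word [q, r])"
      using onf_pure[OF arr_mul, of "[q, r]" b 1 "[p]" 2 "[]"] mul_pure[of "[q, r]"] xs
      by (simp add: insert_tensor_pure)
    moreover have "mul (pt (mult_word [p, q] @ [r])) = pt (mult_word (mult_word [p, q] @ [r]))"
      "mul (pt (p # mult_word [q, r])) = pt (mult_word (p # mult_word [q, r]))"
      using mult_word_shape[of "[p, q]" b] mult_word_shape[of "[q, r]" b] xs
      by (intro mul_pure[of _ b]; simp)+
    moreover have "mult_word (mult_word [p, q] @ [r]) = mult_word (p # mult_word [q, r])"
      using xs by (cases p; cases q; cases r) (auto simp: mult.assoc)
    ultimately show "mul (onf 0 2 mul (pt xs)) = mul (onf 1 2 mul (pt xs))" by simp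
  qed
  have "onf i 2 mul (onf i 2 mul x) = onf i 3 (\<lambda>x. mul (onf 0 2 mul x)) x"
    by (rule onf_comp_nest[OF arr_mul, of "[]" b "[b]" "[b]" mul, symmetric])
      (use arr_mul[of b] x in \<open>simp_all add: W i\<close>)
  also have "\<dots> = onf i 3 (\<lambda>x. mul (onf 1 2 mul x)) x"
    by (rule onf_cong[OF l r eq x W i]) simp_all
  also have "\<dots> = onf i 2 mul (onf j 2 mul x)"
    by (rule onf_comp_nest[OF arr_mul, of "[b]" b "[]" "[b]" mul])
      (use arr_mul[of b] x in \<open>simp_all add: W i j\<close>)
  finally show ?thesis .
qed

lemma mul_unit:
  assumes x: "x \<in> T W" and W: "W = u @ [b] @ v" and i: "i = length u" and j: "j = i \<or> j = Suc i"
  shows "onf i 2 mul (onf j 0 (unit b) x) = x"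
proof -
  define k where "k = j - i"
  have k: "k = 0 \<or> k = 1" and jk: "j = i + k" using j by (auto simp: k_def)
  have 1: "arr [b] [b, b] (onf k 0 (unit b))"
    using k arr_onf[OF arr_unit, of 0 "[]" 0 "[b]" "[b]"] arr_onf[OF arr_unit, of 1 "[b]" 0 "[b]" "[]"]
    by auto
  note l = arr_comp[OF 1 arr_mul]
  have eq: "mul (onf k 0 (unit b) y) = y" if "y \<in> T [b]" for y
    using l arr_id _ that
  proof (rule arr_ext)
    fix xs :: "('a + 'b) list" assume "map isl xs = [b]"
    then obtain p where xs: "xs = [p]" "isl p = b" by auto
    have "onf k 0 (unit b) (pt xs) = pt (if k = 0 then [unit_letter b, p] else [p, unit_letter b])"
      using k onf_pure[OF arr_unit, of "[]" 0 "[]" 0 b "[p]"] onf_pure[OF arr_unit, of "[]" 1 "[p]" 0 b "[]"]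
      by (auto simp: xs unit_pure insert_tensor_pure)
    then show "mul (onf k 0 (unit b) (pt xs)) = pt xs"
      using mul_pure[of "[unit_letter b, p]" b] mul_pure[of "[p, unit_letter b]" b] xs
      by (cases p) (auto simp: unit_letter_def)
  qed
  have "onf i 2 mul (onf j 0 (unit b) x) = onf i 1 (\<lambda>x. mul (onf k 0 (unit b) x)) x"
    using k
  proof
    assume "k = 0"
    then show ?thesis
      by (intro onf_comp_nest[OF arr_unit, of "[]" b "[b]" "[b]" mul, symmetric])
        (use arr_mul[of b] x in \<open>simp_all add: W i jk\<close>)
  next
    assume "k = 1"
    then show ?thesis
      by (intro onf_comp_nest[OF arr_unit, of "[b]" b "[]" "[b]" mul, symmetric])
        (use arr_mul[of b] x in \<open>simp_all add: W i jk\<close>)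
  qed
  also have "\<dots> = onf i 1 (\<lambda>x. x) x"
    by (rule onf_cong[OF l arr_id eq x W i]) simp_all
  also have "\<dots> = x"
    by (rule onf_id[OF x W i]) simp
  finally show ?thesis .
qed

end

section \<open>Crossings\<close>

text \<open>
\<open>mul_c\<close> and \<open>mul_e\<close> are the two quasitriangularity conditions (the hexagons below), \<open>unit_c\<close> and \<open>unit_e\<close> the two normality
conditions. The letters \<open>c\<close> and \<open>e\<close> are parameters so that \<open>R\<close> (with \<open>c\<close> for \<open>B\<close> and \<open>e\<close> for \<open>A\<close>) and
its inverse (with the letters exchanged) are both instances.
\<close>

locale crossing = tensor_algebra sA sB
  for sA :: "'k::field \<Rightarrow> 'a::{ring,monoid_mult} \<Rightarrow> 'a"
    and sB :: "'k \<Rightarrow> 'b::{ring,monoid_mult} \<Rightarrow> 'b" +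
  fixes c e :: bool and K K' :: "('k, 'a, 'b) tensor \<Rightarrow> ('k, 'a, 'b) tensor"
  assumes K: "arr [c, e] [e, c] K" and K': "arr [e, c] [c, e] K'"
    and K'_K: "x \<in> T [c, e] \<Longrightarrow> K' (K x) = x" and K_K': "x \<in> T [e, c] \<Longrightarrow> K (K' x) = x"
    and mul_c: "x \<in> T [c, c, e] \<Longrightarrow> K (onf 0 2 mul x) = onf 1 2 mul (onf 0 2 K (onf 1 2 K x))"
    and mul_e: "x \<in> T [c, e, e] \<Longrightarrow> K (onf 1 2 mul x) = onf 0 2 mul (onf 1 2 K (onf 0 2 K x))"
    and unit_c: "x \<in> T [e] \<Longrightarrow> K (onf 0 0 (unit c) x) = onf 1 0 (unit c) x"
    and unit_e: "x \<in> T [c] \<Longrightarrow> K (onf 1 0 (unit e) x) = onf 0 0 (unit e) x"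
begin

text \<open>
The next five lemmas place the defining identities of \<open>K\<close> at an arbitrary position of a longer word.
\<close>

lemma K_mul_c:
  assumes x: "x \<in> T W" and W: "W = u @ [c, c, e] @ v" and i: "i = length u" and j: "j = Suc i"
  shows "onf i 2 K (onf i 2 mul x) = onf j 2 mul (onf i 2 K (onf j 2 K x))"
proof -
  have M: "arr [c, c, e] [c, e] (onf 0 2 mul)"
    by (rule arr_onf[OF arr_mul, of _ "[]" _ _ _ "[e]"]) simp_all
  have M1: "arr [e, c, c] [e, c] (onf 1 2 mul)"
    by (rule arr_onf[OF arr_mul, of _ "[e]" _ _ _ "[]"]) simp_all
  have X1: "arr [c, c, e] [c, e, c] (onf 1 2 K)"
    by (rule arr_onf[OF K, of _ "[c]" _ _ "[]"]) simp_all
  have X0: "arr [c, e, c] [e, c, c] (onf 0 2 K)"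
    by (rule arr_onf[OF K, of _ "[]" _ _ "[c]"]) simp_all
  have y: "onf j 2 K x \<in> T (u @ [c, e, c] @ v)"
    by (rule onf_mem[OF x K, of "u @ [c]" v]) (simp_all add: W i j)
  have z: "onf i 2 K (onf j 2 K x) \<in> T (u @ [e, c, c] @ v)"
    by (rule onf_mem[OF y K, of u "c # v"]) (simp_all add: i)
  have "onf i 2 K (onf i 2 mul x) = onf i 3 (\<lambda>x. K (onf 0 2 mul x)) x"
    by (rule onf_comp_nest[OF arr_mul, of "[]" c "[e]" _ K, symmetric])
      (use K x in \<open>simp_all add: W i\<close>)
  also have "\<dots> = onf i 3 (\<lambda>x. onf 1 2 mul (onf 0 2 K (onf 1 2 K x))) x"
    by (rule onf_cong[OF arr_comp[OF M K] arr_comp[OF arr_comp[OF X1 X0] M1] mul_c x W i]) simp_all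
  also have "\<dots> = onf i 3 (\<lambda>y. onf 1 2 mul (onf 0 2 K y)) (onf j 2 K x)"
    by (rule onf_comp_nest[OF K, of "[c]" "[]" "[e, c]"])
      (use arr_comp[OF X0 M1] x in \<open>simp_all add: W i j\<close>)
  also have "\<dots> = onf i 3 (onf 1 2 mul) (onf i 2 K (onf j 2 K x))"
    by (rule onf_comp_nest[OF K, of "[]" "[c]" "[e, c]"])
      (use M1 y in \<open>simp_all add: i\<close>)
  also have "\<dots> = onf j 2 mul (onf i 2 K (onf j 2 K x))"
    by (rule onf_nest[OF arr_mul z, of u "[e]" c "[]" v]) (simp_all add: i j)
  finally show ?thesis .
qed

lemma K_mul_e:
  assumes x: "x \<in> T W" and W: "W = u @ [c, e, e] @ v" and i: "i = length u" and j: "j = Suc i"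
  shows "onf i 2 K (onf j 2 mul x) = onf i 2 mul (onf j 2 K (onf i 2 K x))"
proof -
  have M: "arr [c, e, e] [c, e] (onf 1 2 mul)"
    by (rule arr_onf[OF arr_mul, of _ "[c]" _ _ _ "[]"]) simp_all
  have M0: "arr [e, e, c] [e, c] (onf 0 2 mul)"
    by (rule arr_onf[OF arr_mul, of _ "[]" _ _ _ "[c]"]) simp_all
  have X0: "arr [c, e, e] [e, c, e] (onf 0 2 K)"
    by (rule arr_onf[OF K, of _ "[]" _ _ "[e]"]) simp_all
  have X1: "arr [e, c, e] [e, e, c] (onf 1 2 K)"
    by (rule arr_onf[OF K, of _ "[e]" _ _ "[]"]) simp_all
  have y: "onf i 2 K x \<in> T (u @ [e, c, e] @ v)"
    by (rule onf_mem[OF x K, of u "e # v"]) (simp_all add: W i)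
  have z: "onf j 2 K (onf i 2 K x) \<in> T (u @ [e, e, c] @ v)"
    by (rule onf_mem[OF y K, of "u @ [e]" v]) (simp_all add: i j)
  have "onf i 2 K (onf j 2 mul x) = onf i 3 (\<lambda>x. K (onf 1 2 mul x)) x"
    by (rule onf_comp_nest[OF arr_mul, of "[c]" e "[]" _ K, symmetric])
      (use K x in \<open>simp_all add: W i j\<close>)
  also have "\<dots> = onf i 3 (\<lambda>x. onf 0 2 mul (onf 1 2 K (onf 0 2 K x))) x"
    by (rule onf_cong[OF arr_comp[OF M K] arr_comp[OF arr_comp[OF X0 X1] M0] mul_e x W i]) simp_all
  also have "\<dots> = onf i 3 (\<lambda>y. onf 0 2 mul (onf 1 2 K y)) (onf i 2 K x)"
    by (rule onf_comp_nest[OF K, of "[]" "[e]" "[e, c]"])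
      (use arr_comp[OF X1 M0] x in \<open>simp_all add: W i\<close>)
  also have "\<dots> = onf i 3 (onf 0 2 mul) (onf j 2 K (onf i 2 K x))"
    by (rule onf_comp_nest[OF K, of "[e]" "[]" "[e, c]"])
      (use M0 y in \<open>simp_all add: i j\<close>)
  also have "\<dots> = onf i 2 mul (onf j 2 K (onf i 2 K x))"
    by (rule onf_nest[OF arr_mul z, of u "[]" e "[c]" v]) (simp_all add: i)
  finally show ?thesis .
qed

lemma K_unit_c:
  assumes x: "x \<in> T W" and W: "W = u @ [e] @ v" and i: "i = length u" and j: "j = Suc i"
  shows "onf i 2 K (onf i 0 (unit c) x) = onf j 0 (unit c) x"
proof -
  have U0: "arr [e] [c, e] (onf 0 0 (unit c))"
    by (rule arr_onf[OF arr_unit, of _ "[]" _ _ "[e]"]) simp_all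
  have U1: "arr [e] [e, c] (onf 1 0 (unit c))"
    by (rule arr_onf[OF arr_unit, of _ "[e]" _ _ "[]"]) simp_all
  have "onf i 2 K (onf i 0 (unit c) x) = onf i 1 (\<lambda>x. K (onf 0 0 (unit c) x)) x"
    by (rule onf_comp_nest[OF arr_unit, of "[]" c "[e]" _ K, symmetric])
      (use K x in \<open>simp_all add: W i\<close>)
  also have "\<dots> = onf i 1 (onf 1 0 (unit c)) x"
    by (rule onf_cong[OF arr_comp[OF U0 K] U1 unit_c x W i]) simp_all
  also have "\<dots> = onf j 0 (unit c) x"
    by (rule onf_nest[OF arr_unit x, of u "[e]" "[]" v]) (simp_all add: W i j)
  finally show ?thesis .
qed

lemma K_unit_e:
  assumes x: "x \<in> T W" and W: "W = u @ [c] @ v" and i: "i = length u" and j: "j = Suc i"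
  shows "onf i 2 K (onf j 0 (unit e) x) = onf i 0 (unit e) x"
proof -
  have U0: "arr [c] [e, c] (onf 0 0 (unit e))"
    by (rule arr_onf[OF arr_unit, of _ "[]" _ _ "[c]"]) simp_all
  have U1: "arr [c] [c, e] (onf 1 0 (unit e))"
    by (rule arr_onf[OF arr_unit, of _ "[c]" _ _ "[]"]) simp_all
  have "onf i 2 K (onf j 0 (unit e) x) = onf i 1 (\<lambda>x. K (onf 1 0 (unit e) x)) x"
    by (rule onf_comp_nest[OF arr_unit, of "[c]" e "[]" _ K, symmetric])
      (use K x in \<open>simp_all add: W i j\<close>)
  also have "\<dots> = onf i 1 (onf 0 0 (unit e)) x"
    by (rule onf_cong[OF arr_comp[OF U1 K] U0 unit_e x W i]) simp_all
  also have "\<dots> = onf i 0 (unit e) x"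
    by (rule onf_nest[OF arr_unit x, of u "[]" "[c]" v]) (simp_all add: W i)
  finally show ?thesis .
qed

lemma K_inverse:
  assumes x: "x \<in> T W" and i: "i = length u"
  shows "W = u @ [c, e] @ v \<Longrightarrow> onf i 2 K' (onf i 2 K x) = x"
    and "W = u @ [e, c] @ v \<Longrightarrow> onf i 2 K (onf i 2 K' x) = x"
proof -
  assume W: "W = u @ [c, e] @ v"
  have "onf i 2 K' (onf i 2 K x) = onf i 2 (\<lambda>x. K' (K x)) x"
    by (rule onf_comp[OF K K' x W i]) simp_all
  also have "\<dots> = onf i 2 (\<lambda>x. x) x"
    by (rule onf_cong[OF arr_comp[OF K K'] arr_id K'_K x W i]) simp_all
  finally show "onf i 2 K' (onf i 2 K x) = x"
    using onf_id[OF x W i, of 2] by simp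
next
  assume W: "W = u @ [e, c] @ v"
  have "onf i 2 K (onf i 2 K' x) = onf i 2 (\<lambda>x. K (K' x)) x"
    by (rule onf_comp[OF K' K x W i]) simp_all
  also have "\<dots> = onf i 2 (\<lambda>x. x) x"
    by (rule onf_cong[OF arr_comp[OF K' K] arr_id K_K' x W i]) simp_all
  finally show "onf i 2 K (onf i 2 K' x) = x"
    using onf_id[OF x W i, of 2] by simp
qed

section \<open>Naturality of sweeps\<close>

text \<open>
The product is formed from neighbours \<open>a\<close> and \<open>a + 1\<close> of the block. Before reaching them the sweep does
not touch them, at them the hexagon for \<open>e\<close> applies, and beyond them it acts to the right of them.
\<close>

lemma sweep_at_mul_e:
  assumes x: "x \<in> T W" and W: "W = u @ c # replicate (Suc (Suc n)) e @ v" and i: "i = length u"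
    and a: "a \<le> n" and j: "j = i + a" and j': "j' = Suc j"
  shows "sweep_at K i (Suc n) (onf j' 2 mul x) = onf j 2 mul (sweep_at K i (Suc (Suc n)) x)"
proof -
  obtain b where n: "n = a + b" using a le_Suc_ex by blast
  note rep = replicate_add replicate_app_Cons_same
  let ?y = "sweep_at K i a x"
  have y: "?y \<in> T ((u @ replicate a e) @ [c, e, e] @ replicate b e @ v)"
    by (rule sweep_at_mem[OF x K, of u a "e # e # replicate b e @ v"]) (simp_all add: W n i rep)
  have y': "onf j 2 K ?y \<in> T ((u @ replicate a e) @ [e, c, e] @ replicate b e @ v)"
    by (rule onf_mem[OF y K, of _ "e # replicate b e @ v"]) (simp_all add: i j)
  have z: "onf j' 2 K (onf j 2 K ?y) \<in> T ((u @ replicate a e) @ [e, e, c] @ replicate b e @ v)"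
    by (rule onf_mem[OF y' K, of "u @ replicate a e @ [e]" "replicate b e @ v"]) (simp_all add: i j j')
  have "sweep_at K i (Suc n) (onf j' 2 mul x) = sweep_at K (Suc j) b (onf j 2 K (sweep_at K i a (onf j' 2 mul x)))"
    using sweep_at_add[of K i a "Suc b"] by (simp add: n sweep_at_Suc j del: sweep_at.simps(2))
  also have "sweep_at K i a (onf j' 2 mul x) = onf j' 2 mul ?y"
    by (rule onf_sweep_at_right[OF K arr_mul x, of u a "[]" e "replicate b e @ v", symmetric])
      (simp_all add: W n i j j' rep)
  also have "onf j 2 K \<dots> = onf j 2 mul (onf j' 2 K (onf j 2 K ?y))"
    by (rule K_mul_e[OF y refl _ j']) (simp add: i j)
  also have "sweep_at K (Suc j) b \<dots> = onf j 2 mul (sweep_at K (Suc (Suc j)) b (onf j' 2 K (onf j 2 K ?y)))"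
    by (rule sweep_at_onf_left[OF K arr_mul z, of "u @ replicate a e" e "[]" b v]) (simp_all add: i j)
  also have "sweep_at K (Suc (Suc j)) b (onf j' 2 K (onf j 2 K ?y)) = sweep_at K i (Suc (Suc n)) x"
    using sweep_at_add[of K i a "Suc (Suc b)" x] by (simp add: n sweep_at_Suc j j' del: sweep_at.simps(2))
  finally show ?thesis .
qed

lemma sweep_at_unit_e:
  assumes x: "x \<in> T W" and W: "W = u @ c # replicate n e @ v" and i: "i = length u"
    and a: "a \<le> n" and j: "j = i + a" and j': "j' = Suc j"
  shows "sweep_at K i (Suc n) (onf j' 0 (unit e) x) = onf j 0 (unit e) (sweep_at K i n x)"
proof -
  obtain b where n: "n = a + b" using a le_Suc_ex by blast
  let ?y = "sweep_at K i a x"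
  have y: "?y \<in> T ((u @ replicate a e) @ [c] @ replicate b e @ v)"
    by (rule sweep_at_mem[OF x K, of u a "replicate b e @ v"]) (simp_all add: W n i replicate_add)
  have "sweep_at K i (Suc n) (onf j' 0 (unit e) x) =
      sweep_at K (Suc j) b (onf j 2 K (sweep_at K i a (onf j' 0 (unit e) x)))"
    using sweep_at_add[of K i a "Suc b"] by (simp add: n sweep_at_Suc j del: sweep_at.simps(2))
  also have "sweep_at K i a (onf j' 0 (unit e) x) = onf j' 0 (unit e) ?y"
    by (rule onf_sweep_at_right[OF K arr_unit x, of u a "[]" "replicate b e @ v", symmetric])
      (simp_all add: W n i j j' replicate_add)
  also have "onf j 2 K \<dots> = onf j 0 (unit e) ?y"
    by (rule K_unit_e[OF y refl _ j']) (simp add: i j)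
  also have "sweep_at K (Suc j) b \<dots> = onf j 0 (unit e) (sweep_at K j b ?y)"
    by (rule sweep_at_onf_left[OF K arr_unit y, of "u @ replicate a e" "[]" b v]) (simp_all add: i j)
  also have "sweep_at K j b ?y = sweep_at K i n x"
    by (simp add: n j sweep_at_add)
  finally show ?thesis .
qed

text \<open>
The two sweeps on the right are run in parallel, one step apart, and at each step the hexagon for \<open>c\<close>
merges them.
\<close>

lemma sweep_at_mul_c:
  assumes i: "i = length u"
  shows "x \<in> T W \<Longrightarrow> W = u @ c # c # replicate n e @ v \<Longrightarrow>
    sweep_at K i n (onf i 2 mul x) = onf (i + n) 2 mul (sweep_at K i n (sweep_at K (Suc i) n x))"
proof (induction n arbitrary: v W)
  case (Suc n)
  note rep = replicate_app_Cons_same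
  have W: "W = u @ c # c # replicate n e @ e # v" using Suc.prems(2) by (simp add: rep)
  let ?q = "sweep_at K (Suc i) n x" and ?p = "sweep_at K i n (sweep_at K (Suc i) n x)"
  have q: "?q \<in> T (u @ c # replicate n e @ [c, e] @ v)"
    by (rule sweep_at_mem[OF Suc.prems(1) K, of "u @ [c]" n "e # v"]) (simp_all add: W i)
  have p: "?p \<in> T ((u @ replicate n e) @ [c, c, e] @ v)"
    by (rule sweep_at_mem[OF q K, of u n "c # e # v"]) (simp_all add: i)
  have "sweep_at K i (Suc n) (onf i 2 mul x) = onf (i + n) 2 K (onf (i + n) 2 mul ?p)"
    using Suc.IH[OF Suc.prems(1) W] by simp
  also have "\<dots> = onf (Suc (i + n)) 2 mul (onf (i + n) 2 K (onf (Suc (i + n)) 2 K ?p))"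
    by (rule K_mul_c[OF p refl]) (simp_all add: i)
  also have "onf (Suc (i + n)) 2 K ?p = sweep_at K i n (onf (Suc (i + n)) 2 K ?q)"
    by (rule onf_sweep_at_right[OF K K q, of u n "[]" v]) (simp_all add: i)
  finally show ?case by simp
qed simp

lemma sweep_at_unit_c:
  assumes i: "i = length u"
  shows "x \<in> T W \<Longrightarrow> W = u @ replicate n e @ v \<Longrightarrow>
    sweep_at K i n (onf i 0 (unit c) x) = onf (i + n) 0 (unit c) x"
proof (induction n arbitrary: v W)
  case (Suc n)
  have W: "W = u @ replicate n e @ e # v" using Suc.prems(2) by (simp add: replicate_app_Cons_same)
  have "sweep_at K i (Suc n) (onf i 0 (unit c) x) = onf (i + n) 2 K (onf (i + n) 0 (unit c) x)"
    using Suc.IH[OF Suc.prems(1) W] by simp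
  also have "\<dots> = onf (i + Suc n) 0 (unit c) x"
    by (rule K_unit_c[OF Suc.prems(1), of "u @ replicate n e" v]) (simp_all add: W i)
  finally show ?case .
qed simp

lemma bij_sweep_at:
  assumes i: "i = length u"
  shows "W = u @ c # replicate n e @ v \<Longrightarrow> W' = u @ replicate n e @ c # v \<Longrightarrow>
    bij_betw (sweep_at K i n) (T W) (T W')"
proof (induction n arbitrary: v W W')
  case 0
  then show ?case by (simp add: sweep_at.simps(1)[abs_def] bij_betw_def)
next
  case (Suc n)
  let ?V = "(u @ replicate n e) @ [c, e] @ v" and ?V' = "(u @ replicate n e) @ [e, c] @ v"
  have j: "i + n = length (u @ replicate n e)" by (simp add: i)
  have "bij_betw (sweep_at K i n) (T W) (T ?V)"
    by (rule Suc.IH[of _ "e # v"]) (simp_all add: Suc.prems replicate_app_Cons_same)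
  moreover have "bij_betw (onf (i + n) 2 K) (T ?V) (T ?V')"
  proof (rule bij_betw_byWitness[where f' = "onf (i + n) 2 K'"])
    show "onf (i + n) 2 K ` T ?V \<subseteq> T ?V'"
      using onf_mem[OF _ K refl j, where n = 2] by auto
    show "onf (i + n) 2 K' ` T ?V' \<subseteq> T ?V"
      using onf_mem[OF _ K' refl j, where n = 2] by auto
  qed (use K_inverse[OF _ j] in auto)
  ultimately have "bij_betw (onf (i + n) 2 K \<circ> sweep_at K i n) (T W) (T ?V')" by (rule bij_betw_trans)
  then show ?case
    by (simp add: Suc.prems replicate_app_Cons_same comp_def)
qed

section \<open>Full crossings\<close>

lemma sweep_at_cross_inverse:
  "x \<in> T W \<Longrightarrow> W = u @ replicate n e @ c # v \<Longrightarrow> i = length u \<Longrightarrow> sweep_at K i n (cross K' i n 1 x) = x"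
proof (induction n arbitrary: u i W)
  case (Suc n)
  let ?y = "cross K' (Suc i) n 1 x"
  have y: "?y \<in> T (u @ [e, c] @ replicate n e @ v)"
    by (rule cross_mem[OF Suc.prems(1) K', of "u @ [e]" n 1 v]) (simp_all add: Suc.prems)
  have "sweep_at K i (Suc n) (cross K' i (Suc n) 1 x) = sweep_at K (Suc i) n (onf i 2 K (onf i 2 K' ?y))"
    by (simp add: sweep_at_Suc del: sweep_at.simps(2))
  also have "onf i 2 K (onf i 2 K' ?y) = ?y"
    by (rule K_inverse(2)[OF y Suc.prems(3) refl])
  also have "sweep_at K (Suc i) n ?y = x"
    by (rule Suc.IH[OF Suc.prems(1), of "u @ [e]"]) (simp_all add: Suc.prems)
  finally show ?case .
qed simp

text \<open>
By \<open>cross_split\<close>, the block of factors \<open>e\<close> first crosses one factor \<open>c\<close>, and that factor is the one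
which \<open>cross K\<close> carries back last. Between these two steps stands the same composite with one factor
\<open>c\<close> less.
\<close>

lemma cross_inverse:
  "x \<in> T W \<Longrightarrow> W = u @ replicate n e @ replicate m c @ v \<Longrightarrow> i = length u \<Longrightarrow>
    cross K i m n (cross K' i n m x) = x"
proof (induction m arbitrary: u i W x)
  case 0
  have "cross K' i n 0 x = x" for i by (induction n arbitrary: i) simp_all
  then show ?case by simp
next
  case (Suc m)
  let ?y = "cross K' i n 1 x"
  have y: "?y \<in> T ((u @ [c]) @ replicate n e @ replicate m c @ v)"
    by (rule cross_mem[OF Suc.prems(1) K', of u n 1 "replicate m c @ v"]) (simp_all add: Suc.prems)
  have "cross K i (Suc m) n (cross K' i n (Suc m) x) = sweep_at K i n (cross K (Suc i) m n (cross K' (Suc i) n m ?y))"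
    using cross_split[OF K' Suc.prems(1), of u n m v i] Suc.prems by simp
  also have "cross K (Suc i) m n (cross K' (Suc i) n m ?y) = ?y"
    by (rule Suc.IH[OF y refl]) (simp add: Suc.prems)
  also have "sweep_at K i n ?y = x"
    by (rule sweep_at_cross_inverse[OF Suc.prems(1), of u n "replicate m c @ v"]) (simp_all add: Suc.prems)
  finally show ?case .
qed

section \<open>The paracyclic module of a crossing\<close>

text \<open>
The operators are only required to agree with the given formulas on the relevant spaces. The
relations without \<open>t\<close> are interchange laws, associativity and unit laws; those with \<open>t\<close> combine
naturality of the sweep with naturality of the flip that follows it.
\<close>

lemma paracyclic_left:
  fixes n :: nat
  defines "C \<equiv> \<lambda>p. T (replicate (p + 1) c @ replicate n e)"
  assumes d: "\<And>p i x. i < p \<Longrightarrow> x \<in> C p \<Longrightarrow> d p i x = onf i 2 mul x"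
    and d_last: "\<And>p x. 1 \<le> p \<Longrightarrow> x \<in> C p \<Longrightarrow> d p p x = d p 0 (t p x)"
    and s: "\<And>p i x. i \<le> p \<Longrightarrow> x \<in> C p \<Longrightarrow> s p i x = onf (i + 1) 0 (unit c) x"
    and t: "\<And>p x. x \<in> C p \<Longrightarrow> t p x = flip (p + n) (sweep_at K p n x)"
  shows "paracyclic_module tensor_scale C d s t"
proof -
  have W1: "replicate (p + 1) c @ replicate n e = replicate i c @ [c, c] @ replicate (p - Suc i) c @ replicate n e"
    "replicate (p - 1 + 1) c @ replicate n e = replicate i c @ [c] @ replicate (p - Suc i) c @ replicate n e"
    if "i < p" for p i
  proof -
    from that obtain r where p: "p = i + 1 + r" using le_Suc_ex[of "i + 1" p] by auto
    show "replicate (p + 1) c @ replicate n e = replicate i c @ [c, c] @ replicate (p - Suc i) c @ replicate n e"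
      "replicate (p - 1 + 1) c @ replicate n e = replicate i c @ [c] @ replicate (p - Suc i) c @ replicate n e"
      by (simp_all add: p replicate_add replicate_app_Cons_same)
  qed
  have W0: "replicate (p + 1) c @ replicate n e = replicate i c @ replicate (p + 1 - i) c @ replicate n e"
    "replicate (p + 1 + 1) c @ replicate n e = replicate i c @ [c] @ replicate (p + 1 - i) c @ replicate n e"
    if "i \<le> p + 1" for p i
  proof -
    from that obtain r where p: "p + 1 = i + r" using le_Suc_ex by blast
    show "replicate (p + 1) c @ replicate n e = replicate i c @ replicate (p + 1 - i) c @ replicate n e"
      "replicate (p + 1 + 1) c @ replicate n e = replicate i c @ [c] @ replicate (p + 1 - i) c @ replicate n e"
      unfolding p by (simp_all add: replicate_add replicate_app_Cons_same)
  qed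
  have arr_M: "arr (replicate (p + 1) c @ replicate n e) (replicate (p - 1 + 1) c @ replicate n e) (onf i 2 mul)"
    if "i < p" for p i
    by (rule arr_onf[OF arr_mul _ _ W1(1)[OF that] W1(2)[OF that]]) simp_all
  have arr_U: "arr (replicate (p + 1) c @ replicate n e) (replicate (p + 1 + 1) c @ replicate n e)
      (onf (i + 1) 0 (unit c))" if "i \<le> p" for p i
    by (rule arr_onf[OF arr_unit, of _ "replicate (i + 1) c" _ _ "replicate (p + 1 - (i + 1)) c @ replicate n e"])
      (use W0[of "i + 1" p] that in simp_all)
  have arr_S: "arr (replicate (p + 1) c @ replicate n e) (replicate p c @ replicate n e @ [c]) (sweep_at K p n)" for p
    by (rule arr_sweep_at[OF K, of _ "replicate p c" _ _ "[]"]) (simp_all add: replicate_app_Cons_same)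
  have arr_F: "arr (replicate p c @ replicate n e @ [c]) (replicate (p + 1) c @ replicate n e) (flip (p + n))" for p
    by (rule arr_flip[of _ "replicate p c @ replicate n e" _ "[c]"]) simp_all
  note arr_t = arr_comp[OF arr_S arr_F]
  have M_mem: "onf i 2 mul x \<in> C (p - 1)" if "i < p" "x \<in> C p" for p i x
    using arr_mem[OF arr_M] that unfolding C_def by blast
  have U_mem: "onf (i + 1) 0 (unit c) x \<in> C (p + 1)" if "i \<le> p" "x \<in> C p" for p i x
    using arr_mem[OF arr_U] that unfolding C_def by blast
  have S_mem: "sweep_at K p n x \<in> T (replicate p c @ replicate n e @ [c])" if "x \<in> C p" for p x
    using arr_mem[OF arr_S] that unfolding C_def by blast
  have t_mem: "flip (p + n) (sweep_at K p n x) \<in> C p" if "x \<in> C p" for p x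
    using arr_mem[OF arr_t] that unfolding C_def by blast
  show ?thesis
  proof (rule paracyclic_moduleI)
    show "module (tensor_scale :: 'k \<Rightarrow> ('k, 'a, 'b) tensor \<Rightarrow> _)"
      by (rule tensor.module_axioms)
    show "module.subspace tensor_scale (C p)" for p
      unfolding C_def tensor_space_def by (rule tensor.subspace_span)
    show "linear_on tensor_scale tensor_scale (C p) (C (p - 1)) (d p i)" if "i < p" for p i
      using arr_cong[OF arr_M[OF that], of "d p i"] d[OF that] unfolding C_def by blast
    show "linear_on tensor_scale tensor_scale (C p) (C (p + 1)) (s p i)" if "i \<le> p" for p i
      using arr_cong[OF arr_U[OF that], of "s p i"] s[OF that] unfolding C_def by blast
    show "linear_on tensor_scale tensor_scale (C p) (C p) (t p)" for p
      using arr_cong[OF arr_t, of _ "t p"] t unfolding C_def by blast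
    show "bij_betw (t p) (C p) (C p)" for p
    proof -
      have "bij_betw (sweep_at K p n) (C p) (T (replicate p c @ replicate n e @ [c]))"
        unfolding C_def
        by (rule bij_sweep_at[of _ "replicate p c" _ _ "[]"]) (simp_all add: replicate_app_Cons_same)
      moreover have "bij_betw (flip (p + n)) (T (replicate p c @ replicate n e @ [c])) (C p)"
        unfolding C_def by (rule bij_flip[of _ "replicate p c @ replicate n e" _ "[c]"]) simp_all
      ultimately have "bij_betw (flip (p + n) \<circ> sweep_at K p n) (C p) (C p)" by (rule bij_betw_trans)
      then show ?thesis by (subst bij_betw_cong[where g = "flip (p + n) \<circ> sweep_at K p n"]) (simp_all add: t)
    qed
    fix p i j :: nat and x
    show "d p p x = d p 0 (t p x)" if "1 \<le> p" "x \<in> C p"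
      using that by (rule d_last)
    show "d (p - 1) i (d p j x) = d (p - 1) (j - 1) (d p i x)" if "i < j" "j < p" "x \<in> C p"
    proof -
      have "d (p - 1) i (d p j x) = onf i 2 mul (onf j 2 mul x)"
        using that d[of j p x] d[of i "p - 1"] M_mem[of j p x] by simp
      also have "\<dots> = onf (j - 1) 2 mul (onf i 2 mul x)"
      proof (cases "j = Suc i")
        case True
        have "replicate (p + 1) c @ replicate n e = replicate i c @ [c, c, c] @ replicate (p - Suc j) c @ replicate n e"
          using W1(1)[of i p] that True by (cases "p - Suc i") (simp_all add: Suc_diff_Suc)
        from mul_mul[OF that(3)[unfolded C_def this] refl] show ?thesis by (simp add: True)
      next
        case False
        define r r' where "r = j - (i + 2)" and "r' = p - (j + 1)"
        have j: "j = i + 2 + r" and p: "p = j + 1 + r'"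
          using that False by (simp_all add: r_def r'_def)
        show ?thesis
          by (rule onf_interchange[OF arr_mul arr_mul that(3)[unfolded C_def], symmetric,
                of "replicate i c" c "replicate r c" c "replicate r' c @ replicate n e"])
            (simp_all add: j p replicate_add replicate_app_Cons_same)
      qed
      also have "\<dots> = d (p - 1) (j - 1) (d p i x)"
        using that d[of i p x] d[of "j - 1" "p - 1"] M_mem[of i p x] by simp
      finally show ?thesis .
    qed
    show "s (p + 1) i (s p j x) = s (p + 1) (j + 1) (s p i x)" if "i \<le> j" "j \<le> p" "x \<in> C p"
    proof -
      have "s (p + 1) i (s p j x) = onf (i + 1) 0 (unit c) (onf (j + 1) 0 (unit c) x)"
        using that s[of j p x] s[of i "p + 1"] U_mem[of j p x] by simp
      also have "\<dots> = onf (j + 2) 0 (unit c) (onf (i + 1) 0 (unit c) x)"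
      proof -
        define r r' where "r = j - i" and "r' = p - j"
        have j: "j = i + r" and p: "p = j + r'" using that by (simp_all add: r_def r'_def)
        show ?thesis
          by (rule onf_interchange[OF arr_unit arr_unit that(3)[unfolded C_def], symmetric,
                of "replicate (i + 1) c" "replicate r c" "replicate r' c @ replicate n e"])
            (simp_all add: j p replicate_add replicate_app_Cons_same)
      qed
      also have "\<dots> = s (p + 1) (j + 1) (s p i x)"
        using that s[of i p x] s[of "j + 1" "p + 1"] U_mem[of i p x] by simp
      finally show ?thesis .
    qed
    show "d (p + 1) i (s p j x) = s (p - 1) (j - 1) (d p i x)" if "i < j" "j \<le> p" "x \<in> C p"
    proof -
      have "d (p + 1) i (s p j x) = onf i 2 mul (onf (j + 1) 0 (unit c) x)"
        using that s[of j p x] d[of i "p + 1"] U_mem[of j p x] by simp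
      also have "\<dots> = onf j 0 (unit c) (onf i 2 mul x)"
      proof -
        define r r' where "r = j - (i + 1)" and "r' = p - j"
        have j: "j = i + 1 + r" and p: "p = j + r'" using that by (simp_all add: r_def r'_def)
        show ?thesis
          by (rule onf_interchange[OF arr_mul arr_unit that(3)[unfolded C_def], symmetric,
                of "replicate i c" c "replicate r c" "replicate r' c @ replicate n e"])
            (simp_all add: j p replicate_add replicate_app_Cons_same)
      qed
      also have "\<dots> = s (p - 1) (j - 1) (d p i x)"
        using that d[of i p x] s[of "j - 1" "p - 1"] M_mem[of i p x] by simp
      finally show ?thesis .
    qed
    show "d (p + 1) i (s p j x) = x" if "i \<le> p" "j \<le> p" "i = j \<or> i = j + 1" "x \<in> C p"
    proof -
      have "d (p + 1) i (s p j x) = onf i 2 mul (onf (j + 1) 0 (unit c) x)"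
        using that s[of j p x] d[of i "p + 1"] U_mem[of j p x] by simp
      also have "\<dots> = x"
      proof -
        from that(1) obtain r where p: "p = i + r" using le_Suc_ex by blast
        have W: "replicate (p + 1) c @ replicate n e = replicate i c @ [c] @ replicate r c @ replicate n e"
          by (simp add: p replicate_add replicate_app_Cons_same)
        show ?thesis by (rule mul_unit[OF that(4)[unfolded C_def] W]) (use that in auto)
      qed
      finally show ?thesis .
    qed
    show "d (p + 1) i (s p j x) = s (p - 1) j (d p (i - 1) x)" if "j + 1 < i" "i \<le> p" "x \<in> C p"
    proof -
      have "d (p + 1) i (s p j x) = onf i 2 mul (onf (j + 1) 0 (unit c) x)"
        using that s[of j p x] d[of i "p + 1"] U_mem[of j p x] by simp
      also have "\<dots> = onf (j + 1) 0 (unit c) (onf (i - 1) 2 mul x)"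
      proof -
        define r r' where "r = i - (j + 2)" and "r' = p - i"
        have i: "i = j + 2 + r" and p: "p = i + r'" using that by (simp_all add: r_def r'_def)
        show ?thesis
          by (rule onf_interchange[OF arr_unit arr_mul that(3)[unfolded C_def],
                of "replicate (j + 1) c" "replicate r c" c "replicate r' c @ replicate n e"])
            (simp_all add: i p replicate_add replicate_app_Cons_same)
      qed
      also have "\<dots> = s (p - 1) j (d p (i - 1) x)"
        using that d[of "i - 1" p x] s[of j "p - 1"] M_mem[of "i - 1" p x] by simp
      finally show ?thesis .
    qed
    show "d p i (t p x) = t (p - 1) (d p (i - 1) x)" if "1 \<le> i" "i < p" "x \<in> C p"
    proof -
      define a r where "a = i - 1" and "r = p - (i + 1)"
      have i: "i = 1 + a" and p: "p = i + 1 + r" using that by (simp_all add: a_def r_def)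
      have "d p i (t p x) = onf i 2 mul (flip (p + n) (sweep_at K p n x))"
        using that t[of x p] d[of i p] t_mem[of x p] by simp
      also have "\<dots> = flip (p - 1 + n) (onf a 2 mul (sweep_at K p n x))"
        by (rule flip_onf_left[OF arr_mul S_mem[OF that(3)], symmetric,
              of "replicate a c" c "replicate r c @ replicate n e" "[c]"])
          (simp_all add: i p replicate_add replicate_app_Cons_same)
      also have "onf a 2 mul (sweep_at K p n x) = sweep_at K (p - 1) n (onf a 2 mul x)"
        by (rule sweep_at_onf_left[OF K arr_mul that(3)[unfolded C_def], symmetric,
              of "replicate a c" c "replicate r c" n "[]"])
          (simp_all add: i p replicate_add replicate_app_Cons_same)
      also have "flip (p - 1 + n) \<dots> = t (p - 1) (d p (i - 1) x)"
        using that t[of "onf a 2 mul x" "p - 1"] d[of a p x] M_mem[of a p x] by (simp add: i)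
      finally show ?thesis .
    qed
    show "d p 0 (t p (t p x)) = t (p - 1) (d p (p - 1) x)" if p: "1 \<le> p" and x: "x \<in> C p"
    proof -
      from p obtain r where pr: "p = Suc r" using le_Suc_ex[of 1 p] by auto
      let ?y = "sweep_at K p n x" and ?z = "sweep_at K r n (sweep_at K p n x)"
      have y: "?y \<in> T (replicate r c @ c # replicate n e @ [c])"
        using S_mem[OF x] by (simp add: pr replicate_app_Cons_same)
      have z: "?z \<in> T ((replicate r c @ replicate n e) @ [c, c])"
        by (rule sweep_at_mem[OF y K, of "replicate r c" n "[c]"]) simp_all
      have "d p 0 (t p (t p x)) = onf 0 2 mul (flip (p + n) (sweep_at K p n (flip (p + n) ?y)))"
        using p x t[of x p] t[of "flip (p + n) ?y" p] d[of 0 p "flip (p + n) (sweep_at K p n (flip (p + n) ?y))"]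
          t_mem[of x p] t_mem[of "flip (p + n) ?y" p] by simp
      also have "sweep_at K p n (flip (p + n) ?y) = flip (p + n) ?z"
        by (rule flip_sweep_at[OF K y, of "replicate r c" n "[]" "[c]", symmetric]) (simp_all add: pr)
      also have "flip (p + n) (flip (p + n) ?z) = flip (r + n) ?z"
        by (rule flip_flip_wrap[OF z, of "replicate r c @ replicate n e" "[c]" "[c]"]) (simp_all add: pr)
      also have "onf 0 2 mul (flip (r + n) ?z) = flip (r + n) (onf (r + n) 2 mul ?z)"
        by (rule flip_onf_right[OF arr_mul z, symmetric, of "replicate r c @ replicate n e" "[]" c "[]"])
          (simp_all)
      also have "onf (r + n) 2 mul ?z = sweep_at K r n (onf r 2 mul x)"
        unfolding pr
        by (rule sweep_at_mul_c[OF _ x[unfolded C_def], symmetric, of _ "replicate r c" n "[]"])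
          (simp_all add: pr replicate_app_Cons_same)
      also have "flip (r + n) \<dots> = t (p - 1) (d p (p - 1) x)"
        using x t[of "onf r 2 mul x" r] d[of r p x] M_mem[of r p x] by (simp add: pr)
      finally show ?thesis .
    qed
    show "s p i (t p x) = t (p + 1) (s p (i - 1) x)" if "1 \<le> i" "i \<le> p" "x \<in> C p"
    proof -
      from that obtain r where p: "p = i + r" using le_Suc_ex by blast
      have "s p i (t p x) = onf (i + 1) 0 (unit c) (flip (p + n) (sweep_at K p n x))"
        using that t[of x p] s[of i p] t_mem[of x p] by simp
      also have "\<dots> = flip (p + 1 + n) (onf i 0 (unit c) (sweep_at K p n x))"
        by (rule flip_onf_left[OF arr_unit S_mem[OF that(3)], symmetric,
              of "replicate i c" "replicate r c @ replicate n e" "[c]"])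
          (simp_all add: p replicate_add replicate_app_Cons_same)
      also have "onf i 0 (unit c) (sweep_at K p n x) = sweep_at K (p + 1) n (onf i 0 (unit c) x)"
        by (rule sweep_at_onf_left[OF K arr_unit that(3)[unfolded C_def], symmetric,
              of "replicate i c" "replicate r c" n "[]"])
          (simp_all add: p replicate_add replicate_app_Cons_same)
      also have "flip (p + 1 + n) \<dots> = t (p + 1) (s p (i - 1) x)"
        using that t[of "onf i 0 (unit c) x" "p + 1"] s[of "i - 1" p x] U_mem[of "i - 1" p x] by simp
      finally show ?thesis .
    qed
    have t_s: "t (p + 1) (s p p x) = onf 0 0 (unit c) x" if x: "x \<in> C p"
    proof -
      have "t (p + 1) (s p p x) = flip (p + 1 + n) (sweep_at K (p + 1) n (onf (p + 1) 0 (unit c) x))"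
        using x s[of p p x] t[of "onf (p + 1) 0 (unit c) x" "p + 1"] U_mem[of p p x] by simp
      also have "sweep_at K (p + 1) n (onf (p + 1) 0 (unit c) x) = onf (p + 1 + n) 0 (unit c) x"
        by (rule sweep_at_unit_c[OF _ x[unfolded C_def], of _ "replicate (p + 1) c" n "[]"]) simp_all
      also have "flip (p + 1 + n) \<dots> = onf 0 0 (unit c) (flip (p + 1 + n) x)"
        by (rule flip_onf_right[OF arr_unit x[unfolded C_def], of "replicate (p + 1) c @ replicate n e" "[]" "[]"])
          simp_all
      also have "flip (p + 1 + n) x = x"
        by (rule flip_full[OF x[unfolded C_def]]) simp
      finally show ?thesis .
    qed
    show "d (p + 1) 0 (t (p + 1) (s p p x)) = x" if x: "x \<in> C p"
    proof -
      have Ux: "onf 0 0 (unit c) x \<in> C (p + 1)"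
        unfolding C_def
        by (rule onf_mem[OF x[unfolded C_def] arr_unit, of "[]" "replicate (p + 1) c @ replicate n e"]) simp_all
      then have "d (p + 1) 0 (t (p + 1) (s p p x)) = onf 0 2 mul (onf 0 0 (unit c) x)"
        using x t_s d[of 0 "p + 1"] by simp
      also have "\<dots> = x"
        by (rule mul_unit[OF x[unfolded C_def], of "[]" _ "replicate p c @ replicate n e"]) simp_all
      finally show ?thesis .
    qed
    show "s p 0 (t p x) = t (p + 1) (t (p + 1) (s p p x))" if x: "x \<in> C p"
    proof -
      have Ux: "onf 0 0 (unit c) x \<in> C (p + 1)"
        unfolding C_def
        by (rule onf_mem[OF x[unfolded C_def] arr_unit, of "[]" "replicate (p + 1) c @ replicate n e"]) simp_all
      have "t (p + 1) (t (p + 1) (s p p x)) = flip (p + 1 + n) (sweep_at K (p + 1) n (onf 0 0 (unit c) x))"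
        using x t_s t[OF Ux] by simp
      also have "sweep_at K (p + 1) n (onf 0 0 (unit c) x) = onf 0 0 (unit c) (sweep_at K p n x)"
        by (rule sweep_at_onf_left[OF K arr_unit x[unfolded C_def], of "[]" "replicate p c" n "[]"])
          (simp_all add: replicate_app_Cons_same)
      also have "flip (p + 1 + n) \<dots> = onf 1 0 (unit c) (flip (p + n) (sweep_at K p n x))"
        by (rule flip_onf_left[OF arr_unit S_mem[OF x], of "[]" "replicate p c @ replicate n e" "[c]"]) simp_all
      also have "\<dots> = s p 0 (t p x)"
        using x t[of x p] s[of 0 p] t_mem[of x p] by simp
      finally show ?thesis by simp
    qed
  qed
qed

text \<open>
Every condition on \<open>K\<close> turns into one on \<open>K'\<close> by composing with inverses on both sides, and this
exchanges the roles of the conditions for \<open>c\<close> and for \<open>e\<close>.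
\<close>

lemma dual: "crossing sA sB e c K' K"
proof
  fix x
  show "arr [e, c] [c, e] K'" "arr [c, e] [e, c] K" by (fact K' K)+
  show "K (K' x) = x" if "x \<in> T [e, c]" using that by (rule K_K')
  show "K' (K x) = x" if "x \<in> T [c, e]" using that by (rule K'_K)
  show "K' (onf 0 2 mul x) = onf 1 2 mul (onf 0 2 K' (onf 1 2 K' x))" if x: "x \<in> T [e, e, c]"
  proof -
    let ?y = "onf 1 2 K' x" and ?z = "onf 0 2 K' (onf 1 2 K' x)"
    have y: "?y \<in> T [e, c, e]" by (rule onf_mem[OF x K', of "[e]" "[]"]) simp_all
    have z: "?z \<in> T [c, e, e]" by (rule onf_mem[OF y K', of "[]" "[e]"]) simp_all
    have "onf 0 2 K ?z = ?y" by (rule K_inverse(2)[OF y, of _ "[]" "[e]"]) simp_all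
    moreover have "onf 1 2 K ?y = x" by (rule K_inverse(2)[OF x, of _ "[e]" "[]"]) simp_all
    ultimately have "K (onf 1 2 mul ?z) = onf 0 2 mul x" using mul_e[OF z] by simp
    moreover have "onf 1 2 mul ?z \<in> T [c, e]"
      by (rule onf_mem[OF z arr_mul, of "[c]" e "[]"]) simp_all
    ultimately show ?thesis using K'_K by metis
  qed
  show "K' (onf 1 2 mul x) = onf 0 2 mul (onf 1 2 K' (onf 0 2 K' x))" if x: "x \<in> T [e, c, c]"
  proof -
    let ?y = "onf 0 2 K' x" and ?z = "onf 1 2 K' (onf 0 2 K' x)"
    have y: "?y \<in> T [c, e, c]" by (rule onf_mem[OF x K', of "[]" "[c]"]) simp_all
    have z: "?z \<in> T [c, c, e]" by (rule onf_mem[OF y K', of "[c]" "[]"]) simp_all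
    have "onf 1 2 K ?z = ?y" by (rule K_inverse(2)[OF y, of _ "[c]" "[]"]) simp_all
    moreover have "onf 0 2 K ?y = x" by (rule K_inverse(2)[OF x, of _ "[]" "[c]"]) simp_all
    ultimately have "K (onf 0 2 mul ?z) = onf 1 2 mul x" using mul_c[OF z] by simp
    moreover have "onf 0 2 mul ?z \<in> T [c, e]"
      by (rule onf_mem[OF z arr_mul, of "[]" c "[e]"]) simp_all
    ultimately show ?thesis using K'_K by metis
  qed
  show "K' (onf 0 0 (unit e) x) = onf 1 0 (unit e) x" if x: "x \<in> T [c]"
  proof -
    have "onf 1 0 (unit e) x \<in> T [c, e]" by (rule onf_mem[OF x arr_unit, of "[c]" "[]"]) simp_all
    then show ?thesis using unit_e[OF x] K'_K by metis
  qed
  show "K' (onf 1 0 (unit c) x) = onf 0 0 (unit c) x" if x: "x \<in> T [e]"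
  proof -
    have "onf 0 0 (unit c) x \<in> T [c, e]" by (rule onf_mem[OF x arr_unit, of "[]" "[e]"]) simp_all
    then show ?thesis using unit_c[OF x] K'_K by metis
  qed
qed

text \<open>
Conjugation by the flip of the block of factors \<open>e\<close> turns the cyclic operator of the barred kind
(flip, then sweep) into the one of the unbarred kind (sweep, then flip).
\<close>

lemma flip_sweep_at_flip:
  assumes x: "x \<in> T (replicate n e @ replicate (q + 1) c)"
  shows "flip n (sweep_at K 0 n (flip (n + q) x)) = flip (q + n) (sweep_at K q n (flip n x))"
proof -
  have x': "x \<in> T (replicate n e @ replicate q c @ [c])"
    using x by (simp add: replicate_append_same)
  let ?y = "flip (n + q) x"
  have y: "?y \<in> T (c # replicate n e @ replicate q c)"
    by (rule arr_mem[OF arr_flip[of _ "replicate n e @ replicate q c" _ "[c]"] x']) simp_all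
  have z: "sweep_at K 0 n ?y \<in> T (replicate n e @ [c] @ replicate q c)"
    by (rule sweep_at_mem[OF y K, of "[]" n "replicate q c"]) simp_all
  have "flip n (sweep_at K 0 n ?y) = flip (q + n) (flip (n + 1) (sweep_at K 0 n ?y))"
    by (rule flip_flip_wrap[OF z refl, symmetric]) simp_all
  also have "flip (n + 1) (sweep_at K 0 n ?y) = sweep_at K q n (flip (n + 1) ?y)"
    by (rule flip_sweep_at[OF K y, of "[]" n "[]" "replicate q c"]) simp_all
  also have "flip (n + 1) ?y = flip n x"
    by (rule flip_flip_wrap[OF x' refl]) simp_all
  finally show ?thesis .
qed

lemma paracyclic_right:
  fixes n :: nat
  defines "C \<equiv> \<lambda>q. T (replicate n e @ replicate (q + 1) c)"
  assumes d: "\<And>q j x. j < q \<Longrightarrow> x \<in> C q \<Longrightarrow> d q j x = onf (n + j) 2 mul x"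
    and d_last: "\<And>q x. 1 \<le> q \<Longrightarrow> x \<in> C q \<Longrightarrow> d q q x = d q 0 (t q x)"
    and s: "\<And>q j x. j \<le> q \<Longrightarrow> x \<in> C q \<Longrightarrow> s q j x = onf (n + (j + 1)) 0 (unit c) x"
    and t: "\<And>q x. x \<in> C q \<Longrightarrow> t q x = sweep_at K 0 n (flip (n + q) x)"
  shows "paracyclic_module tensor_scale C d s t"
proof (rule paracyclic_module_transport)
  define t0 where "t0 q x = flip (q + n) (sweep_at K q n x)" for q x
  define d0 where "d0 q j x = (if j < q then onf j 2 mul x else onf 0 2 mul (t0 q x))" for q j :: nat and x
  define s0 where "s0 q j x = onf (j + 1) 0 (unit c) x" for q j :: nat and x
  \<comment> \<open>The module is compared with that of \<open>paracyclic_left\<close>, whose operators are given by formulas.\<close>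
  show "paracyclic_module tensor_scale (\<lambda>q. T (replicate (q + 1) c @ replicate n e)) d0 s0 t0"
    by (rule paracyclic_left) (simp_all add: d0_def s0_def t0_def)
  have W2: "\<exists>r. replicate (q + 1) c = replicate j c @ [c, c] @ replicate r c \<and>
      replicate (q - 1 + 1) c = replicate j c @ [c] @ replicate r c" if "j < q" for q j
  proof -
    from that obtain r where q: "q = j + 1 + r" using le_Suc_ex[of "j + 1" q] by auto
    show ?thesis by (rule exI[of _ r]) (simp add: q replicate_add replicate_app_Cons_same)
  qed
  have W1: "\<exists>r. replicate (q + 1) c = replicate (j + 1) c @ replicate r c \<and>
      replicate (q + 1 + 1) c = replicate (j + 1) c @ [c] @ replicate r c" if "j \<le> q" for q j
  proof -
    from that obtain r where q: "q = j + r" using le_Suc_ex by blast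
    show ?thesis by (rule exI[of _ r]) (simp add: q replicate_add replicate_app_Cons_same)
  qed
  have arr_M: "linear_on tensor_scale tensor_scale (C q) (C (q - 1)) (onf (n + j) 2 mul)"
    and flip_M: "\<And>x. x \<in> C q \<Longrightarrow> flip n (onf (n + j) 2 mul x) = onf j 2 mul (flip n x)"
    if j: "j < q" for q j
  proof -
    obtain r where r: "replicate (q + 1) c = replicate j c @ [c, c] @ replicate r c"
      "replicate (q - 1 + 1) c = replicate j c @ [c] @ replicate r c" using W2[OF j] by blast
    show "linear_on tensor_scale tensor_scale (C q) (C (q - 1)) (onf (n + j) 2 mul)"
      unfolding C_def r
      by (rule arr_onf[OF arr_mul, of _ "replicate n e @ replicate j c" _ _ _ "replicate r c"]) simp_all
    show "flip n (onf (n + j) 2 mul x) = onf j 2 mul (flip n x)" if "x \<in> C q" for x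
      by (rule flip_onf_right[OF arr_mul that[unfolded C_def r] refl]) simp_all
  qed
  have arr_U: "linear_on tensor_scale tensor_scale (C q) (C (q + 1)) (onf (n + (j + 1)) 0 (unit c))"
    and flip_U: "\<And>x. x \<in> C q \<Longrightarrow> flip n (onf (n + (j + 1)) 0 (unit c) x) = onf (j + 1) 0 (unit c) (flip n x)"
    if j: "j \<le> q" for q j
  proof -
    obtain r where r: "replicate (q + 1) c = replicate (j + 1) c @ replicate r c"
      "replicate (q + 1 + 1) c = replicate (j + 1) c @ [c] @ replicate r c" using W1[OF j] by blast
    show "linear_on tensor_scale tensor_scale (C q) (C (q + 1)) (onf (n + (j + 1)) 0 (unit c))"
      unfolding C_def r
      by (rule arr_onf[OF arr_unit, of _ "replicate n e @ replicate (j + 1) c" _ _ "replicate r c"]) simp_all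
    show "flip n (onf (n + (j + 1)) 0 (unit c) x) = onf (j + 1) 0 (unit c) (flip n x)" if "x \<in> C q" for x
      by (rule flip_onf_right[OF arr_unit that[unfolded C_def r], of "replicate n e" "replicate (j + 1) c" "replicate r c"])
        simp_all
  qed
  show "module.subspace tensor_scale (C q)" for q
    unfolding C_def tensor_space_def by (rule tensor.subspace_span)
  have arr_t: "linear_on tensor_scale tensor_scale (C q) (C q) (t q)" for q
  proof -
    have "arr (replicate n e @ replicate (q + 1) c) (c # replicate n e @ replicate q c) (flip (n + q))"
      by (rule arr_flip[of _ "replicate n e @ replicate q c" _ "[c]"]) (simp_all add: replicate_append_same)
    moreover have "arr (c # replicate n e @ replicate q c) (replicate n e @ replicate (q + 1) c) (sweep_at K 0 n)"
      by (rule arr_sweep_at[OF K, of _ "[]" _ _ "replicate q c"]) simp_all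
    ultimately have "linear_on tensor_scale tensor_scale (C q) (C q) (\<lambda>x. sweep_at K 0 n (flip (n + q) x))"
      unfolding C_def by (rule arr_comp)
    from arr_cong[OF this[unfolded C_def], of "t q"] t show ?thesis unfolding C_def by blast
  qed
  then show "linear_on tensor_scale tensor_scale (C q) (C q) (t q)" for q .
  have t_mem: "t q x \<in> C q" if "x \<in> C q" for q x
    using arr_t that by (simp add: linear_on_def)
  have d_lin: "linear_on tensor_scale tensor_scale (C q) (C (q - 1)) (d q j)" if "j < q" for q j
    using arr_cong[OF arr_M[OF that, unfolded C_def], of "d q j"] d[OF that] unfolding C_def by blast
  show "linear_on tensor_scale tensor_scale (C q) (C (q - 1)) (d q j)" if "1 \<le> q" "j \<le> q" for q j
  proof (cases "j = q")
    case True
    have "linear_on tensor_scale tensor_scale (C q) (C (q - 1)) (\<lambda>x. d q 0 (t q x))"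
      using arr_t[of q] d_lin[of 0 q] that by (simp add: linear_on_def)
    from arr_cong[OF this[unfolded C_def], of "d q q"] d_last[OF that(1), unfolded C_def]
    show ?thesis unfolding C_def True by blast
  qed (use d_lin that in simp)
  show "linear_on tensor_scale tensor_scale (C q) (C (q + 1)) (s q j)" if "j \<le> q" for q j
    using arr_cong[OF arr_U[OF that, unfolded C_def], of "s q j"] s[OF that] unfolding C_def by blast
  show "bij_betw (flip n) (C q) (T (replicate (q + 1) c @ replicate n e))" for q
    unfolding C_def by (rule bij_flip[OF _ refl refl]) simp
  fix q j :: nat and x
  show t_flip: "flip n (t q x) = t0 q (flip n x)" if "x \<in> C q" for q x
    using that flip_sweep_at_flip[of x n q] by (simp add: t t0_def C_def)
  show "flip n (s q j x) = s0 q j (flip n x)" if "j \<le> q" "x \<in> C q"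
    unfolding s0_def s[OF that] by (rule flip_U[OF that])
  show "flip n (d q j x) = d0 q j (flip n x)" if "1 \<le> q" "j \<le> q" "x \<in> C q"
  proof (cases "j = q")
    case True
    have "flip n (d q q x) = onf 0 2 mul (flip n (t q x))"
      using that flip_M[of 0 q "t q x"] t_mem[of x q] d[of 0 q "t q x"] d_last[of q x] by simp
    then show ?thesis using that True t_flip by (simp add: d0_def)
  qed (use that flip_M[of j q x] d[of j q x] in \<open>simp add: d0_def\<close>)
qed

section \<open>The cylindrical module of a crossing\<close>

text \<open>
After \<open>k\<close> steps the last \<open>k\<close> factors \<open>c\<close> have crossed the block and stand in front, while \<open>r\<close> factors
are left.
\<close>

lemma t_power:
  assumes t: "\<And>x. x \<in> T (replicate (p + 1) c @ replicate n e) \<Longrightarrow> t x = flip (p + n) (sweep_at K p n x)"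
    and x: "x \<in> T (replicate (p + 1) c @ replicate n e)"
  shows "k + r = p + 1 \<Longrightarrow> (t ^^ k) x = flip (r + n) (cross K r k n x)"
proof (induction k arbitrary: r)
  case 0
  with flip_full[OF x, of "r + n"] show ?case by simp
next
  case (Suc k)
  have p: "p = r + k" using Suc.prems by simp
  have comm: "replicate k c @ replicate r c = replicate r c @ replicate k c"
    by (metis add.commute replicate_add)
  let ?y = "cross K (Suc r) k n x"
  have y: "?y \<in> T (replicate r c @ c # replicate n e @ replicate k c)"
    by (rule cross_mem[OF x K, of "replicate (Suc r) c" k n "[]"])
      (simp_all add: p comm replicate_add replicate_app_Cons_same)
  have z: "sweep_at K r n ?y \<in> T ((replicate r c @ replicate n e) @ [c] @ replicate k c)"
    by (rule sweep_at_mem[OF y K, of "replicate r c" n "replicate k c"]) simp_all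
  have fy: "flip (Suc r + n) ?y \<in> T (replicate (p + 1) c @ replicate n e)"
    by (rule arr_mem[OF arr_flip[of _ "replicate r c @ c # replicate n e" _ "replicate k c"] y])
      (simp_all add: p comm replicate_add replicate_app_Cons_same)
  have "(t ^^ Suc k) x = t (flip (Suc r + n) ?y)"
    using Suc.IH[of "Suc r"] Suc.prems by simp
  also have "\<dots> = flip (p + n) (sweep_at K p n (flip (Suc r + n) ?y))"
    by (rule t[OF fy])
  also have "sweep_at K p n (flip (Suc r + n) ?y) = flip (Suc r + n) (sweep_at K r n ?y)"
    by (rule flip_sweep_at[OF K y, of "replicate r c" n "[]" "replicate k c", symmetric]) (simp_all add: p)
  also have "flip (p + n) \<dots> = flip (r + n) (sweep_at K r n ?y)"
    by (rule flip_flip_wrap[OF z refl]) (simp_all add: p)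
  finally show ?case by simp
qed

lemma t_power_right:
  assumes t: "\<And>x. x \<in> T (replicate n e @ replicate (q + 1) c) \<Longrightarrow> t x = sweep_at K 0 n (flip (n + q) x)"
    and x: "x \<in> T (replicate n e @ replicate (q + 1) c)"
  shows "(t ^^ (q + 1)) x = cross K 0 (q + 1) n (flip n x)"
proof -
  let ?W = "replicate n e @ replicate (q + 1) c"
  let ?t0 = "\<lambda>x. flip (q + n) (sweep_at K q n x)"
  have t_mem: "t x \<in> T ?W" if x: "x \<in> T ?W" for x
  proof -
    have "flip (n + q) x \<in> T (c # replicate n e @ replicate q c)"
      by (rule arr_mem[OF arr_flip[of _ "replicate n e @ replicate q c" _ "[c]"] x])
        (simp_all add: replicate_append_same)
    then have "sweep_at K 0 n (flip (n + q) x) \<in> T ?W"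
      by (rule sweep_at_mem[OF _ K, of _ _ "[]" n "replicate q c"]) simp_all
    then show ?thesis by (simp only: t[OF x])
  qed
  have pow: "(t ^^ k) x \<in> T ?W \<and> flip n ((t ^^ k) x) = (?t0 ^^ k) (flip n x)" for k
  proof (induction k)
    case (Suc k)
    then show ?case
      using t_mem[of "(t ^^ k) x"] t[of "(t ^^ k) x"] flip_sweep_at_flip[of "(t ^^ k) x" n q] by simp
  qed (use x in simp)
  have fx: "flip n x \<in> T (replicate (q + 1) c @ replicate n e)"
    by (rule arr_mem[OF arr_flip[OF _ refl refl] x]) simp
  have y: "cross K 0 (q + 1) n (flip n x) \<in> T ?W"
    by (rule cross_mem[OF fx K, of "[]" "q + 1" n "[]"]) simp_all
  have "flip n ((t ^^ (q + 1)) x) = flip n (cross K 0 (q + 1) n (flip n x))"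
    using pow[of "q + 1"] t_power[of q n ?t0 "flip n x" "q + 1" 0] fx by simp
  moreover have "flip (q + 1) (flip n z) = z" if "z \<in> T ?W" for z
    by (rule flip_inverse[OF that refl]) simp_all
  ultimately show ?thesis using pow y by metis
qed

text \<open>
With \<open>b\<close> the last factor \<open>c\<close> and \<open>a\<close> the last factor \<open>e\<close>, on the left \<open>a\<close> crosses all factors \<open>c\<close>, \<open>b\<close>
last, and then \<open>b\<close> crosses \<open>a\<close> back first; on the right the order is reversed. After these
cancellations both sides carry \<open>a\<close> past the other factors \<open>c\<close> and \<open>b\<close> past the other factors \<open>e\<close>.
\<close>

lemma t_commute:
  assumes x: "x \<in> T (replicate (p + 1) c @ replicate (q + 1) e)" and N: "N = p + q + 1"
  shows "flip N (sweep_at K p (q + 1) (sweep_at K' 0 (p + 1) (flip N x))) =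
    sweep_at K' 0 (p + 1) (flip N (flip N (sweep_at K p (q + 1) x)))"
proof -
  let ?y = "flip N x" and ?w = "sweep_at K p q x"
  have x': "x \<in> T (replicate p c @ c # replicate q e @ [e])"
    using x by (simp add: replicate_app_Cons_same replicate_append_same)
  have y: "?y \<in> T (e # replicate p c @ c # replicate q e)"
    by (rule arr_mem[OF arr_flip[of _ "replicate p c @ c # replicate q e" _ "[e]"] x']) (simp_all add: N)
  have w: "?w \<in> T ((replicate p c @ replicate q e) @ [c, e])"
    by (rule sweep_at_mem[OF x' K, of "replicate p c" q "[e]"]) simp_all
  have y': "sweep_at K' 0 p ?y \<in> T (replicate p c @ [e, c] @ replicate q e)"
    by (rule sweep_at_mem[OF y K', of "[]" p "c # replicate q e"]) simp_all
  have w': "flip N ?w \<in> T (e # replicate p c @ replicate q e @ [c])"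
    by (rule arr_mem[OF arr_flip[of _ "replicate p c @ replicate q e @ [c]" _ "[e]"] w]) (simp_all add: N)
  have Kw: "onf (p + q) 2 K ?w \<in> T ((replicate p c @ replicate q e) @ [e] @ [c])"
    by (rule onf_mem[OF w K, of "replicate p c @ replicate q e" "[]"]) simp_all
  have fw: "flip (p + q) ?w \<in> T ([c, e] @ replicate p c @ replicate q e)"
    by (rule arr_mem[OF arr_flip[OF _ refl refl] w]) simp
  have ff: "flip N (flip N z) = flip (p + q) z"
    if "z \<in> T ((replicate p c @ replicate q e) @ [a] @ [b])" for z a b
    by (rule flip_flip_wrap[OF that refl]) (simp_all add: N)
  \<comment> \<open>The crossing of the last factors is undone: \<open>K\<close> follows \<open>K'\<close> on the same slot.\<close>
  have "flip N (sweep_at K p (q + 1) (sweep_at K' 0 (p + 1) ?y)) =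
      flip N (sweep_at K (Suc p) q (onf p 2 K (onf p 2 K' (sweep_at K' 0 p ?y))))"
    using sweep_at_Suc[of K p q] by simp
  also have "onf p 2 K (onf p 2 K' (sweep_at K' 0 p ?y)) = sweep_at K' 0 p ?y"
    by (rule K_inverse(2)[OF y' _ refl]) simp
  also have "sweep_at K (Suc p) q (sweep_at K' 0 p ?y) = sweep_at K' 0 p (sweep_at K (Suc p) q ?y)"
    by (rule sweep_at_sweep_at[OF K' K y, of "[]" p "[]" q "[]"]) simp_all
  also have "sweep_at K (Suc p) q ?y = flip N ?w"
    by (rule flip_sweep_at[OF K x', of "replicate p c" q "[]" "[e]", symmetric]) (simp_all add: N)
  also have "flip N (sweep_at K' 0 p (flip N ?w)) = sweep_at K' 1 p (flip N (flip N ?w))"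
    by (rule flip_sweep_at[OF K' w', of "[]" p "replicate q e" "[c]"]) (simp_all add: N)
  \<comment> \<open>The flips bring the two last factors to the front, where \<open>K'\<close> after \<open>K\<close> is inserted.\<close>
  also have "flip N (flip N ?w) = onf 0 2 K' (onf 0 2 K (flip (p + q) ?w))"
  proof -
    have "onf 0 2 K' (onf 0 2 K (flip (p + q) ?w)) = flip (p + q) ?w"
      by (rule K_inverse(1)[OF fw, of _ "[]" "replicate p c @ replicate q e"]) simp_all
    moreover have "flip N (flip N ?w) = flip (p + q) ?w"
      by (rule ff[of _ c e]) (use w in simp)
    ultimately show ?thesis by simp
  qed
  also have "onf 0 2 K (flip (p + q) ?w) = flip (p + q) (onf (p + q) 2 K ?w)"
    by (rule flip_onf_right[OF K w, of "replicate p c @ replicate q e" "[]" "[]", symmetric]) simp_all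
  also have "\<dots> = flip N (flip N (sweep_at K p (q + 1) x))"
    by (simp add: ff[OF Kw])
  also have "sweep_at K' 1 p (onf 0 2 K' (flip N (flip N (sweep_at K p (q + 1) x)))) =
      sweep_at K' 0 (p + 1) (flip N (flip N (sweep_at K p (q + 1) x)))"
    using sweep_at_Suc[of K' 0 p] by simp
  finally show ?thesis .
qed

text \<open>
The faces with \<open>i < p\<close> and \<open>j < q\<close> and the degeneracies act on disjoint slots, and they commute
with the other cyclic operator since a sweep is natural inside the block that it crosses. The
lemmas for the barred operators come from the dual crossing.
\<close>

theorem cylindrical:
  defines "C \<equiv> \<lambda>p q. T (replicate (p + 1) c @ replicate (q + 1) e)"
  assumes d: "\<And>p q i x. i < p \<Longrightarrow> x \<in> C p q \<Longrightarrow> d p q i x = onf i 2 mul x"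
    and d_last: "\<And>p q x. 1 \<le> p \<Longrightarrow> x \<in> C p q \<Longrightarrow> d p q p x = d p q 0 (t p q x)"
    and s: "\<And>p q i x. i \<le> p \<Longrightarrow> x \<in> C p q \<Longrightarrow> s p q i x = onf (i + 1) 0 (unit c) x"
    and t: "\<And>p q x. x \<in> C p q \<Longrightarrow> t p q x = flip (p + q + 1) (sweep_at K p (q + 1) x)"
    and d': "\<And>p q j x. j < q \<Longrightarrow> x \<in> C p q \<Longrightarrow> d' p q j x = onf (p + 1 + j) 2 mul x"
    and d'_last: "\<And>p q x. 1 \<le> q \<Longrightarrow> x \<in> C p q \<Longrightarrow> d' p q q x = d' p q 0 (t' p q x)"
    and s': "\<And>p q j x. j \<le> q \<Longrightarrow> x \<in> C p q \<Longrightarrow> s' p q j x = onf (p + 1 + j + 1) 0 (unit e) x"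
    and t': "\<And>p q x. x \<in> C p q \<Longrightarrow> t' p q x = sweep_at K' 0 (p + 1) (flip (p + q + 1) x)"
  shows "cylindrical_module tensor_scale C d s t d' s' t'"
proof -
  interpret D: crossing sA sB e c K' K by (rule dual)
  have left: "paracyclic_module tensor_scale (\<lambda>p. C p q) (\<lambda>p. d p q) (\<lambda>p. s p q) (\<lambda>p. t p q)" for q
    unfolding C_def
    by (rule paracyclic_left)
      (simp_all add: d[unfolded C_def] d_last[unfolded C_def] s[unfolded C_def] t[unfolded C_def]
        del: replicate.simps)
  have right: "paracyclic_module tensor_scale (C p) (d' p) (s' p) (t' p)" for p
    unfolding C_def
    by (rule D.paracyclic_right)
      (simp_all add: d'[unfolded C_def] d'_last[unfolded C_def] s'[unfolded C_def] t'[unfolded C_def]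
        del: replicate.simps)
  interpret L: paracyclic_module tensor_scale "\<lambda>p. C p q" "\<lambda>p. d p q" "\<lambda>p. s p q" "\<lambda>p. t p q" for q
    by (rule left)
  interpret P: paracyclic_module tensor_scale "C p" "d' p" "s' p" "t' p" for p
    by (rule right)
  have t_mem: "t p q x \<in> C p q" and t'_mem: "t' p q x \<in> C p q" if "x \<in> C p q" for p q x
    using L.linear_t P.linear_t that by (simp_all add: linear_on_def)
  have s_mem: "s p q i x \<in> C (p + 1) q" if "i \<le> p" "x \<in> C p q" for p q i x
    using L.linear_s[OF that(1)] that(2) by (simp add: linear_on_def)
  have s'_mem: "s' p q j x \<in> C p (q + 1)" if "j \<le> q" "x \<in> C p q" for p q j x
    using P.linear_s[OF that(1)] that(2) by (simp add: linear_on_def)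
  have d_mem: "d p q i x \<in> C (p - 1) q" if "1 \<le> p" "i \<le> p" "x \<in> C p q" for p q i x
    using L.linear_d[OF that(1,2)] that(3) by (simp add: linear_on_def)
  have d'_mem: "d' p q j x \<in> C p (q - 1)" if "1 \<le> q" "j \<le> q" "x \<in> C p q" for p q j x
    using P.linear_d[OF that(1,2)] that(3) by (simp add: linear_on_def)
  note rep = replicate_add replicate_app_Cons_same
  have bi: "bi_paracyclic_module tensor_scale C d s t d' s' t'"
  proof (rule bi_paracyclic_moduleI[OF left right])
    fix p q i j :: nat and x
    show "d p (q - 1) i (d' p q j x) = d' (p - 1) q j (d p q i x)" if i: "i < p" and j: "j < q" and x: "x \<in> C p q"
    proof -
      define a b where "a = p - (i + 1)" and "b = q - (j + 1)"
      have p: "p = i + 1 + a" and q: "q = j + 1 + b" using i j by (simp_all add: a_def b_def)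
      have "onf i 2 mul (onf (p + 1 + j) 2 mul x) = onf (p - 1 + 1 + j) 2 mul (onf i 2 mul x)"
        by (rule onf_interchange[OF arr_mul arr_mul x[unfolded C_def], symmetric,
              of "replicate i c" c "replicate a c @ replicate j e" e "replicate b e"])
          (simp_all add: p q rep)
      then show ?thesis
        using d[of i p x q] d[of i p "onf (p + 1 + j) 2 mul x" "q - 1"] d'[of j q x p]
          d'[of j q "onf i 2 mul x" "p - 1"] d_mem[of p i x q] d'_mem[of q j x p] i j x by simp
    qed
    show "d p (q + 1) i (s' p q j x) = s' (p - 1) q j (d p q i x)" if i: "i < p" and j: "j \<le> q" and x: "x \<in> C p q"
    proof -
      define a b where "a = p - (i + 1)" and "b = q - j"
      have p: "p = i + 1 + a" and q: "q = j + b" using i j by (simp_all add: a_def b_def)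
      have "onf i 2 mul (onf (p + 1 + j + 1) 0 (unit e) x) = onf (p - 1 + 1 + j + 1) 0 (unit e) (onf i 2 mul x)"
        by (rule onf_interchange[OF arr_mul arr_unit x[unfolded C_def], symmetric,
              of "replicate i c" c "replicate a c @ replicate (j + 1) e" "replicate b e"])
          (simp_all add: p q rep)
      then show ?thesis
        using d[of i p x q] d[of i p "onf (p + 1 + j + 1) 0 (unit e) x" "q + 1"] s'[of j q x p]
          s'[of j q "onf i 2 mul x" "p - 1"] d_mem[of p i x q] s'_mem[of j q x p] i j x by simp
    qed
    show "s p (q - 1) i (d' p q j x) = d' (p + 1) q j (s p q i x)" if i: "i \<le> p" and j: "j < q" and x: "x \<in> C p q"
    proof -
      define a b where "a = p - i" and "b = q - (j + 1)"
      have p: "p = i + a" and q: "q = j + 1 + b" using i j by (simp_all add: a_def b_def)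
      have "onf (i + 1) 0 (unit c) (onf (p + 1 + j) 2 mul x) = onf (p + 1 + 1 + j) 2 mul (onf (i + 1) 0 (unit c) x)"
        by (rule onf_interchange[OF arr_unit arr_mul x[unfolded C_def], symmetric,
              of "replicate (i + 1) c" "replicate a c @ replicate j e" e "replicate b e"])
          (simp_all add: p q rep)
      then show ?thesis
        using s[of i p x q] s[of i p "onf (p + 1 + j) 2 mul x" "q - 1"] d'[of j q x p]
          d'[of j q "onf (i + 1) 0 (unit c) x" "p + 1"] s_mem[of i p x q] d'_mem[of q j x p] i j x by simp
    qed
    show "s p (q + 1) i (s' p q j x) = s' (p + 1) q j (s p q i x)" if i: "i \<le> p" and j: "j \<le> q" and x: "x \<in> C p q"
    proof -
      define a b where "a = p - i" and "b = q - j"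
      have p: "p = i + a" and q: "q = j + b" using i j by (simp_all add: a_def b_def)
      have "onf (i + 1) 0 (unit c) (onf (p + 1 + j + 1) 0 (unit e) x) =
          onf (p + 1 + 1 + j + 1) 0 (unit e) (onf (i + 1) 0 (unit c) x)"
        by (rule onf_interchange[OF arr_unit arr_unit x[unfolded C_def], symmetric,
              of "replicate (i + 1) c" "replicate a c @ replicate (j + 1) e" "replicate b e"])
          (simp_all add: p q rep)
      then show ?thesis
        using s[of i p x q] s[of i p "onf (p + 1 + j + 1) 0 (unit e) x" "q + 1"] s'[of j q x p]
          s'[of j q "onf (i + 1) 0 (unit c) x" "p + 1"] s_mem[of i p x q] s'_mem[of j q x p] i j x by simp
    qed
    have S: "sweep_at K p (q + 1) x \<in> T (replicate p c @ replicate (q + 1) e @ [c])" if "x \<in> C p q" for p q x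
      by (rule sweep_at_mem[OF that[unfolded C_def] K, of "replicate p c" "q + 1" "[]"])
        (simp_all add: replicate_app_Cons_same)
    have F: "flip (p + q + 1) x \<in> T (e # replicate (p + 1) c @ replicate q e)" if "x \<in> C p q" for p q x
      by (rule arr_mem[OF arr_flip[of _ "replicate (p + 1) c @ replicate q e" _ "[e]"] that[unfolded C_def]])
        (simp_all add: replicate_append_same)
    show "t p (q - 1) (d' p q j x) = d' p q j (t p q x)" if j: "j < q" and x: "x \<in> C p q"
    proof -
      define b where "b = q - (j + 1)"
      have q: "q = j + 1 + b" using j by (simp add: b_def)
      have "t p (q - 1) (d' p q j x) = flip (p + q) (sweep_at K p (Suc (j + b)) (onf (p + 1 + j) 2 mul x))"
        using t[of "d' p q j x" p "q - 1"] d'[OF j x] d'_mem[of q j x p] j x by (simp add: q)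
      also have "sweep_at K p (Suc (j + b)) (onf (p + 1 + j) 2 mul x) = onf (p + j) 2 mul (sweep_at K p (Suc (Suc (j + b))) x)"
        by (rule sweep_at_mul_e[OF x[unfolded C_def], of "replicate p c" _ "[]"])
          (simp_all add: q replicate_app_Cons_same)
      also have "Suc (Suc (j + b)) = q + 1" by (simp add: q)
      also have "flip (p + q) (onf (p + j) 2 mul (sweep_at K p (q + 1) x)) =
          onf (p + 1 + j) 2 mul (flip (p + q + 1) (sweep_at K p (q + 1) x))"
        by (rule flip_onf_left[OF arr_mul S[OF x], of "replicate p c @ replicate j e" e "replicate b e" "[c]"])
          (simp_all add: q rep)
      also have "\<dots> = d' p q j (t p q x)"
        using d'[of j q "t p q x" p] t[OF x] t_mem[OF x] j by simp
      finally show ?thesis .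
    qed
    show "t p (q + 1) (s' p q j x) = s' p q j (t p q x)" if j: "j \<le> q" and x: "x \<in> C p q"
    proof -
      define b where "b = q - j"
      have q: "q = j + b" using j by (simp add: b_def)
      have "t p (q + 1) (s' p q j x) = flip (p + q + 2) (sweep_at K p (Suc (q + 1)) (onf (p + 1 + j + 1) 0 (unit e) x))"
        using t[of "s' p q j x" p "q + 1"] s'[OF j x] s'_mem[OF j x] by simp
      also have "sweep_at K p (Suc (q + 1)) (onf (p + 1 + j + 1) 0 (unit e) x) = onf (p + j + 1) 0 (unit e) (sweep_at K p (q + 1) x)"
        by (rule sweep_at_unit_e[OF x[unfolded C_def], of "replicate p c" _ "[]" _ "j + 1"])
          (simp_all add: q replicate_app_Cons_same)
      also have "flip (p + q + 2) \<dots> = onf (p + 1 + j + 1) 0 (unit e) (flip (p + q + 1) (sweep_at K p (q + 1) x))"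
        by (rule flip_onf_left[OF arr_unit S[OF x], of "replicate p c @ replicate (j + 1) e" "replicate b e" "[c]"])
          (simp_all add: q rep)
      also have "\<dots> = s' p q j (t p q x)"
        using s'[of j q "t p q x" p] t[OF x] t_mem[OF x] j by simp
      finally show ?thesis .
    qed
    show "d p q i (t' p q x) = t' (p - 1) q (d p q i x)" if i: "i < p" and x: "x \<in> C p q"
    proof -
      define a where "a = p - (i + 1)"
      have p: "p = i + 1 + a" using i by (simp add: a_def)
      have "t' (p - 1) q (d p q i x) = sweep_at K' 0 (Suc (i + a)) (flip (p + q) (onf i 2 mul x))"
        using t'[of "d p q i x" "p - 1" q] d[OF i x] d_mem[of p i x q] i x by (simp add: p)
      also have "flip (p + q) (onf i 2 mul x) = onf (i + 1) 2 mul (flip (p + q + 1) x)"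
        by (rule flip_onf_left[OF arr_mul x[unfolded C_def], of "replicate i c" c "replicate a c @ replicate q e" "[e]"])
          (simp_all add: p rep replicate_append_same)
      also have "sweep_at K' 0 (Suc (i + a)) \<dots> = onf i 2 mul (sweep_at K' 0 (Suc (Suc (i + a))) (flip (p + q + 1) x))"
        by (rule D.sweep_at_mul_e[OF F[OF x], of "[]" _ "replicate q e"]) (simp_all add: p)
      also have "\<dots> = d p q i (t' p q x)"
        using d[of i p "t' p q x" q] t'[OF x] t'_mem[OF x] i by (simp add: p)
      finally show ?thesis by simp
    qed
    show "s p q i (t' p q x) = t' (p + 1) q (s p q i x)" if i: "i \<le> p" and x: "x \<in> C p q"
    proof -
      define a where "a = p - i"
      have p: "p = i + a" using i by (simp add: a_def)
      have "t' (p + 1) q (s p q i x) = sweep_at K' 0 (Suc (p + 1)) (flip (p + q + 2) (onf (i + 1) 0 (unit c) x))"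
        using t'[of "s p q i x" "p + 1" q] s[OF i x] s_mem[OF i x] by simp
      also have "flip (p + q + 2) (onf (i + 1) 0 (unit c) x) = onf (i + 2) 0 (unit c) (flip (p + q + 1) x)"
        by (rule flip_onf_left[OF arr_unit x[unfolded C_def], of "replicate (i + 1) c" "replicate a c @ replicate q e" "[e]"])
          (simp_all add: p rep replicate_append_same)
      also have "sweep_at K' 0 (Suc (p + 1)) \<dots> = onf (i + 1) 0 (unit c) (sweep_at K' 0 (p + 1) (flip (p + q + 1) x))"
        by (rule D.sweep_at_unit_e[OF F[OF x], of "[]" _ "replicate q e"]) (simp_all add: p)
      also have "\<dots> = s p q i (t' p q x)"
        using s[of i p "t' p q x" q] t'[OF x] t'_mem[OF x] i by simp
      finally show ?thesis by simp
    qed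
    show "t p q (t' p q x) = t' p q (t p q x)" if x: "x \<in> C p q"
      using t_commute[OF x[unfolded C_def] refl] t[OF t'_mem[OF x]] t'[OF t_mem[OF x]] t[OF x] t'[OF x]
      by simp
  qed
  have cyl: "(t p q ^^ (p + 1)) ((t' p q ^^ (q + 1)) x) = x" if x: "x \<in> C p q" for p q x
  proof -
    let ?f = "flip (p + 1) x"
    have f: "?f \<in> T (replicate (q + 1) e @ replicate (p + 1) c)"
      by (rule arr_mem[OF arr_flip[OF _ refl refl] x[unfolded C_def]]) simp
    have y: "cross K' 0 (q + 1) (p + 1) ?f \<in> T (replicate (p + 1) c @ replicate (q + 1) e)"
      by (rule cross_mem[OF f K', of "[]" "q + 1" "p + 1" "[]"]) simp_all
    have "(t' p q ^^ (q + 1)) x = cross K' 0 (q + 1) (p + 1) ?f"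
      by (rule D.t_power_right[OF _ x[unfolded C_def]]) (simp add: t'[unfolded C_def] del: replicate.simps)
    moreover have "(t p q ^^ (p + 1)) (cross K' 0 (q + 1) (p + 1) ?f) =
        flip (0 + (q + 1)) (cross K 0 (p + 1) (q + 1) (cross K' 0 (q + 1) (p + 1) ?f))"
      by (rule t_power[OF _ y]) (simp_all add: t[unfolded C_def] del: replicate.simps)
    moreover have "cross K 0 (p + 1) (q + 1) (cross K' 0 (q + 1) (p + 1) ?f) = ?f"
      by (rule cross_inverse[OF f, of "[]" _ _ "[]"]) simp_all
    moreover have "flip (q + 1) ?f = x"
      by (rule flip_inverse[OF x[unfolded C_def] refl]) simp_all
    ultimately show ?thesis by simp
  qed
  interpret bi_paracyclic_module tensor_scale C d s t d' s' t' by (rule bi)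
  show ?thesis by unfold_locales (rule cyl)
qed

end

section \<open>The crossing of a strong smash product\<close>

lemma (in tensor_calculus) sweep_eq_sweep_at: "sweep sA sB G n = sweep_at G 0 (Suc n)"
proof
  show "sweep sA sB G n x = sweep_at G 0 (Suc n) x" for x
    by (induction n) simp_all
qed

context strong_smash_product
begin

sublocale tensor_algebra sA sB ..

definition R' :: "('k, 'a, 'b) tensor \<Rightarrow> ('k, 'a, 'b) tensor" where
  "R' = inv_into (space_BA sA sB) R"

lemma R'_R: "x \<in> space_BA sA sB \<Longrightarrow> R' (R x) = x"
  and R_R': "y \<in> space_AB sA sB \<Longrightarrow> R (R' y) = y"
  and R'_mem: "y \<in> space_AB sA sB \<Longrightarrow> R' y \<in> space_BA sA sB"
  using bij_R unfolding R'_def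
  by (auto simp: bij_betw_def inv_into_f_f f_inv_into_f inv_into_into)

lemma arr_R': "arr [True, False] [False, True] R'"
  unfolding linear_on_def
proof (intro conjI ballI allI)
  fix x y k
  assume x: "x \<in> space_AB sA sB"
  show "R' x \<in> space_BA sA sB" by (rule R'_mem[OF x])
  have "R (tensor_scale k (R' x)) = tensor_scale k x"
    using linear_R x R'_mem[OF x] R_R'[OF x] by (simp add: linear_on_def)
  then show "R' (tensor_scale k x) = tensor_scale k (R' x)"
    using R'_R[of "tensor_scale k (R' x)"] R'_mem[OF x] by (simp add: tensor_space_scale)
  assume y: "y \<in> space_AB sA sB"
  have "R (R' x + R' y) = x + y"
    using linear_R R'_mem[OF x] R'_mem[OF y] R_R'[OF x] R_R'[OF y] by (simp add: linear_on_def)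
  then show "R' (x + y) = R' x + R' y"
    using R'_R[of "R' x + R' y"] R'_mem[OF x] R'_mem[OF y] by (simp add: tensor_space_add)
qed

text \<open>
The hexagons are quasitriangularity as it stands; the unit conditions extend normality from pure
tensors by linearity.
\<close>

lemma crossing_R: "crossing sA sB False True R R'"
proof
  fix x
  show arr_R: "arr [False, True] [True, False] R" by (rule linear_R)
  show "arr [True, False] [False, True] R'" by (rule arr_R')
  show "R' (R x) = x" if "x \<in> T [False, True]" using that by (rule R'_R)
  show "R (R' x) = x" if "x \<in> T [True, False]" using that by (rule R_R')
  show "R (onf 0 2 mul x) = onf 1 2 mul (onf 0 2 R (onf 1 2 R x))" if "x \<in> T [False, False, True]"
    using quasitriangular_R that by (simp add: quasitriangular_def)
  show "R (onf 1 2 mul x) = onf 0 2 mul (onf 1 2 R (onf 0 2 R x))" if "x \<in> T [False, True, True]"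
    using quasitriangular_R that by (simp add: quasitriangular_def)
  have unit_left: "onf 0 0 (unit b) (pt [l]) = pt [unit_letter b, l]" for b l
    using onf_pure[OF arr_unit, of "[]" 0 "[]" 0 b "[l]"] by (simp add: unit_pure insert_tensor_pure)
  have unit_right: "onf 1 0 (unit b) (pt [l]) = pt [l, unit_letter b]" for b l
    using onf_pure[OF arr_unit, of "[]" 1 "[l]" 0 b "[]"] by (simp add: unit_pure insert_tensor_pure)
  have arr_left: "arr [a] [b, a] (onf 0 0 (unit b))" for a b
    by (rule arr_onf[OF arr_unit, of _ "[]" _ _ "[a]"]) simp_all
  have arr_right: "arr [a] [a, b] (onf 1 0 (unit b))" for a b
    by (rule arr_onf[OF arr_unit, of _ "[a]" _ _ "[]"]) simp_all
  show "R (onf 0 0 (unit False) x) = onf 1 0 (unit False) x" if x: "x \<in> T [True]"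
    using arr_comp[OF arr_left arr_R] arr_right _ x
  proof (rule arr_ext)
    fix xs :: "('a + 'b) list" assume "map isl xs = [True]"
    then obtain a where xs: "xs = [Inl a]" by (auto simp: isl_def)
    then show "R (onf 0 0 (unit False) (pt xs)) = onf 1 0 (unit False) (pt xs)"
      using normal_R unfolding xs unit_left unit_right by (simp add: unit_letter_def normal_def)
  qed
  show "R (onf 1 0 (unit True) x) = onf 0 0 (unit True) x" if x: "x \<in> T [False]"
    using arr_comp[OF arr_right arr_R] arr_left _ x
  proof (rule arr_ext)
    fix xs :: "('a + 'b) list" assume "map isl xs = [False]"
    then obtain l where "xs = [l]" "\<not> isl l" by auto
    then obtain b where xs: "xs = [Inr b]" by (cases l) auto
    then show "R (onf 1 0 (unit True) (pt xs)) = onf 0 0 (unit True) (pt xs)"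
      using normal_R unfolding xs unit_left unit_right by (simp add: unit_letter_def normal_def)
  qed
qed

theorem cylindrical_smash_product:
  "cylindrical_module tensor_scale (cyl_space sA sB)
    (cyl_d sA sB R) (cyl_s sA sB) (cyl_t sA sB R)
    (cyl_d_bar sA sB R) (cyl_s_bar sA sB) (cyl_t_bar sA sB R)"
proof -
  interpret X: crossing sA sB False True R R' by (rule crossing_R)
  have space: "cyl_space sA sB = (\<lambda>p q. T (replicate (p + 1) False @ replicate (q + 1) True))"
    by (simp add: fun_eq_iff cyl_space_def)
  show ?thesis
    unfolding space
  proof (rule X.cylindrical)
    fix p q i j :: nat and x
    assume x: "x \<in> T (replicate (p + 1) False @ replicate (q + 1) True)"
    show "cyl_d sA sB R p q i x = onf i 2 mul x" if "i < p"
      using that by (simp add: cyl_d_def)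
    show "cyl_d sA sB R p q p x = cyl_d sA sB R p q 0 (cyl_t sA sB R p q x)" if "1 \<le> p"
      using that by (simp add: cyl_d_def)
    show "cyl_d_bar sA sB R p q j x = onf (p + 1 + j) 2 mul x" if "j < q"
      using that by (simp add: cyl_d_bar_def)
    show "cyl_d_bar sA sB R p q q x = cyl_d_bar sA sB R p q 0 (cyl_t_bar sA sB R p q x)" if "1 \<le> q"
      using that by (simp add: cyl_d_bar_def)
    show "cyl_s sA sB p q i x = onf (i + 1) 0 (unit False) x" if "i \<le> p"
    proof -
      from that obtain r where p: "p = i + r" using le_Suc_ex by blast
      have "cyl_s sA sB p q i x = insert_letter sA sB (i + 1) (unit_letter False) x"
        by (simp add: cyl_s_def unit_letter_def)
      also have "\<dots> = onf (i + 1) 0 (unit False) x"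
        by (rule insert_letter_onf[OF x, of "replicate (i + 1) False" "replicate r False @ replicate (q + 1) True"])
          (simp_all add: p replicate_add)
      finally show ?thesis .
    qed
    show "cyl_s_bar sA sB p q j x = onf (p + 1 + j + 1) 0 (unit True) x" if "j \<le> q"
    proof -
      from that obtain r where q: "q = j + r" using le_Suc_ex by blast
      have "cyl_s_bar sA sB p q j x = insert_letter sA sB (p + 1 + j + 1) (unit_letter True) x"
        by (simp add: cyl_s_bar_def unit_letter_def)
      also have "\<dots> = onf (p + 1 + j + 1) 0 (unit True) x"
        by (rule insert_letter_onf[OF x, of "replicate (p + 1) False @ replicate (j + 1) True" "replicate r True"])
          (simp_all add: q replicate_add)
      finally show ?thesis .
    qed
    show "cyl_t sA sB R p q x = flip (p + q + 1) (sweep_at R p (q + 1) x)"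
      using sweep_at_onf[OF linear_R, of p "replicate p False" x _ "q + 1" "[]"] x
      by (simp add: cyl_t_def Theta_def sweep_eq_sweep_at replicate_app_Cons_same del: sweep_at.simps)
    have "flip (p + q + 1) x \<in> T (True # replicate (p + 1) False @ replicate q True)"
      by (rule arr_mem[OF arr_flip[of _ "replicate (p + 1) False @ replicate q True" _ "[True]"] x])
        (simp_all add: replicate_append_same)
    from sweep_at_onf[OF arr_R' _ this, of 0 "[]" "p + 1" "replicate q True"]
    show "cyl_t_bar sA sB R p q x = sweep_at R' 0 (p + 1) (flip (p + q + 1) x)"
      by (simp add: cyl_t_bar_def Gamma_def sweep_eq_sweep_at R'_def del: sweep_at.simps)
  qed
qed

end

theorem proposition2p5:
  fixes sA :: "'k::field_char_0 \<Rightarrow> 'a::{ring,monoid_mult} \<Rightarrow> 'a"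
    and sB :: "'k \<Rightarrow> 'b::{ring,monoid_mult} \<Rightarrow> 'b"
    and R :: "('k, 'a, 'b) tensor \<Rightarrow> ('k, 'a, 'b) tensor"
  assumes "strong_smash_product sA sB R"
  shows "cylindrical_module tensor_scale (cyl_space sA sB)
    (cyl_d sA sB R) (cyl_s sA sB) (cyl_t sA sB R)
    (cyl_d_bar sA sB R) (cyl_s_bar sA sB) (cyl_t_bar sA sB R)"
  using assms by (rule strong_smash_product.cylindrical_smash_product)

end
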